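(* Let $g>0$, $\mu>0$, let $\bar\rho=\bar\rho(x_3)\in L^\infty(\mathbb{R})$ satisfy $\bar\rho'\in C_0^\infty(\mathbb{R})$, $\inf_{\mathbb{R}}\bar\rho>0$ and $\bar\rho'(x_3^0)>0$ for some $x_3^0$, and let $M$, $\mathcal A$, $\mathbb{A}^{\mathrm g}$ be as in the context. For each $\xi\in\mathbb{A}^{\mathrm g}$ there exist $\psi=\psi(\xi,x_3)\not\equiv0$ and $\lambda=\lambda(\xi)>0$ satisfying $$-\lambda^2[\bar\rho|\xi|^2\psi-(\bar\rho\psi')']=\lambda\mu(|\xi|^4\psi-2|\xi|^2\psi''+\psi'''')-g|\xi|^2\bar\rho'\psi+\begin{cases}M^2\xi_1^2(|\xi|^2\psi-\psi'')&\text{(horizontal case)}\\ M^2(\psi''''-|\xi|^2\psi'')&\text{(vertical case)}\end{cases}$$ on $\mathbb{R}$ and $\psi(\pm\infty)=\psi'(\pm\infty)=0$. Moreover $\psi\in H^\infty(\mathbb{R})\cap\mathcal A$, where $H^\infty(\mathbb{R})=\bigcap_{k\ge0}H^k(\mathbb{R})$.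
   Context: Functions $\psi$ are real-valued functions of $x_3\in\mathbb{R}$, $'=d/dx_3$, $\xi=(\xi_1,\xi_2)$. $M_{\mathrm c}:=\sqrt{\sup_{\psi\in H^1(\mathbb{R}),\psi\not\equiv0}\int g\bar\rho'\psi^2dx_3/\int|\psi'|^2dx_3}\in(0,\infty]$. Horizontal case: $M\neq0$ constant; for $0<|M\xi_1|/|\xi|<M_{\mathrm c}$, $S(\xi):=\sqrt{\sup_{\psi\in H^1,\psi\not\equiv0}(g|\xi|^2\int\bar\rho'\psi^2/(M\xi_1)^2-\int|\psi'|^2)/\int|\psi|^2}$; $\mathbb{A}^{\mathrm g}:=(\{\xi:|\xi_1M|/|\xi|\in(0,M_{\mathrm c}),|\xi|<S(\xi)\}\cup\{\xi_1=0\})\setminus\{\mathbf 0\}$. Vertical case: $M$ constant with $|M|\in(0,M_{\mathrm c})$; $\mathcal M_{\mathrm{vc}}:=\{\psi\in H^2:\int(g\bar\rho'\psi^2-M^2|\psi'|^2)>0\}$; $|\xi|^M_{\mathrm{vc}}:=\sqrt{\inf_{\psi\in\mathcal M_{\mathrm{vc}}}M^2\int|\psi''|^2/\int(g\bar\rho'\psi^2-M^2|\psi'|^2)}$; $\mathbb{A}^{\mathrm g}:=\{\xi:|\xi|>|\xi|^M_{\mathrm{vc}}\}$. In both cases $\mathcal A:=\{\psi\in H^2(\mathbb{R}):\int_{\mathbb{R}}\bar\rho(|\xi|^2\psi^2+|\psi'|^2)dx_3=1\}$. *)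

theory Defs
  imports "HOL-Analysis.Analysis"
begin

definition C_inf :: "(real \<Rightarrow> real) \<Rightarrow> bool" where
  "C_inf f \<longleftrightarrow> (\<forall>k x. ((deriv ^^ k) f) differentiable (at x))"

definition test_fun :: "(real \<Rightarrow> real) \<Rightarrow> bool" where
  "test_fun \<phi> \<longleftrightarrow> C_inf \<phi> \<and> compact (closure {x. \<phi> x \<noteq> 0})"

definition L2 :: "(real \<Rightarrow> real) set" where
  "L2 = {f. f \<in> borel_measurable lborel \<and> integrable lborel (\<lambda>x. (f x)\<^sup>2)}"

definition is_wderiv :: "(real \<Rightarrow> real) \<Rightarrow> (real \<Rightarrow> real) \<Rightarrow> bool" where
  "is_wderiv f g \<longleftrightarrow> (\<forall>\<phi>. test_fun \<phi> \<longrightarrow>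
      integrable lborel (\<lambda>x. f x * deriv \<phi> x) \<and> integrable lborel (\<lambda>x. g x * \<phi> x) \<and>
      (LINT x|lborel. f x * deriv \<phi> x) = - (LINT x|lborel. g x * \<phi> x))"

text \<open>The weak derivative (unique up to null sets, which is all that matters in integrals).\<close>
definition wd :: "(real \<Rightarrow> real) \<Rightarrow> (real \<Rightarrow> real)" where
  "wd f = (SOME g. is_wderiv f g)"

fun H :: "nat \<Rightarrow> (real \<Rightarrow> real) set" where
  "H 0 = L2"
| "H (Suc k) = {f \<in> L2. \<exists>g. is_wderiv f g \<and> g \<in> H k}"

definition H_inf :: "(real \<Rightarrow> real) set" where
  "H_inf = (\<Inter>k. H k)"

definition nonzero_fun :: "(real \<Rightarrow> real) \<Rightarrow> bool" where
  "nonzero_fun f \<longleftrightarrow> \<not> (AE x in lborel. f x = 0)"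

definition ereal_sqrt :: "ereal \<Rightarrow> ereal" where
  "ereal_sqrt x = (case x of ereal r \<Rightarrow> ereal (sqrt r) | PInfty \<Rightarrow> PInfty | MInfty \<Rightarrow> MInfty)"

definition Mc :: "real \<Rightarrow> (real \<Rightarrow> real) \<Rightarrow> ereal" where
  "Mc g rho = ereal_sqrt (SUP \<psi> \<in> {\<psi> \<in> H 1. nonzero_fun \<psi>}.
      ereal ((LINT x|lborel. g * deriv rho x * (\<psi> x)\<^sup>2) / (LINT x|lborel. \<bar>wd \<psi> x\<bar>\<^sup>2)))"

definition S_h :: "real \<Rightarrow> (real \<Rightarrow> real) \<Rightarrow> real \<Rightarrow> real \<times> real \<Rightarrow> ereal" where
  "S_h g rho M \<xi> = ereal_sqrt (SUP \<psi> \<in> {\<psi> \<in> H 1. nonzero_fun \<psi>}.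
      ereal ((g * (norm \<xi>)\<^sup>2 * (LINT x|lborel. deriv rho x * (\<psi> x)\<^sup>2) / (M * fst \<xi>)\<^sup>2
              - (LINT x|lborel. \<bar>wd \<psi> x\<bar>\<^sup>2)) / (LINT x|lborel. \<bar>\<psi> x\<bar>\<^sup>2)))"

definition Ag_h :: "real \<Rightarrow> (real \<Rightarrow> real) \<Rightarrow> real \<Rightarrow> (real \<times> real) set" where
  "Ag_h g rho M =
     ({\<xi>. 0 < ereal (\<bar>fst \<xi> * M\<bar> / norm \<xi>) \<and> ereal (\<bar>fst \<xi> * M\<bar> / norm \<xi>) < Mc g rho
           \<and> ereal (norm \<xi>) < S_h g rho M \<xi>} \<union> {\<xi>. fst \<xi> = 0}) - {0}"

definition M_vc :: "real \<Rightarrow> (real \<Rightarrow> real) \<Rightarrow> real \<Rightarrow> (real \<Rightarrow> real) set" where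
  "M_vc g rho M = {\<psi> \<in> H 2. (LINT x|lborel. g * deriv rho x * (\<psi> x)\<^sup>2 - M\<^sup>2 * \<bar>wd \<psi> x\<bar>\<^sup>2) > 0}"

definition xi_vc :: "real \<Rightarrow> (real \<Rightarrow> real) \<Rightarrow> real \<Rightarrow> ereal" where
  "xi_vc g rho M = ereal_sqrt (INF \<psi> \<in> M_vc g rho M.
      ereal (M\<^sup>2 * (LINT x|lborel. \<bar>wd (wd \<psi>) x\<bar>\<^sup>2)
             / (LINT x|lborel. g * deriv rho x * (\<psi> x)\<^sup>2 - M\<^sup>2 * \<bar>wd \<psi> x\<bar>\<^sup>2)))"

definition Ag_v :: "real \<Rightarrow> (real \<Rightarrow> real) \<Rightarrow> real \<Rightarrow> (real \<times> real) set" where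
  "Ag_v g rho M = {\<xi>. ereal (norm \<xi>) > xi_vc g rho M}"

datatype field_case = Horizontal | Vertical

definition admissible_M :: "real \<Rightarrow> (real \<Rightarrow> real) \<Rightarrow> field_case \<Rightarrow> real \<Rightarrow> bool" where
  "admissible_M g rho c M = (case c of
      Horizontal \<Rightarrow> M \<noteq> 0
    | Vertical \<Rightarrow> 0 < \<bar>M\<bar> \<and> ereal \<bar>M\<bar> < Mc g rho)"

definition Ag :: "real \<Rightarrow> (real \<Rightarrow> real) \<Rightarrow> field_case \<Rightarrow> real \<Rightarrow> (real \<times> real) set" where
  "Ag g rho c M = (case c of Horizontal \<Rightarrow> Ag_h g rho M | Vertical \<Rightarrow> Ag_v g rho M)"

definition A_set :: "(real \<Rightarrow> real) \<Rightarrow> real \<times> real \<Rightarrow> (real \<Rightarrow> real) set" where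
  "A_set rho \<xi> = {\<psi> \<in> H 2.
      (LINT x|lborel. rho x * ((norm \<xi>)\<^sup>2 * (\<psi> x)\<^sup>2 + \<bar>wd \<psi> x\<bar>\<^sup>2)) = 1}"

definition mag_term :: "field_case \<Rightarrow> real \<Rightarrow> real \<times> real \<Rightarrow> (real \<Rightarrow> real) \<Rightarrow> real \<Rightarrow> real" where
  "mag_term c M \<xi> \<psi> x = (case c of
      Horizontal \<Rightarrow> M\<^sup>2 * (fst \<xi>)\<^sup>2 * ((norm \<xi>)\<^sup>2 * \<psi> x - (deriv ^^ 2) \<psi> x)
    | Vertical \<Rightarrow> M\<^sup>2 * ((deriv ^^ 4) \<psi> x - (norm \<xi>)\<^sup>2 * (deriv ^^ 2) \<psi> x))"

end

theory Submission
  imports Defs "HOL-Complex_Analysis.Great_Picard"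
begin

text \<open>With \<open>k\<close> the length of \<open>\<xi>\<close>, a solution for the growth rate \<open>\<lambda>\<close> is a null vector of the
quadratic form
\<open>Q\<^sub>\<lambda>(f) = \<lambda>\<^sup>2 \<integral> rho (k\<^sup>2 f\<^sup>2 + f'\<^sup>2) + \<lambda> \<mu> \<integral> (f''\<^sup>2 + 2 k\<^sup>2 f'\<^sup>2 + k\<^sup>4 f\<^sup>2) + Mag(f) - g k\<^sup>2 \<integral> rho' f\<^sup>2\<close>,
where \<open>Mag\<close> is the magnetic energy. The form increases with \<open>\<lambda>\<close> and is nonnegative for large \<open>\<lambda>\<close>; the
hypothesis on \<open>\<xi>\<close> says that \<open>Q\<^sub>0\<close> takes a negative value. Let \<open>\<lambda>\<close> be the supremum of the rates at which
\<open>Q\<close> takes a negative value. Then \<open>Q\<^sub>\<lambda>\<close> is nonnegative, and there are normalised \<open>f\<^sub>n\<close> with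
\<open>Q\<^sub>\<lambda>(f\<^sub>n) \<longlonglongrightarrow> 0\<close> while \<open>\<integral> rho' f\<^sub>n\<^sup>2\<close> stays away from 0. By the Cauchy-Schwarz inequality for \<open>Q\<^sub>\<lambda>\<close> the
\<open>f\<^sub>n\<close> are asymptotically weak solutions, so a pointwise limit \<open>\<psi>\<close> of a subsequence is a weak solution,
nonzero because \<open>rho'\<close> has compact support. No weak compactness or completeness of \<open>L\<^sup>2\<close> is needed: all
derivatives of order greater than one are moved to the test function, and a du Bois-Reymond lemma of
third order gives back a classical solution.\<close>

section \<open>Smooth functions and test functions\<close>

text \<open>The growth rate enters linearly through viscosity and quadratically through inertia, so
  no single Rayleigh quotient has it as extremal value. Its description as a threshold replaces a
  parametrised extremal problem followed by a fixed point argument. The \<open>rho'\<close> term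
  stays away from 0 because it is the only negative one: where the form is negative it outweighs the
  viscous part, which controls the H^2 norm as long as the rates are bounded below. H^2 bounds make
  \<open>f\<^sub>n\<close> and its derivative bounded and equi-Hoelder of exponent 1/2, so both have
  pointwise limits along a subsequence, while the second derivatives need not; hence one more
  integration by parts and a test function with three derivatives. The other obstacle is regularity:
  the hypothesis on \<open>\<xi>\<close> concerns Sobolev functions with an arbitrarily chosen weak
  derivative, whereas the form is used on C^2 functions. Continuous representatives and moving
  averages bridge this gap, and the same averages bound the difference quotients by which the second
  derivative of the limit is seen to be square integrable.\<close>

fun ndiff :: "((real \<Rightarrow> real) \<Rightarrow> bool) \<Rightarrow> nat \<Rightarrow> (real \<Rightarrow> real) \<Rightarrow> bool" where
  "ndiff P 0 f \<longleftrightarrow> P f"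
| "ndiff P (Suc n) f \<longleftrightarrow> P f \<and> (\<exists>f'. (\<forall>x. (f has_real_derivative f' x) (at x)) \<and> ndiff P n f')"

lemma ndiff_SucI:
  assumes "P f" "\<And>x. (f has_real_derivative f' x) (at x)" "ndiff P n f'"
  shows "ndiff P (Suc n) f"
  using assms by auto

lemma ndiff_lower: "ndiff P (Suc n) f \<Longrightarrow> ndiff P n f"
proof (induction n arbitrary: f)
  case (Suc n)
  then show ?case by (metis ndiff.simps(2))
qed auto

lemma ndiff_mono: "ndiff P n f \<Longrightarrow> (\<And>f. P f \<Longrightarrow> Q f) \<Longrightarrow> ndiff Q n f"
  by (induction n arbitrary: f) auto

lemma ndiff_add:
  assumes "\<And>f g. P f \<Longrightarrow> P g \<Longrightarrow> P (\<lambda>x. f x + g x)"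
  shows "ndiff P n f \<Longrightarrow> ndiff P n g \<Longrightarrow> ndiff P n (\<lambda>x. f x + g x)"
proof (induction n arbitrary: f g)
  case (Suc n)
  then obtain f' g' where "\<And>x. (f has_real_derivative f' x) (at x)" "ndiff P n f'"
    "\<And>x. (g has_real_derivative g' x) (at x)" "ndiff P n g'"
    by auto
  then show ?case
    using Suc assms by (intro ndiff_SucI[where f' = "\<lambda>x. f' x + g' x"]) (auto intro!: derivative_eq_intros)
qed (use assms in auto)

text \<open>The two predicates differ on purpose: bounded coefficients (\<open>P\<close>) times
  square integrable functions (\<open>Q\<close>) stay square integrable, which the regularity
  bootstrap uses; smoothness is the case where both are trivially true.\<close>

lemma ndiff_mult:
  assumes "\<And>f g. P f \<Longrightarrow> Q g \<Longrightarrow> Q (\<lambda>x. f x * g x)" "\<And>f g. Q f \<Longrightarrow> Q g \<Longrightarrow> Q (\<lambda>x. f x + g x)"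
  shows "ndiff P n f \<Longrightarrow> ndiff Q n g \<Longrightarrow> ndiff Q n (\<lambda>x. f x * g x)"
proof (induction n arbitrary: f g)
  case (Suc n)
  then obtain f' g' where *: "\<And>x. (f has_real_derivative f' x) (at x)" "ndiff P n f'"
    "\<And>x. (g has_real_derivative g' x) (at x)" "ndiff Q n g'"
    by auto
  have "ndiff Q n (\<lambda>x. f x * g' x + f' x * g x)"
    using * Suc by (intro ndiff_add assms(2) Suc.IH) (auto simp del: ndiff.simps dest: ndiff_lower)
  with * show ?case
    using Suc.prems assms
    by (intro ndiff_SucI[where f' = "\<lambda>x. f x * g' x + f' x * g x"])
       (auto intro!: derivative_eq_intros simp: algebra_simps)
qed (use assms in auto)

lemma ndiff_mult_True:
  "ndiff (\<lambda>_. True) n f \<Longrightarrow> ndiff (\<lambda>_. True) n g \<Longrightarrow> ndiff (\<lambda>_. True) n (\<lambda>x. f x * g x)"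
  by (rule ndiff_mult[where P = "\<lambda>_. True"]) auto

lemma ndiff_const: "(\<And>c. P (\<lambda>_. c)) \<Longrightarrow> ndiff P n (\<lambda>_. c)"
proof (induction n arbitrary: c)
  case (Suc n)
  then show ?case by (intro ndiff_SucI[where f' = "\<lambda>_. 0"]) auto
qed auto

lemma ndiff_compose:
  "ndiff (\<lambda>_. True) n f \<Longrightarrow> ndiff (\<lambda>_. True) n g \<Longrightarrow> ndiff (\<lambda>_. True) n (\<lambda>x. f (g x))"
proof (induction n arbitrary: f)
  case (Suc n)
  then obtain f' g' where *: "\<And>x. (f has_real_derivative f' x) (at x)" "ndiff (\<lambda>_. True) n f'"
    "\<And>x. (g has_real_derivative g' x) (at x)" "ndiff (\<lambda>_. True) n g'"
    by auto
  have "ndiff (\<lambda>_. True) n (\<lambda>x. f' (g x) * g' x)"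
    using * Suc.prems(2) by (intro ndiff_mult_True[OF Suc.IH]) (auto simp del: ndiff.simps dest: ndiff_lower)
  with * show ?case
    by (intro ndiff_SucI[where f' = "\<lambda>x. f' (g x) * g' x"]) (auto intro: DERIV_chain2[of f])
qed auto

lemma C_inf_iff_ndiff: "C_inf f \<longleftrightarrow> (\<forall>n. ndiff (\<lambda>_. True) n f)"
proof -
  \<comment> \<open>Off by one: level n differentiates the iterates of order below n and asks
    nothing of the n-th.\<close>
  have "ndiff (\<lambda>_. True) n f \<longleftrightarrow> (\<forall>k<n. \<forall>x. ((deriv ^^ k) f) differentiable (at x))" for n
  proof (induction n arbitrary: f)
    case (Suc n)
    have "ndiff (\<lambda>_. True) (Suc n) f \<longleftrightarrow>
        (\<forall>x. f differentiable (at x)) \<and> ndiff (\<lambda>_. True) n (deriv f)"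
    proof safe
      fix x assume "ndiff (\<lambda>_. True) (Suc n) f"
      then obtain f' where f': "\<And>x. (f has_real_derivative f' x) (at x)" "ndiff (\<lambda>_. True) n f'"
        by auto
      show "f differentiable (at x)"
        using f' real_differentiable_def by blast
      have "deriv f = f'" using f' DERIV_imp_deriv by blast
      with f' show "ndiff (\<lambda>_. True) n (deriv f)" by simp
    next
      assume *: "\<forall>x. f differentiable (at x)" "ndiff (\<lambda>_. True) n (deriv f)"
      show "ndiff (\<lambda>_. True) (Suc n) f"
        using * by (intro ndiff_SucI[where f' = "deriv f"])
            (auto simp: DERIV_deriv_iff_real_differentiable)
    qed
    also have "\<dots> \<longleftrightarrow> (\<forall>k<Suc n. \<forall>x. ((deriv ^^ k) f) differentiable (at x))"
      unfolding Suc.IH by (auto simp: All_less_Suc2 funpow_Suc_right simp del: funpow.simps)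
    finally show ?case .
  qed auto
  then show ?thesis unfolding C_inf_def by (metis lessI)
qed

lemma C_inf_D:
  assumes "C_inf f"
  shows "(f has_real_derivative deriv f x) (at x)" "C_inf (deriv f)"
proof -
  show "(f has_real_derivative deriv f x) (at x)"
    using assms unfolding C_inf_def DERIV_deriv_iff_real_differentiable
    by (metis funpow_0)
  have "((deriv ^^ k) (deriv f)) = (deriv ^^ Suc k) f" for k
    by (simp add: funpow_swap1)
  then show "C_inf (deriv f)" using assms unfolding C_inf_def by metis
qed

lemma C_infI:
  assumes "\<And>x. (f has_real_derivative f' x) (at x)" "C_inf f'"
  shows "C_inf f"
  unfolding C_inf_iff_ndiff
proof
  fix n
  have "ndiff (\<lambda>_. True) (Suc n) f"
    using assms by (intro ndiff_SucI[of _ _ f']) (auto simp: C_inf_iff_ndiff)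
  then show "ndiff (\<lambda>_. True) n f" by (rule ndiff_lower)
qed

lemma C_inf_continuous: "C_inf f \<Longrightarrow> continuous_on S f"
  using C_inf_D(1) by (meson DERIV_continuous_on has_field_derivative_at_within)

lemma C_inf_const [simp]: "C_inf (\<lambda>_. c)"
  by (simp add: C_inf_iff_ndiff ndiff_const)

lemma C_inf_ident: "C_inf (\<lambda>x. x)"
  by (rule C_infI[where f' = "\<lambda>_. 1"]) auto

lemma C_inf_add: "C_inf f \<Longrightarrow> C_inf g \<Longrightarrow> C_inf (\<lambda>x. f x + g x)"
  by (simp add: C_inf_iff_ndiff ndiff_add)

lemma C_inf_mult: "C_inf f \<Longrightarrow> C_inf g \<Longrightarrow> C_inf (\<lambda>x. f x * g x)"
  unfolding C_inf_iff_ndiff by (blast intro: ndiff_mult_True)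

lemma C_inf_diff: "C_inf f \<Longrightarrow> C_inf g \<Longrightarrow> C_inf (\<lambda>x. f x - g x)"
  using C_inf_add[of f "\<lambda>x. (-1) * g x"] C_inf_mult[of "\<lambda>_. -1" g] by simp

lemma C_inf_compose: "C_inf f \<Longrightarrow> C_inf g \<Longrightarrow> C_inf (\<lambda>x. f (g x))"
  by (simp add: C_inf_iff_ndiff ndiff_compose)

lemma C_inf_inverse:
  assumes "C_inf f" "\<And>x. f x \<noteq> 0"
  shows "C_inf (\<lambda>x. inverse (f x))"
  unfolding C_inf_iff_ndiff
proof
  fix n show "ndiff (\<lambda>_. True) n (\<lambda>x. inverse (f x))"
  proof (induction n)
    case (Suc n)
    define m where "m = (\<lambda>x. - deriv f x)"
    have "C_inf m"
      using C_inf_mult[of "\<lambda>_. -1" "deriv f"] C_inf_D(2)[OF assms(1)] by (simp add: m_def)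
    then have "ndiff (\<lambda>_. True) n (\<lambda>x. m x * (inverse (f x) * inverse (f x)))"
      using Suc by (intro ndiff_mult_True) (auto simp: C_inf_iff_ndiff)
    then show ?case
      using assms C_inf_D(1)[OF assms(1)]
      by (intro ndiff_SucI[where f' = "\<lambda>x. m x * (inverse (f x) * inverse (f x))"])
         (auto intro!: derivative_eq_intros simp: m_def)
  qed auto
qed

section \<open>A smooth cutoff from the flat function exp(-1/x)\<close>

definition flat_exp :: "real poly \<Rightarrow> real \<Rightarrow> real" where
  "flat_exp p x = (if x > 0 then poly p (inverse x) * exp (- inverse x) else 0)"

lemma poly_mult_exp_minus_at_top: "((\<lambda>y::real. poly p y * exp (- y)) \<longlongrightarrow> 0) at_top"
proof -
  have "((\<lambda>y. (\<Sum>i\<le>degree p. coeff p i * (y ^ i / exp y))) \<longlongrightarrow> (\<Sum>i\<le>degree p. coeff p i * 0)) at_top"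
    by (intro tendsto_intros tendsto_power_div_exp_0)
  then show ?thesis
    by (simp add: poly_altdef sum_distrib_right exp_minus divide_inverse mult.assoc)
qed

text \<open>The polynomial factor in y = 1/x makes the family closed under differentiation: d/dx = -
  y^2 d/dy, and \<open>[:0,0,1:]\<close> is y^2. Smoothness of every member then follows by one
  induction.\<close>

lemma flat_exp_has_derivative:
  "(flat_exp p has_real_derivative flat_exp ([:0,0,1:] * (p - pderiv p)) x) (at x)"
proof -
  consider "x > 0" | "x < 0" | "x = 0" by linarith
  then show ?thesis
  proof cases
    case 1
    have "((\<lambda>x. poly p (inverse x) * exp (- inverse x)) has_real_derivative
         flat_exp ([:0,0,1:] * (p - pderiv p)) x) (at x)"
      using 1 by (auto intro!: derivative_eq_intros simp: flat_exp_def algebra_simps power2_eq_square)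
    then show ?thesis
      by (rule has_field_derivative_transform_within_open[where S = "{0<..}"])
         (use 1 in \<open>auto simp: flat_exp_def\<close>)
  next
    case 2
    have "((\<lambda>x. 0) has_real_derivative flat_exp ([:0,0,1:] * (p - pderiv p)) x) (at x)"
      using 2 by (auto simp: flat_exp_def)
    then show ?thesis
      by (rule has_field_derivative_transform_within_open[where S = "{..<0}"])
         (use 2 in \<open>auto simp: flat_exp_def\<close>)
  next
    case 3
    \<comment> \<open>\<open>pCons 0 p\<close> is y p(y): the difference quotient at 0 divides by h,
      that is, multiplies by y = 1/h.\<close>
    have "((\<lambda>y. poly (pCons 0 p) y * exp (- y)) \<longlongrightarrow> 0) at_top"
      by (rule poly_mult_exp_minus_at_top)
    then have "((\<lambda>h. poly (pCons 0 p) (inverse h) * exp (- inverse h)) \<longlongrightarrow> 0) (at_right 0)"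
      using filterlim_compose filterlim_inverse_at_top_right by blast
    then have r: "((\<lambda>h. flat_exp p h / h) \<longlongrightarrow> 0) (at_right 0)"
      by (rule Lim_transform_eventually)
         (auto simp: eventually_at_right_field flat_exp_def field_simps intro!: exI[of _ 1])
    have l: "((\<lambda>h. flat_exp p h / h) \<longlongrightarrow> 0) (at_left 0)"
      by (rule Lim_transform_eventually[OF tendsto_const])
         (auto simp: eventually_at_left_field flat_exp_def intro!: exI[of _ "-1"])
    show ?thesis
      using r l 3 by (simp add: DERIV_def flat_exp_def filterlim_split_at_real)
  qed
qed

lemma C_inf_flat_exp: "C_inf (flat_exp p)"
  unfolding C_inf_iff_ndiff
proof
  fix n show "ndiff (\<lambda>_. True) n (flat_exp p)"
    by (induction n arbitrary: p) (auto intro: flat_exp_has_derivative)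
qed

text \<open>The summand \<open>inverse (real (Suc n))\<close> keeps the denominator positive, hence
  the quotient smooth; as it tends to 0 the steps converge pointwise to the indicator of the
  positive half-line.\<close>

definition smooth_step :: "nat \<Rightarrow> real \<Rightarrow> real" where
  "smooth_step n x = flat_exp 1 x * inverse (flat_exp 1 x + inverse (real (Suc n)))"

definition smooth_ind :: "nat \<Rightarrow> real \<Rightarrow> real \<Rightarrow> real \<Rightarrow> real" where
  "smooth_ind n a b x = smooth_step n (x - a) * smooth_step n (b - x)"

lemma flat_exp_1_nonneg: "flat_exp 1 x \<ge> 0"
  by (simp add: flat_exp_def)

lemma smooth_step_bounds: "0 \<le> smooth_step n x" "smooth_step n x \<le> 1"
  using flat_exp_1_nonneg[of x] by (auto simp: smooth_step_def divide_simps add_nonneg_pos)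

lemma smooth_step_eq_0: "x \<le> 0 \<Longrightarrow> smooth_step n x = 0"
  by (simp add: smooth_step_def flat_exp_def)

lemma smooth_step_pos: "x > 0 \<Longrightarrow> smooth_step n x > 0"
  by (auto simp: smooth_step_def flat_exp_def intro!: mult_pos_pos add_pos_pos)

lemma smooth_step_tendsto: "x > 0 \<Longrightarrow> (\<lambda>n. smooth_step n x) \<longlonglongrightarrow> 1"
proof -
  assume "x > 0"
  then have *: "flat_exp 1 x \<noteq> 0" by (simp add: flat_exp_def)
  have "(\<lambda>n. flat_exp 1 x * inverse (flat_exp 1 x + inverse (real (Suc n)))) \<longlonglongrightarrow>
      flat_exp 1 x * inverse (flat_exp 1 x + 0)"
    using * by (intro tendsto_intros LIMSEQ_inverse_real_of_nat) auto
  then show ?thesis using * by (simp add: smooth_step_def)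
qed

lemma C_inf_smooth_step: "C_inf (smooth_step n)"
  unfolding smooth_step_def
  using flat_exp_1_nonneg
  by (intro C_inf_mult C_inf_inverse C_inf_add C_inf_flat_exp C_inf_const)
     (metis add_nonneg_pos inverse_positive_iff_positive less_irrefl of_nat_0_less_iff zero_less_Suc)

lemma C_inf_smooth_ind: "C_inf (smooth_ind n a b)"
  unfolding smooth_ind_def
  by (intro C_inf_mult C_inf_compose[OF C_inf_smooth_step] C_inf_diff C_inf_ident C_inf_const)

lemma smooth_ind_bounds: "0 \<le> smooth_ind n a b x" "smooth_ind n a b x \<le> indicator {a<..<b} x"
  using smooth_step_bounds[of n] smooth_step_eq_0[of _ n]
  by (auto simp: smooth_ind_def indicator_def intro!: mult_nonneg_nonneg mult_le_one)

lemma smooth_ind_pos: "a < x \<Longrightarrow> x < b \<Longrightarrow> smooth_ind n a b x > 0"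
  by (simp add: smooth_ind_def smooth_step_pos)

lemma smooth_ind_eq_0: "x \<notin> {a<..<b} \<Longrightarrow> smooth_ind n a b x = 0"
  using smooth_ind_bounds[of n a b x] by auto

lemma smooth_ind_tendsto: "(\<lambda>n. smooth_ind n a b x) \<longlonglongrightarrow> indicator {a<..<b} x"
proof (cases "x \<in> {a<..<b}")
  case True
  have "(\<lambda>n. smooth_step n (x - a) * smooth_step n (b - x)) \<longlonglongrightarrow> 1 * 1"
    using True by (intro tendsto_intros smooth_step_tendsto) auto
  then show ?thesis using True by (simp add: smooth_ind_def)
qed (simp add: smooth_ind_eq_0)

lemma test_funI:
  assumes "C_inf f" "\<And>x. x \<notin> {a..b} \<Longrightarrow> f x = 0"
  shows "test_fun f"
proof -
  have "closure {x. f x \<noteq> 0} \<subseteq> {a..b}"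
    using assms(2) by (intro closure_minimal) blast+
  then have "compact (closure {x. f x \<noteq> 0})"
    by (meson bounded_closed_interval bounded_subset closed_closure compact_eq_bounded_closed)
  with assms show ?thesis by (simp add: test_fun_def)
qed

lemma compact_supportE:
  assumes "compact (closure {x::real. f x \<noteq> (0::real)})"
  obtains N where "N > 0" "\<And>x. N \<le> \<bar>x\<bar> \<Longrightarrow> f x = 0"
proof -
  have "bounded {x. f x \<noteq> 0}"
    using assms bounded_subset closure_subset compact_imp_bounded by metis
  then obtain N where "N > 0" "\<And>x. f x \<noteq> 0 \<Longrightarrow> \<bar>x\<bar> < N"
    by (auto simp: bounded_pos_less)
  then show ?thesis by (intro that[of N]) force+
qed

lemma test_fun_smooth_ind: "test_fun (smooth_ind n a b)"
  by (rule test_funI[OF C_inf_smooth_ind, of a b]) (auto simp: smooth_ind_eq_0)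

section \<open>Weak derivatives\<close>

lemma ex_antiderivative:
  fixes f :: "real \<Rightarrow> real"
  assumes "continuous_on UNIV f"
  obtains F where "\<And>x. (F has_real_derivative f x) (at x)" "F c = 0"
proof -
  have "\<exists>F. \<forall>x::real. -\<infinity> < ereal x \<longrightarrow> ereal x < \<infinity> \<longrightarrow> (F has_vector_derivative f x) (at x)"
    using assms by (intro einterval_antiderivative) (auto simp: continuous_on_eq_continuous_at)
  then obtain F where "\<And>x. (F has_real_derivative f x) (at x)"
    by (auto simp: has_real_derivative_iff_has_vector_derivative)
  then show ?thesis
    by (intro that[of "\<lambda>x. F x - F c"]) (auto intro!: derivative_eq_intros)
qed

lemma integrable_Icc_mult:
  fixes f :: "real \<Rightarrow> real"
  assumes "continuous_on UNIV f"
  shows "integrable lborel (\<lambda>x. indicator {a..b} x * f x)"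
  using borel_integrable_compact[OF compact_Icc, of a b f] assms
  by (auto intro: continuous_on_subset)

lemma LINT_FTC:
  fixes f F :: "real \<Rightarrow> real"
  assumes "a \<le> b" "\<And>x. (F has_real_derivative f x) (at x)" "continuous_on UNIV f"
  shows "(LINT x|lborel. indicator {a..b} x * f x) = F b - F a"
  using integral_FTC_atLeastAtMost[of a b F f] assms
  by (auto intro: continuous_on_subset has_vector_derivative_at_within
      simp: has_real_derivative_iff_has_vector_derivative)

lemma LINT_FTC_supp:
  fixes f F :: "real \<Rightarrow> real"
  assumes "a \<le> b" "\<And>x. (F has_real_derivative f x) (at x)" "continuous_on UNIV f"
    "\<And>x. x \<notin> {a..b} \<Longrightarrow> f x = 0"
  shows "integrable lborel f" "(LINT x|lborel. f x) = F b - F a"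
proof -
  have eq: "(\<lambda>x. indicator {a..b} x * f x) = f"
    using assms(4) by (force simp: indicator_def)
  show "integrable lborel f" "(LINT x|lborel. f x) = F b - F a"
    using integrable_Icc_mult[of f a b] LINT_FTC[OF assms(1-3)] assms(3) unfolding eq by auto
qed

lemma test_funE:
  assumes "test_fun f"
  obtains N where "N > 0" "\<And>x. N \<le> \<bar>x\<bar> \<Longrightarrow> f x = 0" "\<And>x. N \<le> \<bar>x\<bar> \<Longrightarrow> deriv f x = 0"
proof -
  obtain N where N: "N > 0" "\<And>x. N \<le> \<bar>x\<bar> \<Longrightarrow> f x = 0"
    using assms compact_supportE unfolding test_fun_def by metis
  \<comment> \<open>\<open>N + 1\<close> puts the point strictly outside \<open>{-N..N}\<close>, so
    f vanishes in a neighbourhood and the derivative is 0 too.\<close>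
  have "deriv f x = 0" if "N + 1 \<le> \<bar>x\<bar>" for x
  proof -
    have "((\<lambda>_. 0) has_real_derivative 0) (at x)" by simp
    then have "(f has_real_derivative 0) (at x)"
      by (rule has_field_derivative_transform_within_open[where S = "- {-N..N}"])
         (use that N in \<open>auto simp: abs_if split: if_splits\<close>)
    then show ?thesis by (rule DERIV_imp_deriv)
  qed
  with N show ?thesis by (intro that[of "N + 1"]) auto
qed

lemma integrable_mult_test_fun:
  assumes "continuous_on UNIV f" "test_fun \<phi>"
  shows "integrable lborel (\<lambda>x. f x * \<phi> x)" "integrable lborel (\<lambda>x. f x * deriv \<phi> x)"
proof -
  obtain N where N: "N > 0" "\<And>x. N \<le> \<bar>x\<bar> \<Longrightarrow> \<phi> x = 0" "\<And>x. N \<le> \<bar>x\<bar> \<Longrightarrow> deriv \<phi> x = 0"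
    using test_funE[OF assms(2)] by blast
  have *: "C_inf \<phi>" using assms(2) by (simp add: test_fun_def)
  have N': "\<phi> x = 0 \<and> deriv \<phi> x = 0" if "\<not> (-N \<le> x \<and> x \<le> N)" for x
    using N that by (cases "N \<le> \<bar>x\<bar>") auto
  have 1: "(\<lambda>x. indicator {-N..N} x * (f x * \<phi> x)) = (\<lambda>x. f x * \<phi> x)"
    "(\<lambda>x. indicator {-N..N} x * (f x * deriv \<phi> x)) = (\<lambda>x. f x * deriv \<phi> x)"
    using N' by (auto simp: indicator_def fun_eq_iff)
  have "continuous_on UNIV (\<lambda>x. f x * \<phi> x)" "continuous_on UNIV (\<lambda>x. f x * deriv \<phi> x)"
    using continuous_on_mult[OF assms(1) C_inf_continuous[OF *]]
      continuous_on_mult[OF assms(1) C_inf_continuous[OF C_inf_D(2)[OF *]]] by auto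
  from this[THEN integrable_Icc_mult[of _ "-N" N]]
  show "integrable lborel (\<lambda>x. f x * \<phi> x)" "integrable lborel (\<lambda>x. f x * deriv \<phi> x)"
    unfolding 1 by this
qed

lemma is_wderiv_C1:
  assumes "\<And>x. (f has_real_derivative f' x) (at x)" "continuous_on UNIV f'"
  shows "is_wderiv f f'"
  unfolding is_wderiv_def
proof (intro allI impI)
  fix \<phi> assume \<phi>: "test_fun \<phi>"
  have f: "continuous_on UNIV f"
    using assms(1) by (meson DERIV_continuous_on has_field_derivative_at_within)
  have *: "C_inf \<phi>" using \<phi> by (simp add: test_fun_def)
  obtain N where N: "N > 0" "\<And>x. N \<le> \<bar>x\<bar> \<Longrightarrow> \<phi> x = 0" "\<And>x. N \<le> \<bar>x\<bar> \<Longrightarrow> deriv \<phi> x = 0"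
    using test_funE[OF \<phi>] by blast
  note int = integrable_mult_test_fun[OF f \<phi>] integrable_mult_test_fun[OF assms(2) \<phi>]
  have "(LINT x|lborel. f x * deriv \<phi> x + f' x * \<phi> x) = f N * \<phi> N - f (-N) * \<phi> (-N)"
  proof (intro LINT_FTC_supp(2)[where F = "\<lambda>x. f x * \<phi> x"])
    show "((\<lambda>x. f x * \<phi> x) has_real_derivative f x * deriv \<phi> x + f' x * \<phi> x) (at x)" for x
      using assms(1) C_inf_D(1)[OF *] by (auto intro!: derivative_eq_intros)
    show "continuous_on UNIV (\<lambda>x. f x * deriv \<phi> x + f' x * \<phi> x)"
      by (intro continuous_on_add continuous_on_mult f assms(2) C_inf_continuous[OF *]
          C_inf_continuous[OF C_inf_D(2)[OF *]])
    show "f x * deriv \<phi> x + f' x * \<phi> x = 0" if "x \<notin> {-N..N}" for x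
      using N that by (cases "N \<le> \<bar>x\<bar>") auto
  qed (use N in auto)
  also have "\<dots> = 0" using N by simp
  finally show "integrable lborel (\<lambda>x. f x * deriv \<phi> x) \<and> integrable lborel (\<lambda>x. f' x * \<phi> x) \<and>
      (LINT x|lborel. f x * deriv \<phi> x) = - (LINT x|lborel. f' x * \<phi> x)"
    using int by simp
qed

section \<open>The fundamental lemma of the calculus of variations\<close>

lemma integrable_mult_Icc_if_test:
  assumes "\<And>\<phi>. test_fun \<phi> \<Longrightarrow> integrable lborel (\<lambda>x. h x * \<phi> x)"
  shows "integrable lborel (\<lambda>x. indicator {a..b} x * h x)"
proof -
  define \<phi> where "\<phi> = smooth_ind 0 (a - 1) (b + 1)"
  have cont: "continuous_on S \<phi>" for S unfolding \<phi>_def by (intro C_inf_continuous C_inf_smooth_ind)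
  have pos: "\<phi> x > 0" if "x \<in> {a..b}" for x
    using that unfolding \<phi>_def by (intro smooth_ind_pos) auto
  have 1: "integrable lborel (\<lambda>x. h x * \<phi> x)"
    unfolding \<phi>_def by (intro assms test_fun_smooth_ind)
  have [measurable]: "\<phi> \<in> borel_measurable borel"
    using cont by (rule borel_measurable_continuous_onI)
  show ?thesis
  proof (cases "a \<le> b")
    case True
    \<comment> \<open>The cutoff has a positive minimum on the interval, so |h| is at most |h
      \<phi>| / \<phi>(c) there. Measurability of h on the interval is recovered by dividing the
      integrable product by \<phi>.\<close>
    obtain c where c: "c \<in> {a..b}" "\<And>x. x \<in> {a..b} \<Longrightarrow> \<phi> c \<le> \<phi> x"
      using continuous_attains_inf[of "{a..b}" \<phi>] True cont by auto
    have eq: "(\<lambda>x. indicator {a..b} x * h x) = (\<lambda>x. (h x * \<phi> x) * (indicator {a..b} x * inverse (\<phi> x)))"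
      using pos by (force simp: indicator_def fun_eq_iff)
    show ?thesis
    proof (rule Bochner_Integration.integrable_bound)
      show "integrable lborel (\<lambda>x. h x * \<phi> x * inverse (\<phi> c))"
        using 1 by simp
      show "(\<lambda>x. indicator {a..b} x * h x) \<in> borel_measurable lborel"
        unfolding eq by (rule borel_measurable_times[OF borel_measurable_integrable[OF 1]]) measurable
      have "\<bar>h x\<bar> * 1 \<le> \<bar>h x\<bar> * \<bar>\<phi> x * inverse (\<phi> c)\<bar>" if "x \<in> {a..b}" for x
        using c pos[of c] pos[of x] that by (intro mult_left_mono) (auto simp: divide_simps)
      then show "AE x in lborel. norm (indicator {a..b} x * h x) \<le> norm (h x * \<phi> x * inverse (\<phi> c))"
        by (intro AE_I2) (auto simp: abs_mult indicator_def mult.assoc)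
    qed
  qed simp
qed

text \<open>Open intervals generate the Borel sets and are stable under intersection, so vanishing
  integrals pass to every Borel set by Dynkin's induction; the density is then determined almost
  everywhere.\<close>

lemma AE_zero_if_LINT_intervals:
  fixes h :: "real \<Rightarrow> real"
  assumes h: "integrable lborel h"
    and zero: "\<And>a b. a < b \<Longrightarrow> (LINT x|lborel. indicator {a<..<b} x * h x) = 0"
  shows "AE x in lborel. h x = 0"
proof (rule density_unique_real[OF h integrable_zero])
  let ?G = "range (\<lambda>(a,b). {a<..<b::real})"
  note [measurable] = borel_measurable_integrable[OF h]
  have int: "integrable lborel (\<lambda>x. indicator A x * h x)" if "A \<in> sets borel" for A
    using integrable_mult_indicator[of A lborel h] h that by simp
  \<comment> \<open>For complements in the induction: the integral over the line is a limit of
    integrals over symmetric intervals.\<close>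
  have all: "(LINT x|lborel. h x) = 0"
  proof -
    have "(\<lambda>n. (LINT x|lborel. indicator {- real (Suc n)<..<real (Suc n)} x * h x)) \<longlonglongrightarrow> (LINT x|lborel. h x)"
    proof (rule integral_dominated_convergence)
      show "AE x in lborel. (\<lambda>n. indicator {- real (Suc n)<..<real (Suc n)} x * h x) \<longlonglongrightarrow> h x"
      proof (intro AE_I2)
        fix x :: real
        obtain n where n: "\<bar>x\<bar> < real n" using reals_Archimedean2 by blast
        have "eventually (\<lambda>n. indicator {- real (Suc n)<..<real (Suc n)} x * h x = h x) sequentially"
          using eventually_ge_at_top[of n] by eventually_elim (use n in \<open>auto simp: indicator_def\<close>)
        then show "(\<lambda>n. indicator {- real (Suc n)<..<real (Suc n)} x * h x) \<longlonglongrightarrow> h x"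
          by (rule tendsto_eventually)
      qed
      show "integrable lborel (\<lambda>x. \<bar>h x\<bar>)" using h by simp
    qed (auto simp: indicator_def)
    then show ?thesis by (simp add: zero LIMSEQ_const_iff)
  qed
  fix A :: "real set" assume "A \<in> sets lborel"
  then have mem: "A \<in> sigma_sets UNIV ?G"
    by (simp add: borel_eq_box box_real)
  have "Int_stable ?G" by (auto simp: Int_stable_def)
  moreover have "?G \<subseteq> Pow UNIV" by simp
  ultimately have "A \<in> sets borel \<and> (LINT x|lborel. indicator A x * h x) = 0"
    using mem
  proof (induction rule: sigma_sets_induct_disjoint[consumes 3, case_names basic empty compl union])
    case (basic A)
    then obtain a b where A: "A = {a<..<b}" by auto
    then show ?case using zero[of a b] by (cases "a < b") auto
  next
    case (compl A)
    have "(LINT x|lborel. indicator (UNIV - A) x * h x) = (LINT x|lborel. h x - indicator A x * h x)"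
      by (intro Bochner_Integration.integral_cong) (auto simp: indicator_def)
    also have "\<dots> = 0" using compl all h int by simp
    finally show ?case using compl by auto
  next
    case (union A)
    have UN: "(\<Union>i. A i) \<in> sets borel" using union by auto
    have "(LINT x:(\<Union>i. A i)|lborel. h x) = (\<Sum>i. (LINT x:A i|lborel. h x))"
      using union int int[OF UN]
      by (intro lebesgue_integral_countable_add)
         (auto simp: set_integrable_def disjoint_family_on_def)
    also have "\<dots> = 0" using union by (simp add: set_lebesgue_integral_def)
    finally show ?case using union by (auto simp: set_lebesgue_integral_def)
  qed simp
  then show "(LINT x:A|lborel. h x) = (LINT x:A|lborel. 0)"
    by (simp add: set_lebesgue_integral_def)
qed

text \<open>Smooth cutoffs converge to the indicator of an interval, so dominated convergence turns
  vanishing against test functions into vanishing interval integrals. As h is only locally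
  integrable, the conclusion is drawn for its truncations to \<open>{- real n<..<real n}\<close> and
  then for all n at once.\<close>

lemma AE_zero_if_test:
  assumes int: "\<And>\<phi>. test_fun \<phi> \<Longrightarrow> integrable lborel (\<lambda>x. h x * \<phi> x)"
    and zero: "\<And>\<phi>. test_fun \<phi> \<Longrightarrow> (LINT x|lborel. h x * \<phi> x) = 0"
  shows "AE x in lborel. h x = 0"
proof -
  note loc = integrable_mult_Icc_if_test[OF int]
  have ab: "(LINT x|lborel. indicator {a<..<b} x * h x) = 0" if "a < b" for a b
  proof -
    have m: "(\<lambda>x. indicator {a..b} x * h x) \<in> borel_measurable borel"
      using borel_measurable_integrable[OF loc[of a b]] by simp
    have "(\<lambda>n. LINT x|lborel. h x * smooth_ind n a b x) \<longlonglongrightarrow> (LINT x|lborel. indicator {a<..<b} x * h x)"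
    proof (rule integral_dominated_convergence)
      have "(\<lambda>x. indicator {a<..<b} x * h x) = (\<lambda>x. indicator {a<..<b} x * (indicator {a..b} x * h x))"
        by (auto simp: indicator_def)
      then show "(\<lambda>x. indicator {a<..<b} x * h x) \<in> borel_measurable lborel"
        using m by simp
      show "integrable lborel (\<lambda>x. \<bar>indicator {a..b} x * h x\<bar>)"
        using loc[of a b] by simp
      show "(\<lambda>x. h x * smooth_ind n a b x) \<in> borel_measurable lborel" for n
        by (intro borel_measurable_integrable int test_fun_smooth_ind)
      show "AE x in lborel. (\<lambda>n. h x * smooth_ind n a b x) \<longlonglongrightarrow> indicator {a<..<b} x * h x"
      proof (intro AE_I2)
        fix x
        have "(\<lambda>n. h x * smooth_ind n a b x) \<longlonglongrightarrow> h x * indicator {a<..<b} x"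
          by (intro tendsto_intros smooth_ind_tendsto)
        then show "(\<lambda>n. h x * smooth_ind n a b x) \<longlonglongrightarrow> indicator {a<..<b} x * h x"
          by (simp add: mult.commute)
      qed
      show "AE x in lborel. norm (h x * smooth_ind n a b x) \<le> \<bar>indicator {a..b} x * h x\<bar>" for n
      proof (intro AE_I2)
        fix x
        have "\<bar>h x\<bar> * smooth_ind n a b x \<le> \<bar>h x\<bar> * indicator {a..b} x"
          using smooth_ind_bounds[of n a b x]
          by (intro mult_left_mono) (auto simp: indicator_def of_bool_def split: if_splits)
        then show "norm (h x * smooth_ind n a b x) \<le> \<bar>indicator {a..b} x * h x\<bar>"
          using smooth_ind_bounds(1)[of n a b x] by (simp add: abs_mult mult.commute)
      qed
    qed
    then show ?thesis by (simp add: zero test_fun_smooth_ind LIMSEQ_const_iff)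
  qed
  have "AE x in lborel. indicator {- real n<..<real n} x * h x = 0" for n
  proof (rule AE_zero_if_LINT_intervals)
    have "(\<lambda>x. indicator {- real n<..<real n} x * h x) =
        (\<lambda>x. indicator {- real n<..<real n} x * (indicator {- real n..real n} x * h x))"
      by (auto simp: indicator_def)
    then show "integrable lborel (\<lambda>x. indicator {- real n<..<real n} x * h x)"
      using integrable_mult_indicator[of "{- real n<..<real n}" lborel "\<lambda>x. indicator {- real n..real n} x * h x"]
        loc[of "- real n" "real n"] by simp
    fix a b :: real assume "a < b"
    have "(\<lambda>x. indicator {a<..<b} x * (indicator {- real n<..<real n} x * h x)) =
       (\<lambda>x. indicator {max a (- real n)<..<min b (real n)} x * h x)"
      by (auto simp: indicator_def)
    then show "(LINT x|lborel. indicator {a<..<b} x * (indicator {- real n<..<real n} x * h x)) = 0"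
      using ab[of "max a (- real n)" "min b (real n)"]
      by (cases "max a (- real n) < min b (real n)") auto
  qed
  then have "AE x in lborel. \<forall>n. indicator {- real n<..<real n} x * h x = 0"
    unfolding AE_all_countable by blast
  then show ?thesis
  proof eventually_elim
    case (elim x)
    obtain n where "\<bar>x\<bar> < real n" using reals_Archimedean2 by blast
    with elim[rule_format, of n] show ?case by (auto simp: indicator_def split: if_splits)
  qed
qed

text \<open>This is what makes the arbitrary choice in \<open>wd\<close> harmless inside
  integrals.\<close>

lemma is_wderiv_unique:
  assumes "is_wderiv f g" "is_wderiv f g'"
  shows "AE x in lborel. g x = g' x"
proof -
  have "AE x in lborel. g x - g' x = 0"
  proof (rule AE_zero_if_test)
    fix \<phi> assume "test_fun \<phi>"
    then have "integrable lborel (\<lambda>x. g x * \<phi> x)" "integrable lborel (\<lambda>x. g' x * \<phi> x)"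
       "(LINT x|lborel. g x * \<phi> x) = (LINT x|lborel. g' x * \<phi> x)"
      using assms unfolding is_wderiv_def by (auto simp: minus_equation_iff)
    then show "integrable lborel (\<lambda>x. (g x - g' x) * \<phi> x)" "(LINT x|lborel. (g x - g' x) * \<phi> x) = 0"
      by (auto simp: left_diff_distrib)
  qed
  then show ?thesis by simp
qed

lemma borel_measurable_if_test:
  assumes "\<And>\<phi>. test_fun \<phi> \<Longrightarrow> integrable lborel (\<lambda>x. h x * \<phi> x)"
  shows "h \<in> borel_measurable borel"
proof (rule borel_measurable_LIMSEQ_real)
  show "(\<lambda>x. indicator {- real n..real n} x * h x) \<in> borel_measurable borel" for n
    using borel_measurable_integrable[OF integrable_mult_Icc_if_test[OF assms]] by simp
  fix x :: real
  obtain n where n: "\<bar>x\<bar> < real n" using reals_Archimedean2 by blast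
  have "eventually (\<lambda>n. indicator {- real n..real n} x * h x = h x) sequentially"
    using eventually_ge_at_top[of n] by eventually_elim (use n in \<open>auto simp: indicator_def\<close>)
  then show "(\<lambda>n. indicator {- real n..real n} x * h x) \<longlonglongrightarrow> h x"
    by (rule tendsto_eventually)
qed

lemma AE_zero_continuous:
  fixes f :: "real \<Rightarrow> real"
  assumes "continuous_on UNIV f" "AE x in lborel. f x = 0"
  shows "f x = 0"
proof (rule ccontr)
  assume "f x \<noteq> 0"
  have "open {x. f x \<noteq> 0}"
    using open_Collect_neq[OF assms(1) continuous_on_const] .
  then obtain e where e: "e > 0" "ball x e \<subseteq> {x. f x \<noteq> 0}"
    using \<open>f x \<noteq> 0\<close> by (auto simp: open_contains_ball)
  have "f y \<noteq> 0" if "y \<in> {x<..<x+e}" for y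
    using e that by (auto simp: dist_real_def subset_eq)
  then have "AE y in lborel. y \<notin> {x<..<x+e}"
    using assms(2) by (auto elim!: eventually_mono)
  then have "emeasure lborel {x<..<x+e} = 0"
    by (subst (asm) AE_iff_measurable[of "{x<..<x+e}"]) auto
  then show False using e by simp
qed

lemma antiderivative_support:
  fixes f F :: "real \<Rightarrow> real"
  assumes F: "\<And>x. (F has_real_derivative f x) (at x)" "F a = 0" "F b = 0"
    and f: "\<And>x. x \<notin> {a..b} \<Longrightarrow> f x = 0" and x: "x \<notin> {a..b}"
  shows "F x = 0"
proof -
  consider "x < a" | "x > b" using x by fastforce
  then show ?thesis
  proof cases
    case 1
    obtain z where "x < z" "z < a" "F a - F x = (a - x) * f z"
      using MVT2[of x a F f] 1 F by auto
    then show ?thesis using f[of z] F by auto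
  next
    case 2
    obtain z where "b < z" "z < x" "F x - F b = (x - b) * f z"
      using MVT2[of b x F f] 2 F by auto
    then show ?thesis using f[of z] F by auto
  qed
qed

text \<open>A test function of integral zero is the derivative of a test function, namely of its
  compactly supported antiderivative. Any other test function is brought to integral zero by
  subtracting a multiple of one fixed bump \<eta>; that multiple produces the constant.\<close>

lemma AE_const_if_test_deriv:
  assumes int: "\<And>\<phi>. test_fun \<phi> \<Longrightarrow> integrable lborel (\<lambda>x. h x * \<phi> x)"
    and zero: "\<And>\<phi>. test_fun \<phi> \<Longrightarrow> (LINT x|lborel. h x * deriv \<phi> x) = 0"
  obtains c where "AE x in lborel. h x = c"
proof -
  define \<eta> where "\<eta> = smooth_ind 0 0 1"
  have \<eta>: "test_fun \<eta>" "C_inf \<eta>" unfolding \<eta>_def by (simp_all add: test_fun_smooth_ind C_inf_smooth_ind)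
  have int1: "integrable lborel \<phi>" if "test_fun \<phi>" for \<phi>
    using integrable_mult_test_fun(1)[of "\<lambda>_. 1" \<phi>] that by simp
  define I where "I = (LINT x|lborel. \<eta> x)"
  have "I \<noteq> 0"
  proof
    assume "I = 0"
    then have "AE x in lborel. \<eta> x = 0"
      using integral_nonneg_eq_0_iff_AE[OF int1[OF \<eta>(1)]] smooth_ind_bounds(1) by (simp add: I_def \<eta>_def)
    from AE_zero_continuous[OF C_inf_continuous[OF \<eta>(2)] this, of "1/2"] smooth_ind_pos[of 0 "1/2" 1 0]
    show False by (simp add: \<eta>_def)
  qed
  define c where "c = (LINT x|lborel. h x * \<eta> x) / I"
  have "AE x in lborel. h x - c = 0"
  proof (rule AE_zero_if_test)
    fix \<phi> assume \<phi>: "test_fun \<phi>"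
    then have C\<phi>: "C_inf \<phi>" by (simp add: test_fun_def)
    show int': "integrable lborel (\<lambda>x. (h x - c) * \<phi> x)"
      using int[OF \<phi>] int1[OF \<phi>] by (simp add: left_diff_distrib)
    define J where "J = (LINT x|lborel. \<phi> x)"
    define \<theta> where "\<theta> = (\<lambda>x. \<phi> x - J / I * \<eta> x)"
    have C\<theta>: "C_inf \<theta>"
      unfolding \<theta>_def by (intro C_inf_diff C_inf_mult \<eta> C_inf_const C\<phi>)
    obtain N1 where N1: "N1 > 0" "\<And>x. N1 \<le> \<bar>x\<bar> \<Longrightarrow> \<phi> x = 0" using test_funE[OF \<phi>] by metis
    obtain N2 where N2: "N2 > 0" "\<And>x. N2 \<le> \<bar>x\<bar> \<Longrightarrow> \<eta> x = 0" using test_funE[OF \<eta>(1)] by metis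
    define N where "N = max N1 N2"
    have N: "N > 0" "\<And>x. N \<le> \<bar>x\<bar> \<Longrightarrow> \<theta> x = 0" using N1 N2 by (auto simp: N_def \<theta>_def)
    obtain F where F: "\<And>x. (F has_real_derivative \<theta> x) (at x)" "F (-N) = 0"
      using ex_antiderivative[of \<theta> "-N"] C_inf_continuous[OF C\<theta>] by blast
    have "(LINT x|lborel. \<theta> x) = 0"
      using int1[OF \<phi>] int1[OF \<eta>(1)] \<open>I \<noteq> 0\<close> by (simp add: \<theta>_def J_def I_def)
    moreover have "(LINT x|lborel. \<theta> x) = F N - F (-N)"
      using N F C_inf_continuous[OF C\<theta>] by (intro LINT_FTC_supp) auto
    ultimately have FN: "F N = 0" using F by simp
    have \<theta>0: "\<theta> x = 0" if "x \<notin> {-N..N}" for x using that by (intro N(2)) auto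
    have "F x = 0" if "x \<notin> {-N..N}" for x
      using antiderivative_support[OF F FN _ that] \<theta>0 by blast
    then have "test_fun F"
      using C_infI[OF F(1) C\<theta>] by (intro test_funI[of F "-N" N])
    moreover have "deriv F = \<theta>" using F DERIV_imp_deriv by blast
    ultimately have "(LINT x|lborel. h x * \<theta> x) = 0" using zero by metis
    moreover have "(LINT x|lborel. h x * \<theta> x) = (LINT x|lborel. h x * \<phi> x) - J / I * (LINT x|lborel. h x * \<eta> x)"
    proof -
      have "(LINT x|lborel. h x * \<theta> x) = (LINT x|lborel. h x * \<phi> x - J / I * (h x * \<eta> x))"
        by (intro Bochner_Integration.integral_cong) (auto simp: \<theta>_def algebra_simps)
      then show ?thesis using int[OF \<phi>] int[OF \<eta>(1)] by simp
    qed
    ultimately show "(LINT x|lborel. (h x - c) * \<phi> x) = 0"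
      using int[OF \<phi>] int1[OF \<phi>] by (simp add: left_diff_distrib J_def c_def)
  qed
  then show ?thesis using that by simp
qed

section \<open>Absolutely continuous representatives\<close>

lemma L2D:
  assumes "f \<in> L2"
  shows "f \<in> borel_measurable borel" "integrable lborel (\<lambda>x. (f x)\<^sup>2)"
  using assms by (auto simp: L2_def)

lemma L2_bound:
  assumes "g \<in> L2" "f \<in> borel_measurable borel" "\<And>x. \<bar>f x\<bar> \<le> \<bar>g x\<bar>"
  shows "f \<in> L2"
proof -
  have "integrable lborel (\<lambda>x. (f x)\<^sup>2)"
    using assms(2,3)
    by (intro Bochner_Integration.integrable_bound[OF L2D(2)[OF assms(1)]])
       (auto simp: abs_le_square_iff)
  then show ?thesis using assms(2) by (simp add: L2_def)
qed

lemma L2_cong_AE: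
  assumes "f \<in> L2" "AE x in lborel. f x = g x" "g \<in> borel_measurable borel"
  shows "g \<in> L2"
proof -
  note [measurable] = assms(3) L2D(1)[OF assms(1)]
  have "integrable lborel (\<lambda>x. (g x)\<^sup>2)"
    by (rule integrable_cong_AE_imp[OF L2D(2)[OF assms(1)]]) (use assms(2) in \<open>auto elim!: eventually_mono\<close>)
  then show ?thesis by (simp add: L2_def)
qed

lemma L2_mult_integrable:
  assumes "f \<in> L2" "g \<in> L2"
  shows "integrable lborel (\<lambda>x. f x * g x)"
proof (rule Bochner_Integration.integrable_bound)
  note [measurable] = L2D(1)[OF assms(1)] L2D(1)[OF assms(2)]
  show "integrable lborel (\<lambda>x. (f x)\<^sup>2 + (g x)\<^sup>2)"
    using L2D(2)[OF assms(1)] L2D(2)[OF assms(2)] by simp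
  show "(\<lambda>x. f x * g x) \<in> borel_measurable lborel" by measurable
  have "\<bar>a * b\<bar> \<le> a\<^sup>2 + b\<^sup>2" for a b :: real
    using sum_squares_bound[of a b] sum_squares_bound[of a "-b"] by (auto simp: abs_if) 
  then show "AE x in lborel. norm (f x * g x) \<le> norm ((f x)\<^sup>2 + (g x)\<^sup>2)" by simp
qed

lemma L2_add: "f \<in> L2 \<Longrightarrow> g \<in> L2 \<Longrightarrow> (\<lambda>x. f x + g x) \<in> L2"
  using L2_mult_integrable[of f g] by (auto simp: L2_def power2_sum mult.assoc)

lemma L2_cmult: "f \<in> L2 \<Longrightarrow> (\<lambda>x. c * f x) \<in> L2"
  by (auto simp: L2_def power_mult_distrib)

lemma L2_diff: "f \<in> L2 \<Longrightarrow> g \<in> L2 \<Longrightarrow> (\<lambda>x. f x - g x) \<in> L2"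
  using L2_add[of f "\<lambda>x. (-1) * g x"] L2_cmult[of g "-1"] by simp

lemma L2_mult_bounded:
  assumes "f \<in> L2" "b \<in> borel_measurable borel" "\<And>x. \<bar>b x\<bar> \<le> B"
  shows "(\<lambda>x. b x * f x) \<in> L2"
proof (rule L2_bound)
  show "(\<lambda>x. B * f x) \<in> L2" by (rule L2_cmult) fact
  show "(\<lambda>x. b x * f x) \<in> borel_measurable borel"
    using assms(2) L2D(1)[OF assms(1)] by simp
  show "\<bar>b x * f x\<bar> \<le> \<bar>B * f x\<bar>" for x
    unfolding abs_mult using assms(3)[of x] by (intro mult_right_mono) auto
qed

lemma L2_shift:
  assumes "f \<in> L2"
  shows "(\<lambda>x. f (x + h)) \<in> L2" "(LINT x|lborel. (f (x + h))\<^sup>2) = (LINT x|lborel. (f x)\<^sup>2)"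
proof -
  note [measurable] = L2D(1)[OF assms]
  show "(\<lambda>x. f (x + h)) \<in> L2"
    using lborel_integrable_real_affine[OF L2D(2)[OF assms], of 1 h] by (simp add: L2_def add.commute)
  show "(LINT x|lborel. (f (x + h))\<^sup>2) = (LINT x|lborel. (f x)\<^sup>2)"
    using lborel_integral_real_affine[of 1 "\<lambda>x. (f x)\<^sup>2" h] by (simp add: add.commute)
qed

lemma integrable_Icc_const: "integrable lborel (\<lambda>x::real. indicator {a..b} x * (c::real))"
  using integrable_Icc_mult[of "\<lambda>_. c" a b] by simp

lemma LINT_Icc_const: "a \<le> b \<Longrightarrow> (LINT x|lborel. indicator {a..b::real} x * (c::real)) = (b - a) * c"
  by simp

lemma L2_Icc_integrable:
  assumes "g \<in> L2"
  shows "integrable lborel (\<lambda>x. indicator {a..b} x * g x)"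
proof -
  have "(\<lambda>x. indicator {a..b} x :: real) \<in> L2"
    using integrable_Icc_const[of a b 1]
    by (auto simp: L2_def power2_eq_square simp flip: indicator_inter_arith)
  from L2_mult_integrable[OF this assms] show ?thesis .
qed

text \<open>Young's inequality with a free parameter stands in for Cauchy-Schwarz; \<epsilon> is
  tuned to the length of the interval in the application.\<close>

lemma LINT_Icc_le:
  assumes "g \<in> L2" "a \<le> b" "\<epsilon> > 0"
  shows "(LINT x|lborel. indicator {a..b} x * \<bar>g x\<bar>) \<le> \<epsilon> * (LINT x|lborel. (g x)\<^sup>2) + (b - a) / (4 * \<epsilon>)"
proof -
  have abs: "integrable lborel (\<lambda>x. indicator {a..b} x * \<bar>g x\<bar>)"
    using L2_Icc_integrable[of "\<lambda>x. \<bar>g x\<bar>" a b] assms(1) by (auto simp: L2_def)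
  have "(LINT x|lborel. indicator {a..b} x * \<bar>g x\<bar>) \<le> 
      (LINT x|lborel. \<epsilon> * (g x)\<^sup>2 + indicator {a..b} x * (1 / (4 * \<epsilon>)))"
  proof (rule integral_mono)
    show "integrable lborel (\<lambda>x. \<epsilon> * (g x)\<^sup>2 + indicator {a..b} x * (1 / (4 * \<epsilon>)))"
      using L2D(2)[OF assms(1)] integrable_Icc_const by (intro Bochner_Integration.integrable_add) auto
    have "\<bar>y\<bar> \<le> \<epsilon> * y\<^sup>2 + 1 / (4 * \<epsilon>)" for y
    proof -
      have "0 \<le> (2 * \<epsilon> * \<bar>y\<bar> - 1)\<^sup>2 / (4 * \<epsilon>)" using assms(3) by simp
      also have "\<dots> = \<epsilon> * y\<^sup>2 - \<bar>y\<bar> + 1 / (4 * \<epsilon>)"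
        using assms(3) by (simp add: power2_eq_square field_simps flip: abs_mult)
      finally show ?thesis by simp
    qed
    then show "indicator {a..b} x * \<bar>g x\<bar> \<le> \<epsilon> * (g x)\<^sup>2 + indicator {a..b} x * (1 / (4 * \<epsilon>))" for x
      using assms(3) by (auto simp: indicator_def)
  qed (rule abs)
  also have "\<dots> = \<epsilon> * (LINT x|lborel. (g x)\<^sup>2) + (b - a) / (4 * \<epsilon>)"
    using L2D(2)[OF assms(1)] integrable_Icc_const[of a b "1 / (4 * \<epsilon>)"] assms(2)
    by (simp add: LINT_Icc_const del: integral_divide_zero integral_mult_left_zero)
  finally show ?thesis .
qed

text \<open>The identity holds for all end points, so U is the continuous representative, while g
  may still change on null sets. U itself need not be square integrable, so that primitives and
  representatives share the notion.\<close>

definition AC :: "(real \<Rightarrow> real) \<Rightarrow> (real \<Rightarrow> real) \<Rightarrow> bool" where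
  "AC U g \<longleftrightarrow> g \<in> L2 \<and> (\<forall>a b. a \<le> b \<longrightarrow> U b - U a = (LINT x|lborel. indicator {a..b} x * g x))"

text \<open>The one-dimensional Morrey estimate (Hoelder exponent 1/2), with the squared norm plus 1
  in place of the norm.\<close>

lemma AC_modulus:
  assumes "AC U g"
  shows "\<bar>U x - U y\<bar> \<le> sqrt \<bar>x - y\<bar> * ((LINT x|lborel. (g x)\<^sup>2) + 1)"
proof -
  have *: "\<bar>U b - U a\<bar> \<le> sqrt (b - a) * ((LINT x|lborel. (g x)\<^sup>2) + 1)" if "a < b" for a b
  proof -
    have "\<bar>U b - U a\<bar> = \<bar>LINT x|lborel. indicator {a..b} x * g x\<bar>"
      using assms that by (simp add: AC_def)
    also have "\<dots> \<le> (LINT x|lborel. \<bar>indicator {a..b} x * g x\<bar>)"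
      by (rule integral_abs_bound)
    also have "\<dots> = (LINT x|lborel. indicator {a..b} x * \<bar>g x\<bar>)"
      by (simp add: abs_mult)
    \<comment> \<open>Taking \<epsilon> as \<open>sqrt (b - a)\<close> gives both terms the same
      power of the length.\<close>
    also have "\<dots> \<le> sqrt (b - a) * (LINT x|lborel. (g x)\<^sup>2) + (b - a) / (4 * sqrt (b - a))"
      using assms that by (intro LINT_Icc_le) (auto simp: AC_def)
    also have "(b - a) / (4 * sqrt (b - a)) = sqrt (b - a) / 4"
      using that real_div_sqrt[of "b - a"] by (simp flip: divide_divide_eq_left add: divide_divide_eq_left[of _ _ 4] mult.commute[of 4])
    also have "sqrt (b - a) * (LINT x|lborel. (g x)\<^sup>2) + sqrt (b - a) / 4 
        \<le> sqrt (b - a) * (LINT x|lborel. (g x)\<^sup>2) + sqrt (b - a)"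
      using that by simp
    finally show ?thesis by (simp add: algebra_simps)
  qed
  show ?thesis
    using *[of x y] *[of y x] by (cases x y rule: linorder_cases) (auto simp: abs_minus_commute)
qed

lemma equi_modulus_continuous:
  fixes U :: "real \<Rightarrow> real"
  assumes "\<And>x y. \<bar>U x - U y\<bar> \<le> sqrt \<bar>x - y\<bar> * C"
  shows "continuous_on UNIV U"
  unfolding continuous_on_def
proof
  fix x :: real
  have "((\<lambda>y. sqrt \<bar>y - x\<bar> * C) \<longlongrightarrow> sqrt \<bar>x - x\<bar> * C) (at x)"
    by (intro tendsto_intros)
  then have "((\<lambda>y. sqrt \<bar>y - x\<bar> * C) \<longlongrightarrow> 0) (at x)" by simp
  then have "((\<lambda>y. U y - U x) \<longlongrightarrow> 0) (at x)"
    by (rule Lim_null_comparison[rotated]) (use assms in auto)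
  then show "(U \<longlongrightarrow> U x) (at x within UNIV)" by (simp add: LIM_zero_iff)
qed

lemma AC_continuous: "AC U g \<Longrightarrow> continuous_on UNIV U"
  by (rule equi_modulus_continuous) (rule AC_modulus)

lemma AC_C1:
  assumes "\<And>x. (f has_real_derivative f' x) (at x)" "continuous_on UNIV f'" "f' \<in> L2"
  shows "AC f f'"
  using LINT_FTC[of _ _ f f'] assms by (simp add: AC_def)

lemma AC_cong_AE:
  assumes "AC U g" "AE x in lborel. g x = g' x" "g' \<in> borel_measurable borel"
  shows "AC U g'"
proof -
  have g: "g \<in> L2" using assms by (simp add: AC_def)
  note [measurable] = assms(3) L2D(1)[OF g]
  have "(LINT x|lborel. indicator {a..b} x * g x) = (LINT x|lborel. indicator {a..b} x * g' x)" for a b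
    by (rule integral_cong_AE) (use assms(2) in \<open>auto elim!: eventually_mono\<close>)
  then show ?thesis using assms(1) L2_cong_AE[OF g assms(2,3)] by (simp add: AC_def)
qed

text \<open>The oriented integral from 0 to x: whatever the sign of x, one of the two intervals is
  empty or a single point.\<close>

definition primitive :: "(real \<Rightarrow> real) \<Rightarrow> real \<Rightarrow> real" where
  "primitive g x = (LINT t|lborel. indicator {0..x} t * g t) - (LINT t|lborel. indicator {x..0} t * g t)"

lemma AC_primitive:
  assumes "g \<in> L2"
  shows "AC (primitive g) g"
  unfolding AC_def
proof (intro conjI allI impI)
  fix a b :: real assume "a \<le> b"
  note int = L2_Icc_integrable[OF assms]
  note [measurable] = L2D(1)[OF assms]
  have "primitive g b - primitive g a = (LINT t|lborel. (indicator {0..b} t * g t - indicator {b..0} t * g t)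
      - (indicator {0..a} t * g t - indicator {a..0} t * g t))"
    using int by (simp add: primitive_def)
  also have "\<dots> = (LINT t|lborel. indicator {a..b} t * g t)"
  proof (rule integral_cong_AE)
    \<comment> \<open>The two combinations of indicators agree away from the end points 0, a and
      b.\<close>
    show "AE t in lborel. (indicator {0..b} t * g t - indicator {b..0} t * g t)
      - (indicator {0..a} t * g t - indicator {a..0} t * g t) = indicator {a..b} t * g t"
      using AE_lborel_singleton[of 0] AE_lborel_singleton[of a] AE_lborel_singleton[of b]
    proof eventually_elim
      case (elim t)
      then show ?case using \<open>a \<le> b\<close> by (auto simp: indicator_def)
    qed
  qed measurable
  finally show "primitive g b - primitive g a = (LINT t|lborel. indicator {a..b} t * g t)" .
qed fact

text \<open>U need not be differentiable at every point, so integration by parts is obtained from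
  Fubini on the half-plane y \<le> x: U(x) - U(-N) is the integral of g from -N to x, and
  integrating \<phi>' over x \<ge> y gives -\<phi>(y).\<close>

lemma is_wderiv_AC:
  assumes "AC U g"
  shows "is_wderiv U g"
  unfolding is_wderiv_def
proof (intro allI impI)
  fix \<phi> assume \<phi>: "test_fun \<phi>"
  have g: "g \<in> L2" using assms by (simp add: AC_def)
  note [measurable] = L2D(1)[OF g]
  have C\<phi>: "C_inf \<phi>" using \<phi> by (simp add: test_fun_def)
  note cont = C_inf_continuous[OF C\<phi>, of UNIV] C_inf_continuous[OF C_inf_D(2)[OF C\<phi>], of UNIV]
  note [measurable] = cont[THEN borel_measurable_continuous_onI]
  obtain N where N: "N > 0" "\<And>x. N \<le> \<bar>x\<bar> \<Longrightarrow> \<phi> x = 0" "\<And>x. N \<le> \<bar>x\<bar> \<Longrightarrow> deriv \<phi> x = 0"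
    using test_funE[OF \<phi>] by blast
  have out: "\<phi> x = 0 \<and> deriv \<phi> x = 0" if "\<not> (-N \<le> x \<and> x \<le> N)" for x
    using N that by (cases "N \<le> \<bar>x\<bar>") auto
  define gg where "gg = (\<lambda>y. indicator {-N..N} y * g y)"
  have gg[measurable]: "integrable lborel gg" unfolding gg_def by (rule L2_Icc_integrable[OF g])
  have int\<phi>: "integrable lborel (deriv \<phi>)"
    using integrable_mult_test_fun(2)[of "\<lambda>_. 1" \<phi>] \<phi> by simp
  define F where "F = (\<lambda>y x. gg y * (indicator {y..} x * deriv \<phi> x))"
  have Fi: "integrable (lborel \<Otimes>\<^sub>M lborel) (case_prod F)"
  proof (rule lborel_pair.Fubini_integrable)
    have [measurable]: "gg \<in> borel_measurable borel" using gg by auto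
    have "case_prod F = (\<lambda>z. gg (fst z) * ((if fst z \<le> snd z then 1 else 0) * deriv \<phi> (snd z)))"
      by (auto simp: F_def indicator_def fun_eq_iff)
    then show "case_prod F \<in> borel_measurable (lborel \<Otimes>\<^sub>M lborel)" by simp
    have i2: "integrable lborel (\<lambda>x. indicator {y..} x * deriv \<phi> x)" for y
      using integrable_mult_indicator[of "{y..}" lborel "deriv \<phi>"] int\<phi> by simp
    then show "AE y in lborel. integrable lborel (\<lambda>x. case_prod F (y, x))"
      by (simp add: F_def)
    show "integrable lborel (\<lambda>y. LINT x|lborel. norm (case_prod F (y, x)))"
    proof (rule Bochner_Integration.integrable_bound)
      show "integrable lborel (\<lambda>y. gg y * (LINT x|lborel. \<bar>deriv \<phi> x\<bar>))" using gg by simp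
      have "(\<lambda>y. LINT x|lborel. norm (gg y * ((if y \<le> x then 1 else 0) * deriv \<phi> x))) \<in> borel_measurable lborel"
        by measurable
      moreover have "(\<lambda>y. LINT x|lborel. norm (gg y * ((if y \<le> x then 1 else 0) * deriv \<phi> x))) 
          = (\<lambda>y. LINT x|lborel. norm (case_prod F (y, x)))"
        by (simp add: F_def indicator_def of_bool_def)
      ultimately show "(\<lambda>y. LINT x|lborel. norm (case_prod F (y, x))) \<in> borel_measurable lborel" by metis
      have "(LINT x|lborel. \<bar>indicator {y..} x * deriv \<phi> x\<bar>) \<le> (LINT x|lborel. \<bar>deriv \<phi> x\<bar>)" for y
        using i2[of y] int\<phi> by (intro integral_mono) (auto simp: indicator_def)
      then show "AE y in lborel. norm (LINT x|lborel. norm (case_prod F (y, x)))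
          \<le> norm (gg y * (LINT x|lborel. \<bar>deriv \<phi> x\<bar>))"
        by (intro AE_I2) (auto simp: F_def abs_mult intro!: mult_left_mono)
    qed
  qed
  have Fy: "(LINT x|lborel. F y x) = - (g y * \<phi> y)" for y
  proof (cases "y \<in> {-N..N}")
    case True
    have "(LINT x|lborel. indicator {y..} x * deriv \<phi> x) = (LINT x|lborel. indicator {y..N} x * deriv \<phi> x)"
      by (rule Bochner_Integration.integral_cong) (use out in \<open>force simp: indicator_def\<close>)+
    also have "\<dots> = \<phi> N - \<phi> y"
      using True C_inf_D(1)[OF C\<phi>] cont by (intro LINT_FTC) auto
    finally show ?thesis using True N by (simp add: F_def gg_def)
  next
    case False
    then show ?thesis using out[of y] by (auto simp: F_def gg_def)
  qed
  have Fx: "(LINT y|lborel. F y x) = (U x - U (-N)) * deriv \<phi> x" for x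
  proof (cases "x \<in> {-N..N}")
    case True
    have "(LINT y|lborel. F y x) = (LINT y|lborel. (indicator {-N..x} y * g y) * deriv \<phi> x)"
      by (rule Bochner_Integration.integral_cong) (use True in \<open>auto simp: F_def gg_def indicator_def\<close>)
    also have "\<dots> = (U x - U (-N)) * deriv \<phi> x"
      using assms True by (simp add: AC_def)
    finally show ?thesis .
  next
    case False
    then show ?thesis using out[of x] by (auto simp: F_def)
  qed
  have U\<phi>: "integrable lborel (\<lambda>x. U x * deriv \<phi> x)"
    by (rule integrable_mult_test_fun[OF AC_continuous[OF assms] \<phi>])
  \<comment> \<open>\<phi>' has integral zero, so replacing U by U - U(-N) changes nothing.\<close>
  have "(LINT x|lborel. deriv \<phi> x) = \<phi> N - \<phi> (-N)"
    using N out C_inf_D(1)[OF C\<phi>] cont by (intro LINT_FTC_supp[of "-N" N]) auto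
  then have "(LINT x|lborel. deriv \<phi> x) = 0" using N by simp
  then have "(LINT x|lborel. U x * deriv \<phi> x) = (LINT x|lborel. (U x - U (-N)) * deriv \<phi> x)"
    using U\<phi> int\<phi> by (simp add: left_diff_distrib)
  also have "\<dots> = (LINT x|lborel. (LINT y|lborel. F y x))" unfolding Fx ..
  also have "\<dots> = (LINT y|lborel. (LINT x|lborel. F y x))"
    by (rule lborel_pair.Fubini_integral[OF Fi])
  also have "\<dots> = - (LINT y|lborel. g y * \<phi> y)" unfolding Fy by simp
  finally have "(LINT x|lborel. U x * deriv \<phi> x) = - (LINT x|lborel. g x * \<phi> x)" .
  moreover have "integrable lborel (\<lambda>y. - (g y * \<phi> y))"
    using lborel_pair.integrable_fst[OF Fi] unfolding Fy .
  ultimately show "integrable lborel (\<lambda>x. U x * deriv \<phi> x) \<and> integrable lborel (\<lambda>x. g x * \<phi> x) \<and>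
      (LINT x|lborel. U x * deriv \<phi> x) = - (LINT x|lborel. g x * \<phi> x)"
    using U\<phi> by simp
qed

lemma test_fun_L2:
  assumes "test_fun \<phi>"
  shows "\<phi> \<in> L2"
proof -
  have c: "continuous_on UNIV \<phi>"
    using assms by (auto simp: test_fun_def intro: C_inf_continuous)
  show ?thesis
    using integrable_mult_test_fun(1)[OF c assms] borel_measurable_continuous_onI[OF c]
    by (simp add: L2_def power2_eq_square)
qed

text \<open>The primitive of g has the same weak derivative as u, so the difference is almost
  everywhere constant by the du Bois-Reymond argument.\<close>

lemma H1_AC_representative:
  assumes u: "u \<in> L2" and g: "g \<in> L2" and "is_wderiv u g"
  obtains U where "AC U g" "AE x in lborel. u x = U x"
proof -
  note P = AC_primitive[OF g]
  obtain c where c: "AE x in lborel. u x - primitive g x = c"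
  proof (rule AE_const_if_test_deriv)
    fix \<phi> assume \<phi>: "test_fun \<phi>"
    show "integrable lborel (\<lambda>x. (u x - primitive g x) * \<phi> x)"
      using L2_mult_integrable[OF u test_fun_L2[OF \<phi>]]
        integrable_mult_test_fun(1)[OF AC_continuous[OF P] \<phi>]
      by (simp add: left_diff_distrib)
    show "(LINT x|lborel. (u x - primitive g x) * deriv \<phi> x) = 0"
      using is_wderiv_AC[OF P] assms(3) \<phi> unfolding is_wderiv_def by (auto simp: left_diff_distrib)
  qed
  show ?thesis
  proof (rule that)
    show "AC (\<lambda>x. primitive g x + c) g" using P by (simp add: AC_def)
    show "AE x in lborel. u x = primitive g x + c" using c by eventually_elim auto
  qed
qed

section \<open>Steklov averages\<close>

text \<open>Exchange of integration: a point t lies in the window of x exactly when x lies in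
  [t - h, t], a set of measure h.\<close>

lemma window_integral:
  fixes q :: "real \<Rightarrow> real"
  assumes q: "integrable lborel q"
  shows "integrable lborel (\<lambda>x. LINT t|lborel. indicator {x..x+h} t * q t)"
    "h \<ge> 0 \<Longrightarrow> (LINT x|lborel. LINT t|lborel. indicator {x..x+h} t * q t) = h * (LINT t|lborel. q t)"
proof -
  note [measurable] = borel_measurable_integrable[OF q]
  define F where "F = (\<lambda>t x::real. indicator {t-h..t} x * q t)"
  have Fi: "integrable (lborel \<Otimes>\<^sub>M lborel) (case_prod F)"
  proof (rule lborel_pair.Fubini_integrable)
    have "case_prod F = (\<lambda>z. (if fst z - h \<le> snd z \<and> snd z \<le> fst z then 1 else 0) * q (fst z))"
      by (auto simp: F_def indicator_def fun_eq_iff)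
    then show "case_prod F \<in> borel_measurable (lborel \<Otimes>\<^sub>M lborel)" by simp
    show "AE t in lborel. integrable lborel (\<lambda>x. case_prod F (t, x))"
      using integrable_Icc_const by (simp add: F_def)
    have "(\<lambda>t. LINT x|lborel. norm (case_prod F (t, x))) = (\<lambda>t. measure lborel {t-h..t} * \<bar>q t\<bar>)"
      by (simp add: F_def abs_mult)
    also have "\<dots> = (\<lambda>t. max h 0 * \<bar>q t\<bar>)" by (auto simp: fun_eq_iff)
    finally show "integrable lborel (\<lambda>t. LINT x|lborel. norm (case_prod F (t, x)))"
      using q by simp
  qed
  have eq: "F t x = indicator {x..x+h} t * q t" for t x
    by (auto simp: F_def indicator_def)
  show "integrable lborel (\<lambda>x. LINT t|lborel. indicator {x..x+h} t * q t)"
    using lborel_pair.integrable_snd[OF Fi] unfolding eq .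
  assume "h \<ge> 0"
  have "(LINT x|lborel. LINT t|lborel. F t x) = (LINT t|lborel. LINT x|lborel. F t x)"
    by (rule lborel_pair.Fubini_integral[OF Fi])
  also have "\<dots> = (LINT t|lborel. h * q t)"
    using \<open>h \<ge> 0\<close> by (simp add: F_def)
  finally show "(LINT x|lborel. LINT t|lborel. indicator {x..x+h} t * q t) = h * (LINT t|lborel. q t)"
    unfolding eq by simp
qed

definition steklov :: "real \<Rightarrow> (real \<Rightarrow> real) \<Rightarrow> real \<Rightarrow> real" where
  "steklov h g x = (LINT t|lborel. indicator {x..x+h} t * g t) / h"

text \<open>An average of the derivative is a difference quotient of the function. Read one way this
  gives the smoothing effect of averages, read the other way the uniform bounds on difference
  quotients used for the second derivative of the minimizer.\<close>

lemma steklov_AC: "AC U g \<Longrightarrow> h > 0 \<Longrightarrow> steklov h g = (\<lambda>x. (U (x + h) - U x) / h)"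
  by (simp add: steklov_def AC_def fun_eq_iff)

text \<open>Jensen's inequality for the window average, from the nonnegative integral of (g - m)^2
  over the window.\<close>

lemma steklov_square_le:
  assumes g: "g \<in> L2" and h: "h > 0"
  shows "(steklov h g x)\<^sup>2 \<le> (LINT t|lborel. indicator {x..x+h} t * (g t)\<^sup>2) / h"
proof -
  define m where "m = steklov h g x"
  define I where "I = (\<lambda>t. indicator {x..x+h} t :: real)"
  have i1: "integrable lborel (\<lambda>t. I t * g t)" unfolding I_def by (rule L2_Icc_integrable[OF g])
  have i2: "integrable lborel (\<lambda>t. I t * (g t)\<^sup>2)"
    using integrable_mult_indicator[OF _ L2D(2)[OF g], of "{x..x+h}"] by (simp add: I_def)
  have i3: "integrable lborel (\<lambda>t. I t * m\<^sup>2)" unfolding I_def by (rule integrable_Icc_const)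
  have "0 \<le> (LINT t|lborel. I t * (g t - m)\<^sup>2)"
    by (intro Bochner_Integration.integral_nonneg) (auto simp: I_def)
  also have "\<dots> = (LINT t|lborel. I t * (g t)\<^sup>2 - 2 * m * (I t * g t) + I t * m\<^sup>2)"
    by (intro Bochner_Integration.integral_cong) (auto simp: power2_eq_square algebra_simps)
  also have "\<dots> = (LINT t|lborel. I t * (g t)\<^sup>2) - 2 * m * (LINT t|lborel. I t * g t) + (LINT t|lborel. I t * m\<^sup>2)"
    using i1 i2 i3 by simp
  also have "(LINT t|lborel. I t * g t) = h * m" using h by (simp add: m_def steklov_def I_def)
  also have "(LINT t|lborel. I t * m\<^sup>2) = h * m\<^sup>2" using h by (simp add: I_def)
  finally have "h * m\<^sup>2 \<le> (LINT t|lborel. I t * (g t)\<^sup>2)" by (simp add: power2_eq_square algebra_simps)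
  then show ?thesis using h by (simp add: m_def I_def field_simps)
qed

lemma steklov_L2:
  assumes g: "g \<in> L2" and h: "h > 0"
  shows "steklov h g \<in> L2" "(LINT x|lborel. (steklov h g x)\<^sup>2) \<le> (LINT x|lborel. (g x)\<^sup>2)"
    "continuous_on UNIV (steklov h g)"
proof -
  note P = AC_primitive[OF g]
  show c: "continuous_on UNIV (steklov h g)"
    unfolding steklov_AC[OF P h] using h
    by (intro continuous_intros continuous_on_compose2[OF AC_continuous[OF P]]) auto
  note [measurable] = borel_measurable_continuous_onI[OF c]
  \<comment> \<open>The window average of g^2: it dominates the squared average of g and has the
    same integral as g^2, so averaging is a contraction.\<close>
  define W where "W = (\<lambda>x. (LINT t|lborel. indicator {x..x+h} t * (g t)\<^sup>2) / h)"
  have W: "integrable lborel W" "(LINT x|lborel. W x) = (LINT x|lborel. (g x)\<^sup>2)"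
    using window_integral[OF L2D(2)[OF g], of h] h by (auto simp: W_def)
  have le: "(steklov h g x)\<^sup>2 \<le> W x" for x
    unfolding W_def by (rule steklov_square_le[OF g h])
  have i: "integrable lborel (\<lambda>x. (steklov h g x)\<^sup>2)"
    by (rule Bochner_Integration.integrable_bound[OF W(1)])
       (use le in \<open>auto intro!: AE_I2 simp: order_trans[OF _ abs_ge_self]\<close>)
  then show "steklov h g \<in> L2" by (simp add: L2_def)
  show "(LINT x|lborel. (steklov h g x)\<^sup>2) \<le> (LINT x|lborel. (g x)\<^sup>2)"
    using integral_mono[OF i W(1) le] W(2) by simp
qed

text \<open>Averaging commutes with differentiation. By the mean value theorem for a primitive of U,
  the average is a value U(z) with z in the window, so its distance from U(x) is bounded by the
  Hoelder estimate.\<close>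

lemma steklov_has_derivative:
  assumes "AC U g" "U \<in> L2" "h > 0"
  shows "(steklov h U has_real_derivative steklov h g x) (at x)"
    "\<bar>steklov h U x - U x\<bar> \<le> sqrt h * ((LINT x|lborel. (g x)\<^sup>2) + 1)"
proof -
  note cont = AC_continuous[OF assms(1)]
  obtain P where P: "\<And>x. (P has_real_derivative U x) (at x)"
    using ex_antiderivative[OF cont] by blast
  have S: "steklov h U = (\<lambda>x. (P (x + h) - P x) / h)"
    unfolding steklov_def using LINT_FTC[OF _ P cont] assms(3) by auto
  show "(steklov h U has_real_derivative steklov h g x) (at x)"
    unfolding S steklov_AC[OF assms(1,3)] using assms(3)
    by (auto intro!: derivative_eq_intros P DERIV_chain2[of P] simp: DERIV_shift[symmetric])
  obtain z where z: "x < z" "z < x + h" "P (x + h) - P x = (x + h - x) * U z"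
    using MVT2[of x "x + h" P U] P assms(3) by auto
  then have "\<bar>steklov h U x - U x\<bar> = \<bar>U z - U x\<bar>" using assms(3) by (simp add: S)
  also have "\<dots> \<le> sqrt \<bar>z - x\<bar> * ((LINT x|lborel. (g x)\<^sup>2) + 1)"
    by (rule AC_modulus[OF assms(1)])
  also have "\<dots> \<le> sqrt h * ((LINT x|lborel. (g x)\<^sup>2) + 1)"
    using z by (intro mult_right_mono) (auto intro!: add_nonneg_nonneg)
  finally show "\<bar>steklov h U x - U x\<bar> \<le> sqrt h * ((LINT x|lborel. (g x)\<^sup>2) + 1)" .
qed

definition C2_L2 :: "(real \<Rightarrow> real) \<Rightarrow> (real \<Rightarrow> real) \<Rightarrow> (real \<Rightarrow> real) \<Rightarrow> bool" where
  "C2_L2 f f1 f2 \<longleftrightarrow> (\<forall>x. (f has_real_derivative f1 x) (at x)) \<and> (\<forall>x. (f1 has_real_derivative f2 x) (at x)) \<and>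
     continuous_on UNIV f2 \<and> f \<in> L2 \<and> f1 \<in> L2 \<and> f2 \<in> L2"

text \<open>Each average gains one derivative, so two lead from an absolutely continuous U to class
  C^2. Both contract L2 norms; \<open>f2\<close> is square integrable in any case, and if g is
  itself absolutely continuous it also has a bound free of h.\<close>

lemma steklov_steklov:
  assumes U: "AC U g" "U \<in> L2" and h: "h > 0"
  obtains f f1 f2 where "C2_L2 f f1 f2"
    "(LINT x|lborel. (f x)\<^sup>2) \<le> (LINT x|lborel. (U x)\<^sup>2)"
    "(LINT x|lborel. (f1 x)\<^sup>2) \<le> (LINT x|lborel. (g x)\<^sup>2)"
    "\<And>x. \<bar>f x - U x\<bar> \<le> 2 * sqrt h * ((LINT x|lborel. (g x)\<^sup>2) + 1)"
    "\<And>g2. AC g g2 \<Longrightarrow> (LINT x|lborel. (f2 x)\<^sup>2) \<le> (LINT x|lborel. (g2 x)\<^sup>2)"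
proof -
  have g: "g \<in> L2" using U by (simp add: AC_def)
  define V where "V = steklov h U"
  define V1 where "V1 = steklov h g"
  note VL = steklov_L2[OF U(2) h, folded V_def] steklov_L2[OF g h, folded V1_def]
  note Vd = steklov_has_derivative[OF U h, folded V_def V1_def]
  have VAC: "AC V V1" using Vd VL by (intro AC_C1) auto
  define W where "W = steklov h V"
  define W1 where "W1 = steklov h V1"
  note WL = steklov_L2[OF VL(1) h, folded W_def] steklov_L2[OF VL(4) h, folded W1_def]
  note Wd = steklov_has_derivative[OF VAC VL(1) h, folded W_def W1_def]
  define W2 where "W2 = (\<lambda>x. (V1 (x + h) - V1 x) / h)"
  obtain P where P: "\<And>x. (P has_real_derivative V1 x) (at x)"
    using ex_antiderivative[OF VL(6)] by blast
  have "W1 = (\<lambda>x. (P (x + h) - P x) / h)"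
    unfolding W1_def steklov_def using LINT_FTC[OF _ P VL(6)] h by auto
  then have W1d: "(W1 has_real_derivative W2 x) (at x)" for x
    unfolding W2_def using h
    by (auto intro!: derivative_eq_intros P DERIV_chain2[of P] simp: DERIV_shift[symmetric])
  show ?thesis
  proof (rule that)
    have "continuous_on UNIV W2"
      unfolding W2_def using h
      by (intro continuous_intros continuous_on_compose2[OF VL(6)]) auto
    moreover have "W2 \<in> L2"
      using L2_cmult[OF L2_diff[OF L2_shift(1)[OF VL(4), of h] VL(4)], of "1/h"] by (simp add: W2_def)
    ultimately show "C2_L2 W W1 W2"
      using Wd(1) W1d WL by (auto simp: C2_L2_def)
    show "(LINT x|lborel. (W x)\<^sup>2) \<le> (LINT x|lborel. (U x)\<^sup>2)" using WL VL by linarith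
    show "(LINT x|lborel. (W1 x)\<^sup>2) \<le> (LINT x|lborel. (g x)\<^sup>2)" using WL VL by linarith
    show "\<bar>W x - U x\<bar> \<le> 2 * sqrt h * ((LINT x|lborel. (g x)\<^sup>2) + 1)" for x
    proof -
      have "sqrt h * ((LINT x|lborel. (V1 x)\<^sup>2) + 1) \<le> sqrt h * ((LINT x|lborel. (g x)\<^sup>2) + 1)"
        using VL h by (intro mult_left_mono) auto
      then show ?thesis using Wd(2)[of x] Vd(2)[of x] by linarith
    qed
    fix g2 assume g2: "AC g g2"
    then have g2L: "g2 \<in> L2" by (simp add: AC_def)
    define V2 where "V2 = steklov h g2"
    have "AC V1 V2" unfolding V1_def V2_def
      using steklov_has_derivative(1)[OF g2 g h] steklov_L2[OF g2L h] by (intro AC_C1) auto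
    then have "W2 = steklov h V2" by (simp add: W2_def steklov_AC[OF _ h])
    then show "(LINT x|lborel. (W2 x)\<^sup>2) \<le> (LINT x|lborel. (g2 x)\<^sup>2)"
      using steklov_L2[OF g2L h] steklov_L2[OF steklov_L2(1)[OF g2L h] h] by (simp add: V2_def)
  qed
qed

text \<open>Averaging does not increase the \<open>L\<^sup>2\<close> norms of the derivatives and converges uniformly, so a
  negative direction of low regularity can be replaced by a regular one.\<close>
lemma negative_direction_C2:
  assumes U: "AC U g" "U \<in> L2" and r: "continuous_on UNIV r" "\<And>x. \<bar>r x\<bar> \<le> B" "integrable lborel r"
    and A: "A0 \<ge> 0" "A1 \<ge> 0" "A2 \<ge> 0"
    and g2: "A2 = 0 \<or> AC g g2"
    and neg: "A2 * (LINT x|lborel. (g2 x)\<^sup>2) + A1 * (LINT x|lborel. (g x)\<^sup>2) + A0 * (LINT x|lborel. (U x)\<^sup>2)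
        < (LINT x|lborel. r x * (U x)\<^sup>2)"
  obtains f f1 f2 where "C2_L2 f f1 f2"
    "A2 * (LINT x|lborel. (f2 x)\<^sup>2) + A1 * (LINT x|lborel. (f1 x)\<^sup>2) + A0 * (LINT x|lborel. (f x)\<^sup>2)
        < (LINT x|lborel. r x * (f x)\<^sup>2)"
proof -
  define C where "C = 2 * ((LINT x|lborel. (g x)\<^sup>2) + 1)"
  have "\<exists>f f1 f2. C2_L2 f f1 f2 \<and> (LINT x|lborel. (f x)\<^sup>2) \<le> (LINT x|lborel. (U x)\<^sup>2) \<and>
    (LINT x|lborel. (f1 x)\<^sup>2) \<le> (LINT x|lborel. (g x)\<^sup>2) \<and>
    (\<forall>x. \<bar>f x - U x\<bar> \<le> sqrt (inverse (real (Suc n))) * C) \<and>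
    (AC g g2 \<longrightarrow> (LINT x|lborel. (f2 x)\<^sup>2) \<le> (LINT x|lborel. (g2 x)\<^sup>2))" for n
  proof -
    have "inverse (real (Suc n)) > 0" by simp
    from steklov_steklov[OF U this] obtain f f1 f2 where f: "C2_L2 f f1 f2"
      "(LINT x|lborel. (f x)\<^sup>2) \<le> (LINT x|lborel. (U x)\<^sup>2)"
      "(LINT x|lborel. (f1 x)\<^sup>2) \<le> (LINT x|lborel. (g x)\<^sup>2)"
      "\<And>x. \<bar>f x - U x\<bar> \<le> 2 * sqrt (inverse (real (Suc n))) * ((LINT x|lborel. (g x)\<^sup>2) + 1)"
      "\<And>g2. AC g g2 \<Longrightarrow> (LINT x|lborel. (f2 x)\<^sup>2) \<le> (LINT x|lborel. (g2 x)\<^sup>2)"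
      by metis
    have eq: "2 * sqrt (inverse (real (Suc n))) * ((LINT x|lborel. (g x)\<^sup>2) + 1) = sqrt (inverse (real (Suc n))) * C"
      by (simp add: C_def)
    from f f(4)[unfolded eq] show ?thesis by blast
  qed
  then obtain f f1 f2 where f: "\<And>n. C2_L2 (f n) (f1 n) (f2 n)"
    "\<And>n. (LINT x|lborel. (f n x)\<^sup>2) \<le> (LINT x|lborel. (U x)\<^sup>2)"
    "\<And>n. (LINT x|lborel. (f1 n x)\<^sup>2) \<le> (LINT x|lborel. (g x)\<^sup>2)"
    "\<And>n x. \<bar>f n x - U x\<bar> \<le> sqrt (inverse (real (Suc n))) * C"
    "\<And>n. AC g g2 \<Longrightarrow> (LINT x|lborel. (f2 n x)\<^sup>2) \<le> (LINT x|lborel. (g2 x)\<^sup>2)"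
    by metis
  have "C \<ge> 0" by (auto simp: C_def intro!: add_nonneg_nonneg)
  note [measurable] = L2D(1)[OF U(2)] borel_measurable_continuous_onI[OF r(1)]
  have fL: "f n \<in> L2" for n using f(1)[of n] by (simp add: C2_L2_def)
  note [measurable] = L2D(1)[OF fL]
  have "(\<lambda>n. LINT x|lborel. r x * (f n x)\<^sup>2) \<longlonglongrightarrow> (LINT x|lborel. r x * (U x)\<^sup>2)"
  proof (rule integral_dominated_convergence)
    \<comment> \<open>Dominates uniformly in n: f^2 \<le> 2 U^2 + 2 (f - U)^2, and |f - U| \<le> C
      since the window lengths are at most 1.\<close>
    show "integrable lborel (\<lambda>x. 2 * B * (U x)\<^sup>2 + 2 * C\<^sup>2 * \<bar>r x\<bar>)"
      using L2D(2)[OF U(2)] r(3) by (intro Bochner_Integration.integrable_add) auto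
    show "AE x in lborel. (\<lambda>n. r x * (f n x)\<^sup>2) \<longlonglongrightarrow> r x * (U x)\<^sup>2"
    proof (intro AE_I2)
      fix x
      have "(\<lambda>n. sqrt (inverse (real (Suc n))) * C) \<longlonglongrightarrow> sqrt 0 * C"
        by (intro tendsto_intros LIMSEQ_inverse_real_of_nat)
      then have "(\<lambda>n. sqrt (inverse (real (Suc n))) * C) \<longlonglongrightarrow> 0" by simp
      then have "(\<lambda>n. f n x - U x) \<longlonglongrightarrow> 0"
        by (rule Lim_null_comparison[rotated]) (use f(4) in auto)
      then have "(\<lambda>n. f n x) \<longlonglongrightarrow> U x" by (simp add: LIM_zero_iff)
      then show "(\<lambda>n. r x * (f n x)\<^sup>2) \<longlonglongrightarrow> r x * (U x)\<^sup>2" by (intro tendsto_intros)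
    qed
    show "AE x in lborel. norm (r x * (f n x)\<^sup>2) \<le> 2 * B * (U x)\<^sup>2 + 2 * C\<^sup>2 * \<bar>r x\<bar>" for n
    proof (intro AE_I2)
      fix x
      have "sqrt (inverse (real (Suc n))) * C \<le> 1 * C"
        using \<open>C \<ge> 0\<close> by (intro mult_right_mono) (auto simp: real_sqrt_le_1_iff inverse_le_1_iff)
      then have "\<bar>f n x - U x\<bar> \<le> C" using f(4)[of n x] by linarith
      then have "(f n x - U x)\<^sup>2 \<le> C\<^sup>2" using abs_le_square_iff[of "f n x - U x" C] \<open>C \<ge> 0\<close> by simp
      moreover have "(f n x)\<^sup>2 \<le> 2 * (U x)\<^sup>2 + 2 * (f n x - U x)\<^sup>2"
        using zero_le_power2[of "2 * U x - f n x"] by (simp add: power2_eq_square algebra_simps)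
      ultimately have "(f n x)\<^sup>2 \<le> 2 * (U x)\<^sup>2 + 2 * C\<^sup>2" by linarith
      then have "\<bar>r x\<bar> * (f n x)\<^sup>2 \<le> \<bar>r x\<bar> * (2 * (U x)\<^sup>2 + 2 * C\<^sup>2)" by (intro mult_left_mono) auto
      also have "\<dots> = 2 * (\<bar>r x\<bar> * (U x)\<^sup>2) + 2 * C\<^sup>2 * \<bar>r x\<bar>" by (simp add: algebra_simps)
      also have "\<bar>r x\<bar> * (U x)\<^sup>2 \<le> B * (U x)\<^sup>2" using r(2) by (intro mult_right_mono) auto
      finally show "norm (r x * (f n x)\<^sup>2) \<le> 2 * B * (U x)\<^sup>2 + 2 * C\<^sup>2 * \<bar>r x\<bar>"
        by (simp add: abs_mult)
    qed
  qed simp_all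
  from order_tendstoD(1)[OF this neg] obtain n where n: "A2 * (LINT x|lborel. (g2 x)\<^sup>2) +
     A1 * (LINT x|lborel. (g x)\<^sup>2) + A0 * (LINT x|lborel. (U x)\<^sup>2) < (LINT x|lborel. r x * (f n x)\<^sup>2)"
    by (auto simp: eventually_sequentially)
  have "A2 * (LINT x|lborel. (f2 n x)\<^sup>2) \<le> A2 * (LINT x|lborel. (g2 x)\<^sup>2)"
    using g2 f(5) A by (auto intro: mult_left_mono)
  moreover have "A1 * (LINT x|lborel. (f1 n x)\<^sup>2) \<le> A1 * (LINT x|lborel. (g x)\<^sup>2)"
    "A0 * (LINT x|lborel. (f n x)\<^sup>2) \<le> A0 * (LINT x|lborel. (U x)\<^sup>2)"
    using f(2,3) A by (auto intro: mult_left_mono)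
  ultimately show ?thesis using n by (intro that[OF f(1)[of n]]) linarith
qed

section \<open>Limits of bounded sequences in Sobolev spaces\<close>

text \<open>Integrate the derivative of (x + 1 - t) f(t)^2 over the unit window: the weight is 1 at
  x and 0 at the far end, so only f(x)^2 remains. The estimate is kept local because it then yields
  decay at infinity as well as a sup bound.\<close>

lemma square_le_window:
  assumes f: "\<And>x. (f has_real_derivative f' x) (at x)" "continuous_on UNIV f'" "f \<in> L2" "f' \<in> L2"
  shows "(f x)\<^sup>2 \<le> (LINT t|lborel. indicator {x..x+1} t * (2 * (f t)\<^sup>2 + (f' t)\<^sup>2))"
proof -
  have cf: "continuous_on UNIV f"
    using f(1) by (meson DERIV_continuous_on has_field_derivative_at_within)
  define F' where "F' = (\<lambda>t. 2 * (x + 1 - t) * (f t * f' t) - (f t)\<^sup>2)"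
  have cF: "continuous_on UNIV F'" unfolding F'_def by (intro continuous_intros cf f(2))
  have "(LINT t|lborel. indicator {x..x+1} t * F' t) = (x + 1 - (x + 1)) * (f (x + 1))\<^sup>2 - (x + 1 - x) * (f x)\<^sup>2"
    using cF f(1)
    by (intro LINT_FTC[where F = "\<lambda>t. (x + 1 - t) * (f t)\<^sup>2"])
       (auto intro!: derivative_eq_intros simp: F'_def)
  then have "(f x)\<^sup>2 = (LINT t|lborel. - (indicator {x..x+1} t * F' t))" by simp
  also have "\<dots> \<le> (LINT t|lborel. indicator {x..x+1} t * (2 * (f t)\<^sup>2 + (f' t)\<^sup>2))"
  proof (rule integral_mono)
    show "integrable lborel (\<lambda>t. - (indicator {x..x+1} t * F' t))"
      using integrable_Icc_mult[OF cF] by simp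
    show "integrable lborel (\<lambda>t. indicator {x..x+1} t * (2 * (f t)\<^sup>2 + (f' t)\<^sup>2))"
      by (intro integrable_Icc_mult continuous_intros cf f(2))
    fix t
    have "- F' t \<le> 2 * (f t)\<^sup>2 + (f' t)\<^sup>2" if "t \<in> {x..x+1}"
    proof -
      define s where "s = x + 1 - t"
      have s: "0 \<le> s" "s \<le> 1" using that by (auto simp: s_def)
      have "s\<^sup>2 \<le> 1" using s by (simp add: power_le_one)
      then have "s\<^sup>2 * (f' t)\<^sup>2 \<le> 1 * (f' t)\<^sup>2" by (intro mult_right_mono) auto
      moreover have "0 \<le> (f t + s * f' t)\<^sup>2" by simp
      moreover have "F' t = 2 * s * (f t * f' t) - (f t)\<^sup>2" by (simp add: F'_def s_def)
      ultimately show ?thesis by (simp add: power2_sum power_mult_distrib algebra_simps)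
    qed
    then show "- (indicator {x..x+1} t * F' t) \<le> indicator {x..x+1} t * (2 * (f t)\<^sup>2 + (f' t)\<^sup>2)"
      by (auto simp: indicator_def)
  qed
  finally show ?thesis .
qed

lemma square_le_integral:
  assumes f: "\<And>x. (f has_real_derivative f' x) (at x)" "continuous_on UNIV f'" "f \<in> L2" "f' \<in> L2"
  shows "(f x)\<^sup>2 \<le> 2 * (LINT t|lborel. (f t)\<^sup>2) + (LINT t|lborel. (f' t)\<^sup>2)"
proof -
  have i: "integrable lborel (\<lambda>t. 2 * (f t)\<^sup>2 + (f' t)\<^sup>2)"
    using L2D(2)[OF f(3)] L2D(2)[OF f(4)] by simp
  have "(f x)\<^sup>2 \<le> (LINT t|lborel. indicator {x..x+1} t * (2 * (f t)\<^sup>2 + (f' t)\<^sup>2))"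
    by (rule square_le_window[OF f])
  also have "\<dots> \<le> (LINT t|lborel. 2 * (f t)\<^sup>2 + (f' t)\<^sup>2)"
    using i integrable_mult_indicator[OF _ i, of "{x..x+1}"]
    by (intro integral_mono) (auto simp: indicator_def)
  also have "\<dots> = 2 * (LINT t|lborel. (f t)\<^sup>2) + (LINT t|lborel. (f' t)\<^sup>2)"
    using L2D(2)[OF f(3)] L2D(2)[OF f(4)] by simp
  finally show ?thesis .
qed

text \<open>The unit window that dominates f(x)^2 moves off to infinity, where the integral of an
  integrable function over it tends to 0.\<close>

lemma L2_C1_tendsto_0_at_top:
  assumes f: "\<And>x. (f has_real_derivative f' x) (at x)" "continuous_on UNIV f'" "f \<in> L2" "f' \<in> L2"
  shows "(f \<longlongrightarrow> 0) at_top"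
proof -
  define q where "q = (\<lambda>t. 2 * (f t)\<^sup>2 + (f' t)\<^sup>2)"
  have q: "integrable lborel q"
    using L2D(2)[OF f(3)] L2D(2)[OF f(4)] by (simp add: q_def)
  note [measurable] = borel_measurable_integrable[OF q]
  have "((\<lambda>x. LINT t|lborel. indicator {x..x+1} t * q t) \<longlongrightarrow> 0) at_top"
  proof (rule tendsto_at_topI_sequentially)
    fix X :: "nat \<Rightarrow> real" assume X: "filterlim X at_top sequentially"
    have "(\<lambda>n. LINT t|lborel. indicator {X n..X n+1} t * q t) \<longlonglongrightarrow> (LINT t::real|lborel. (0::real))"
    proof (rule integral_dominated_convergence)
      show "integrable lborel (\<lambda>t. \<bar>q t\<bar>)" using q by simp
      show "AE t in lborel. norm (indicator {X n..X n+1} t * q t) \<le> \<bar>q t\<bar>" for n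
        by (auto simp: indicator_def)
      show "AE t in lborel. (\<lambda>n. indicator {X n..X n+1} t * q t) \<longlonglongrightarrow> 0"
      proof (intro AE_I2)
        fix t :: real
        have "eventually (\<lambda>n. t < X n) sequentially" using X by (simp add: filterlim_at_top_dense)
        then have "eventually (\<lambda>n. indicator {X n..X n+1} t * q t = 0) sequentially"
          by eventually_elim auto
        then show "(\<lambda>n. indicator {X n..X n+1} t * q t) \<longlonglongrightarrow> 0" by (rule tendsto_eventually)
      qed
    qed simp_all
    then show "(\<lambda>n. LINT t|lborel. indicator {X n..X n+1} t * q t) \<longlonglongrightarrow> 0" by simp
  qed
  then have "((\<lambda>x. (f x)\<^sup>2) \<longlongrightarrow> 0) at_top"
    by (rule Lim_null_comparison[rotated]) (use square_le_window[OF f] in \<open>auto simp: q_def\<close>)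
  then show ?thesis by (simp add: power_tendsto_0_iff)
qed

lemma L2_reflect: "f \<in> L2 \<Longrightarrow> (\<lambda>x. f (- x)) \<in> L2"
  using lborel_integrable_real_affine[of "\<lambda>x. (f x)\<^sup>2" "-1" 0] by (auto simp: L2_def)

lemma L2_C1_tendsto_0_at_bot:
  assumes f: "\<And>x. (f has_real_derivative f' x) (at x)" "continuous_on UNIV f'" "f \<in> L2" "f' \<in> L2"
  shows "(f \<longlongrightarrow> 0) at_bot"
  unfolding filterlim_at_bot_mirror
proof (rule L2_C1_tendsto_0_at_top)
  show "((\<lambda>x. f (- x)) has_real_derivative (-1) * f' (- x)) (at x)" for x
    using f(1)[of "- x"] by (simp add: DERIV_mirror)
  show "continuous_on UNIV (\<lambda>x. (-1) * f' (- x))"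
    by (intro continuous_intros continuous_on_compose2[OF f(2)]) auto
  show "(\<lambda>x. f (- x)) \<in> L2" "(\<lambda>x. (-1) * f' (- x)) \<in> L2"
    by (intro L2_reflect L2_cmult f)+
qed

text \<open>Pointwise limits and Fatou's lemma take over the role of weak lower semicontinuity of
  the norm.\<close>

lemma L2_Fatou:
  assumes f: "\<And>n. f n \<in> L2" "\<And>n. (LINT x|lborel. (f n x)\<^sup>2) \<le> C" "\<And>x. (\<lambda>n. f n x) \<longlonglongrightarrow> F x"
  shows "F \<in> L2" "(LINT x|lborel. (F x)\<^sup>2) \<le> C"
proof -
  note [measurable] = L2D(1)[OF f(1)]
  have [measurable]: "F \<in> borel_measurable borel"
    by (rule borel_measurable_LIMSEQ_real[OF f(3)]) measurable
  have C: "0 \<le> C" using f(2)[of 0] by (rule order_trans[rotated]) simp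
  have "(\<integral>\<^sup>+x. ennreal ((F x)\<^sup>2) \<partial>lborel) = (\<integral>\<^sup>+x. liminf (\<lambda>n. ennreal ((f n x)\<^sup>2)) \<partial>lborel)"
  proof (intro nn_integral_cong)
    fix x
    have "(\<lambda>n. ennreal ((f n x)\<^sup>2)) \<longlonglongrightarrow> ennreal ((F x)\<^sup>2)"
      by (intro tendsto_ennrealI tendsto_intros f(3))
    then show "ennreal ((F x)\<^sup>2) = liminf (\<lambda>n. ennreal ((f n x)\<^sup>2))"
      using lim_imp_Liminf[OF sequentially_bot] by metis
  qed
  also have "\<dots> \<le> liminf (\<lambda>n. \<integral>\<^sup>+x. ennreal ((f n x)\<^sup>2) \<partial>lborel)"
    by (rule nn_integral_liminf) measurable
  also have "\<dots> \<le> liminf (\<lambda>n. ennreal C)"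
  proof (intro Liminf_mono always_eventually allI)
    fix n
    show "(\<integral>\<^sup>+x. ennreal ((f n x)\<^sup>2) \<partial>lborel) \<le> ennreal C"
      using nn_integral_eq_integral[OF L2D(2)[OF f(1)[of n]]] f(2)[of n] by (simp add: ennreal_leI)
  qed
  also have "\<dots> = ennreal C" by (simp add: Liminf_const)
  finally have le: "(\<integral>\<^sup>+x. ennreal ((F x)\<^sup>2) \<partial>lborel) \<le> ennreal C" .
  then have i: "integrable lborel (\<lambda>x. (F x)\<^sup>2)"
    by (intro integrableI_bounded) (auto simp: le_less_trans)
  then show "F \<in> L2" by (simp add: L2_def)
  show "(LINT x|lborel. (F x)\<^sup>2) \<le> C"
    using le nn_integral_eq_integral[OF i] C by (simp add: ennreal_le_iff)
qed

text \<open>The Arzela-Ascoli argument on the whole line: a diagonal subsequence converges at every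
  rational, and the common modulus carries convergence to all other points.\<close>

lemma equi_modulus_subsequence:
  fixes f :: "nat \<Rightarrow> real \<Rightarrow> real"
  assumes "\<And>n x. \<bar>f n x\<bar> \<le> B" "\<And>n x y. \<bar>f n x - f n y\<bar> \<le> sqrt \<bar>x - y\<bar> * C"
  obtains k l where "strict_mono (k :: nat \<Rightarrow> nat)" "\<And>x. (\<lambda>n. f (k n) x) \<longlonglongrightarrow> l x"
proof -
  have "countable (\<rat> :: real set)" by (rule countable_rat)
  from function_convergent_subsequence[OF this, of f B]
  obtain k :: "nat \<Rightarrow> nat" where k: "strict_mono k" "\<And>x. x \<in> \<rat> \<Longrightarrow> \<exists>l. (\<lambda>n. f (k n) x) \<longlonglongrightarrow> l"
    using assms(1) by (auto simp: image_def)
  have C: "C \<ge> 0" using assms(2)[of 0 0 1] by (simp add: order_trans[OF abs_ge_zero])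
  have "convergent (\<lambda>n. f (k n) x)" for x
  proof (rule Cauchy_convergent, rule metric_CauchyI)
    fix e :: real assume e: "e > 0"
    \<comment> \<open>Chosen so that sqrt d times C is below e / 4; the added 1 keeps the quotient
      meaningful when C is 0.\<close>
    define d where "d = (e / (4 * (C + 1)))\<^sup>2"
    have d: "d > 0" using e C by (simp add: d_def)
    obtain y where y: "y \<in> \<rat>" "x < y" "y < x + d" using Rats_dense_in_real[of x "x + d"] d by auto
    have close: "\<bar>f n x - f n y\<bar> < e / 3" for n
    proof -
      have "sqrt \<bar>x - y\<bar> \<le> e / (4 * (C + 1))"
        using y e C by (intro real_le_lsqrt) (auto simp: d_def)
      then have "sqrt \<bar>x - y\<bar> * C \<le> e / (4 * (C + 1)) * C" using C by (intro mult_right_mono) auto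
      also have "\<dots> < e / 3" using e C by (simp add: divide_simps)
      finally show ?thesis using assms(2)[of n x y] by linarith
    qed
    have "Cauchy (\<lambda>n. f (k n) y)" using k(2)[OF y(1)] LIMSEQ_imp_Cauchy by blast
    moreover have "e / 3 > 0" using e by simp
    ultimately obtain M where M: "\<And>m n. m \<ge> M \<Longrightarrow> n \<ge> M \<Longrightarrow> dist (f (k m) y) (f (k n) y) < e / 3"
      using metric_CauchyD by blast
    show "\<exists>M. \<forall>m\<ge>M. \<forall>n\<ge>M. dist (f (k m) x) (f (k n) x) < e"
    proof (intro exI allI impI)
      fix m n assume "M \<le> m" "M \<le> n"
      then show "dist (f (k m) x) (f (k n) x) < e"
        using M[of m n] close[of "k m"] close[of "k n"] unfolding dist_real_def by linarith
    qed
  qed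
  then show ?thesis using that[OF k(1), of "\<lambda>x. lim (\<lambda>n. f (k n) x)"] convergent_LIMSEQ_iff by blast
qed

lemma modulus_LIMSEQ:
  fixes f :: "nat \<Rightarrow> real \<Rightarrow> real"
  assumes "\<And>n x y. \<bar>f n x - f n y\<bar> \<le> sqrt \<bar>x - y\<bar> * C" "\<And>x. (\<lambda>n. f n x) \<longlonglongrightarrow> l x"
  shows "\<bar>l x - l y\<bar> \<le> sqrt \<bar>x - y\<bar> * C"
  by (rule LIMSEQ_le_const2[of "\<lambda>n. \<bar>f n x - f n y\<bar>"]) (use assms in \<open>auto intro!: tendsto_intros\<close>)

text \<open>The derivatives converge boundedly and pointwise, not necessarily uniformly, so the
  limit is taken in the integrated identity by dominated convergence; continuity of F' then allows
  differentiating back.\<close>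

lemma has_derivative_LIMSEQ:
  fixes f f' :: "nat \<Rightarrow> real \<Rightarrow> real"
  assumes f: "\<And>n x. (f n has_real_derivative f' n x) (at x)" "\<And>n. continuous_on UNIV (f' n)"
    and bound: "\<And>n x. \<bar>f' n x\<bar> \<le> B"
    and lim: "\<And>x. (\<lambda>n. f n x) \<longlonglongrightarrow> F x" "\<And>x. (\<lambda>n. f' n x) \<longlonglongrightarrow> F' x" and cont: "continuous_on UNIV F'"
  shows "(F has_real_derivative F' x) (at x)"
proof -
  obtain P where P: "\<And>x. (P has_real_derivative F' x) (at x)" "P 0 = 0"
    using ex_antiderivative[OF cont] by blast
  note [measurable] = borel_measurable_continuous_onI[OF cont] borel_measurable_continuous_onI[OF f(2)]
  have *: "F b - F a = P b - P a" if "a \<le> b" for a b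
  proof -
    have "(\<lambda>n. LINT t|lborel. indicator {a..b} t * f' n t) \<longlonglongrightarrow> (LINT t|lborel. indicator {a..b} t * F' t)"
    proof (rule integral_dominated_convergence)
      show "integrable lborel (\<lambda>t. indicator {a..b} t * B)" by (rule integrable_Icc_const)
      show "AE t in lborel. (\<lambda>n. indicator {a..b} t * f' n t) \<longlonglongrightarrow> indicator {a..b} t * F' t"
        by (intro AE_I2 tendsto_intros lim)
      show "AE t in lborel. norm (indicator {a..b} t * f' n t) \<le> indicator {a..b} t * B" for n
        using bound by (auto simp: indicator_def)
    qed simp_all
    then have "(\<lambda>n. f n b - f n a) \<longlonglongrightarrow> P b - P a"
      using LINT_FTC[OF that f(1) f(2)] LINT_FTC[OF that P(1) cont] by simp
    moreover have "(\<lambda>n. f n b - f n a) \<longlonglongrightarrow> F b - F a" by (intro tendsto_intros lim)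
    ultimately show ?thesis using LIMSEQ_unique by blast
  qed
  have "F = (\<lambda>x. P x + F 0)"
  proof
    fix x show "F x = P x + F 0" using *[of 0 x] *[of x 0] P(2) by (cases "0 \<le> x") auto
  qed
  then show ?thesis using DERIV_add[OF P(1)[of x] DERIV_const[of "F 0"]] by simp
qed

text \<open>Taylor's formula with unit step: f' is f(x+1) - f(x) minus an integral remainder, which
  is bounded by the unit window average of |f''|.\<close>

lemma L2_interpolate:
  assumes f: "\<And>x. (f has_real_derivative f' x) (at x)" "\<And>x. (f' has_real_derivative f'' x) (at x)"
    "continuous_on UNIV f''" "f \<in> L2" "f'' \<in> L2"
  shows "f' \<in> L2"
proof -
  have cf: "continuous_on UNIV f'"
    using f(2) by (meson DERIV_continuous_on has_field_derivative_at_within)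
  define R where "R = (\<lambda>x. f (x + 1) - f x - f' x)"
  have c: "continuous_on UNIV f"
    using f(1) by (meson DERIV_continuous_on has_field_derivative_at_within)
  have abs: "(\<lambda>x. \<bar>f'' x\<bar>) \<in> L2" using f(5) by (auto simp: L2_def)
  have "R \<in> L2"
  proof (rule L2_bound[OF steklov_L2(1)[OF abs, of 1]])
    have "continuous_on UNIV R" unfolding R_def
      by (intro continuous_intros cf c continuous_on_compose2[OF c]) auto
    then show "R \<in> borel_measurable borel" by (rule borel_measurable_continuous_onI)
    fix x
    have cF: "continuous_on UNIV (\<lambda>t. (x + 1 - t) * f'' t)" by (intro continuous_intros f(3))
    have "(LINT t|lborel. indicator {x..x+1} t * ((x + 1 - t) * f'' t)) =
        ((x + 1 - (x + 1)) * f' (x + 1) + f (x + 1)) - ((x + 1 - x) * f' x + f x)"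
      using cF f(1,2) by (intro LINT_FTC[where F = "\<lambda>t. (x + 1 - t) * f' t + f t"])
         (auto intro!: derivative_eq_intros)
    then have "\<bar>R x\<bar> = \<bar>LINT t|lborel. indicator {x..x+1} t * ((x + 1 - t) * f'' t)\<bar>" by (simp add: R_def)
    also have "\<dots> \<le> (LINT t|lborel. \<bar>indicator {x..x+1} t * ((x + 1 - t) * f'' t)\<bar>)"
      by (rule integral_abs_bound)
    also have "\<dots> \<le> (LINT t|lborel. indicator {x..x+1} t * \<bar>f'' t\<bar>)"
    proof (rule integral_mono)
      show "integrable lborel (\<lambda>t. \<bar>indicator {x..x+1} t * ((x + 1 - t) * f'' t)\<bar>)"
        using integrable_Icc_mult[OF cF] by (intro integrable_abs)
      show "integrable lborel (\<lambda>t. indicator {x..x+1} t * \<bar>f'' t\<bar>)" by (rule L2_Icc_integrable[OF abs])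
      fix t show "\<bar>indicator {x..x+1} t * ((x + 1 - t) * f'' t)\<bar> \<le> indicator {x..x+1} t * \<bar>f'' t\<bar>"
        by (auto simp: indicator_def abs_mult intro!: mult_left_le_one_le)
    qed
    finally show "\<bar>R x\<bar> \<le> \<bar>steklov 1 (\<lambda>x. \<bar>f'' x\<bar>) x\<bar>" by (simp add: steklov_def)
  qed simp
  then have "(\<lambda>x. f (x + 1) - f x - R x) \<in> L2"
    by (intro L2_diff L2_shift(1) f(4))
  then show ?thesis by (simp add: R_def)
qed

section \<open>Regularity of weak solutions\<close>

text \<open>Class C^3 rather than smooth, because the test function required below is a third
  antiderivative of a function that is only continuous.\<close>

definition C3_supported :: "real \<Rightarrow> (real \<Rightarrow> real) \<Rightarrow> (real \<Rightarrow> real) \<Rightarrow> (real \<Rightarrow> real) \<Rightarrow> (real \<Rightarrow> real) \<Rightarrow> bool" where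
  "C3_supported N \<phi> \<phi>1 \<phi>2 \<phi>3 \<longleftrightarrow> (\<forall>x. (\<phi> has_real_derivative \<phi>1 x) (at x)) \<and>
     (\<forall>x. (\<phi>1 has_real_derivative \<phi>2 x) (at x)) \<and> (\<forall>x. (\<phi>2 has_real_derivative \<phi>3 x) (at x)) \<and>
     continuous_on UNIV \<phi>3 \<and> (\<forall>x. x \<notin> {-N..N} \<longrightarrow> \<phi> x = 0 \<and> \<phi>1 x = 0 \<and> \<phi>2 x = 0 \<and> \<phi>3 x = 0)"

text \<open>The test function is the third antiderivative of \<open>h = w (F - p)\<close>, where \<open>p\<close> is the
  quadratic polynomial that makes \<open>h\<close> orthogonal to \<open>1\<close>, \<open>x\<close>, \<open>x\<^sup>2\<close>. The weight
  \<open>w = N\<^sup>2 - x\<^sup>2\<close> makes \<open>h\<close> vanish at the end points.\<close>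
lemma du_Bois_Reymond_third_order:
  fixes F :: "real \<Rightarrow> real"
  assumes N: "N > 0" and F: "continuous_on UNIV F"
    and weak: "\<And>\<phi> \<phi>1 \<phi>2 \<phi>3. C3_supported N \<phi> \<phi>1 \<phi>2 \<phi>3 \<Longrightarrow> (LINT x|lborel. F x * \<phi>3 x) = 0"
  obtains c0 c1 c2 where "\<And>x. x \<in> {-N<..<N} \<Longrightarrow> F x = c0 + c1 * x + c2 * x\<^sup>2"
proof -
  define I where "I = (\<lambda>f::real \<Rightarrow> real. LINT x|lborel. indicator {-N..N} x * f x)"
  define u where "u = (\<lambda>x. N\<^sup>2 - x\<^sup>2)"
  have cu: "continuous_on UNIV u" unfolding u_def by (intro continuous_intros)
  have I_add: "I (\<lambda>x. f x + g x) = I f + I g"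
    and I_diff: "I (\<lambda>x. f x - g x) = I f - I g"
    if "continuous_on UNIV f" "continuous_on UNIV g" for f g :: "real \<Rightarrow> real"
    using integrable_Icc_mult[OF that(1), of "-N" N] integrable_Icc_mult[OF that(2), of "-N" N]
    by (simp_all add: I_def distrib_left right_diff_distrib)
  have I_cmult: "I (\<lambda>x. c * f x) = c * I f" for c and f :: "real \<Rightarrow> real"
    unfolding I_def by (simp add: mult.left_commute[of _ c])
  have I_FTC: "I f = G N - G (-N)" if "\<And>x. (G has_real_derivative f x) (at x)" "continuous_on UNIV f" for f G :: "real \<Rightarrow> real"
    unfolding I_def using N that by (intro LINT_FTC) auto
  have pow: "((\<lambda>x. x ^ Suc j / real (Suc j)) has_real_derivative x ^ j) (at x)" for j and x :: real
    using DERIV_cdivide[OF DERIV_pow[of "Suc j" x], of "real (Suc j)"] by (simp del: of_nat_Suc power_Suc)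
  have I_mon: "I (\<lambda>x. u x * x ^ i) = (N\<^sup>2 * (N ^ Suc i / real (Suc i)) - N ^ Suc (i + 2) / real (Suc (i + 2)))
      - (N\<^sup>2 * ((-N) ^ Suc i / real (Suc i)) - (-N) ^ Suc (i + 2) / real (Suc (i + 2)))" for i
  proof (rule I_FTC)
    show "continuous_on UNIV (\<lambda>x. u x * x ^ i)" by (intro continuous_intros cu)
    show "((\<lambda>x. N\<^sup>2 * (x ^ Suc i / real (Suc i)) - x ^ Suc (i + 2) / real (Suc (i + 2)))
        has_real_derivative u x * x ^ i) (at x)" for x
      using DERIV_diff[OF DERIV_cmult[OF pow[of i x], of "N\<^sup>2"] pow[of "i + 2" x]]
      by (simp add: u_def algebra_simps power_add power2_eq_square del: of_nat_Suc)
  qed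
  \<comment> \<open>Moments of the weight N^2 - x^2 on the interval. The odd ones vanish by
    symmetry, so the conditions on p split into one equation for \<open>c1\<close> and a 2x2 system
    for \<open>c0\<close>, \<open>c2\<close> with determinant D, solved by Cramer's rule.\<close>
  define G0 where "G0 = 4 * N ^ 3 / 3"
  define G2 where "G2 = 4 * N ^ 5 / 15"
  define G4 where "G4 = 4 * N ^ 7 / 35"
  define Gi where "Gi = (\<lambda>i. I (\<lambda>x. u x * x ^ i))"
  have G: "Gi 0 = G0" "Gi 1 = 0" "Gi 2 = G2" "Gi 3 = 0" "Gi 4 = G4"
    unfolding Gi_def I_mon G0_def G2_def G4_def by (simp_all add: eval_nat_numeral field_simps)
  define D where "D = G0 * G4 - G2\<^sup>2"
  have D_eq: "D = 128 / 1575 * N ^ 10"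
    by (simp add: D_def G0_def G2_def G4_def power2_eq_square eval_nat_numeral field_simps)
  have D: "D \<noteq> 0" unfolding D_eq using N by simp
  have G2: "G2 \<noteq> 0" using N by (simp add: G2_def)
  define m where "m = (\<lambda>i. I (\<lambda>x. u x * (x ^ i * F x)))"
  define c0 where "c0 = (m 0 * G4 - m 2 * G2) / D"
  define c1 where "c1 = m 1 / G2"
  define c2 where "c2 = (G0 * m 2 - G2 * m 0) / D"
  define p where "p = (\<lambda>x. c0 + c1 * x + c2 * x\<^sup>2)"
  have cp: "continuous_on UNIV p" unfolding p_def by (intro continuous_intros)
  \<comment> \<open>\<open>max 0\<close> cuts the weight off outside \<open>{-N..N}\<close> without
    losing continuity.\<close>
  define h where "h = (\<lambda>x. max 0 (u x) * (F x - p x))"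
  have ch: "continuous_on UNIV h" unfolding h_def by (intro continuous_intros cu F cp)
  have out: "h x = 0" if "x \<notin> {-N..N}" for x
  proof -
    have "N\<^sup>2 \<le> x\<^sup>2" using that N by (intro abs_le_square_iff[THEN iffD1]) auto
    then show ?thesis by (simp add: h_def u_def)
  qed
  have u_nonneg: "u x \<ge> 0" if "x \<in> {-N..N}" for x
    using that N abs_le_square_iff[of x N] by (auto simp: u_def)
  have h_in: "I (\<lambda>x. f x * h x) = I (\<lambda>x. f x * (u x * (F x - p x)))" for f
    unfolding I_def using u_nonneg
    by (intro Bochner_Integration.integral_cong) (auto simp: h_def indicator_def max_def)
  have mom: "I (\<lambda>x. x ^ i * h x) = m i - c0 * Gi i - c1 * Gi (i + 1) - c2 * Gi (i + 2)" for i
  proof -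
    have "I (\<lambda>x. x ^ i * h x) = I (\<lambda>x. u x * (x ^ i * F x) - c0 * (u x * x ^ i) - c1 * (u x * x ^ (i + 1))
        - c2 * (u x * x ^ (i + 2)))"
      unfolding h_in by (rule arg_cong[of _ _ I]) (auto simp: fun_eq_iff p_def power2_eq_square algebra_simps)
    also have "\<dots> = m i - c0 * Gi i - c1 * Gi (i + 1) - c2 * Gi (i + 2)"
      by (subst I_diff | (intro continuous_intros cu F; fail))+ (simp only: I_cmult m_def Gi_def)
    finally show ?thesis .
  qed
  have "c0 * G0 + c2 * G2 = m 0 * D / D" "c0 * G2 + c2 * G4 = m 2 * D / D"
    unfolding c0_def c2_def times_divide_eq_left add_divide_distrib[symmetric]
    by (simp_all add: D_def power2_eq_square algebra_simps)
  then have lin: "m 0 = c0 * G0 + c2 * G2" "m 2 = c0 * G2 + c2 * G4" using D by simp_all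
  have mom0: "I (\<lambda>x. x ^ 0 * h x) = 0"
    unfolding mom using G lin by (simp add: eval_nat_numeral)
  have mom1: "I (\<lambda>x. x ^ 1 * h x) = 0"
    unfolding mom using G G2 by (simp add: c1_def eval_nat_numeral)
  have mom2: "I (\<lambda>x. x ^ 2 * h x) = 0"
    unfolding mom using G lin by (simp add: eval_nat_numeral)
  obtain f2 where f2: "\<And>x. (f2 has_real_derivative h x) (at x)" "f2 (-N) = 0"
    using ex_antiderivative[OF ch] by blast
  have c2': "continuous_on UNIV f2" using f2(1) by (meson DERIV_continuous_on has_field_derivative_at_within)
  obtain f1 where f1: "\<And>x. (f1 has_real_derivative f2 x) (at x)" "f1 (-N) = 0"
    using ex_antiderivative[OF c2'] by blast
  have c1': "continuous_on UNIV f1" using f1(1) by (meson DERIV_continuous_on has_field_derivative_at_within)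
  obtain f0 where f0: "\<And>x. (f0 has_real_derivative f1 x) (at x)" "f0 (-N) = 0"
    using ex_antiderivative[OF c1'] by blast
  \<comment> \<open>By parts, the moments of order 0, 1 and 2 express the values at N of the
    successive antiderivatives; as the moments vanish, all three antiderivatives are supported in
    the interval.\<close>
  have f2N: "f2 N = 0"
  proof -
    have "I (\<lambda>x. x ^ 0 * h x) = f2 N - f2 (-N)"
      by (rule I_FTC) (use f2 ch in auto)
    then show ?thesis using mom0 f2 by simp
  qed
  have f1N: "f1 N = 0"
  proof -
    have "I (\<lambda>x. x ^ 1 * h x) = (N * f2 N - f1 N) - (-N * f2 (-N) - f1 (-N))"
      by (rule I_FTC[where G = "\<lambda>x. x * f2 x - f1 x"])
         (auto intro!: derivative_eq_intros f1 f2 continuous_intros ch)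
    then show ?thesis using mom1 f2 f1 f2N by simp
  qed
  have f0N: "f0 N = 0"
  proof -
    have "I (\<lambda>x. x ^ 2 * h x) = (N\<^sup>2 * f2 N - 2 * N * f1 N + 2 * f0 N) 
        - ((-N)\<^sup>2 * f2 (-N) - 2 * (-N) * f1 (-N) + 2 * f0 (-N))"
      by (rule I_FTC[where G = "\<lambda>x. x\<^sup>2 * f2 x - 2 * x * f1 x + 2 * f0 x"])
         (auto intro!: derivative_eq_intros f0 f1 f2 continuous_intros ch simp: algebra_simps)
    then show ?thesis using mom2 f2 f1 f0 f2N f1N by simp
  qed
  have o2: "f2 x = 0" if "x \<notin> {-N..N}" for x
    using antiderivative_support[OF f2 f2N _ that] out by blast
  have o1: "f1 x = 0" if "x \<notin> {-N..N}" for x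
    using antiderivative_support[OF f1 f1N _ that] o2 by blast
  have o0: "f0 x = 0" if "x \<notin> {-N..N}" for x
    using antiderivative_support[OF f0 f0N _ that] o1 by blast
  have "(LINT x|lborel. F x * h x) = 0"
    using out o0 o1 o2 f0(1) f1(1) f2(1) ch by (intro weak[of f0 f1 f2]) (auto simp: C3_supported_def)
  moreover have "(LINT x|lborel. F x * h x) = I (\<lambda>x. F x * h x)"
    unfolding I_def using out by (intro Bochner_Integration.integral_cong) (auto simp: indicator_def)
  ultimately have IF: "I (\<lambda>x. F x * h x) = 0" by simp
  \<comment> \<open>In the integral of (F - p) h the part with F vanishes by hypothesis and the part
    with p by the moment conditions, which leaves a weighted square of integral zero.\<close>
  have "I (\<lambda>x. u x * (F x - p x)\<^sup>2) = I (\<lambda>x. (F x - p x) * h x)"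
    unfolding h_in by (rule arg_cong[of _ _ I]) (auto simp: power2_eq_square fun_eq_iff)
  also have "\<dots> = I (\<lambda>x. F x * h x - c0 * (x ^ 0 * h x) - c1 * (x ^ 1 * h x) - c2 * (x ^ 2 * h x))"
    by (rule arg_cong[of _ _ I]) (auto simp: p_def fun_eq_iff algebra_simps)
  also have "\<dots> = I (\<lambda>x. F x * h x) - c0 * I (\<lambda>x. x ^ 0 * h x) - c1 * I (\<lambda>x. x ^ 1 * h x) - c2 * I (\<lambda>x. x ^ 2 * h x)"
    by (subst I_diff | (intro continuous_intros ch F; fail))+ (simp only: I_cmult)
  finally have zero: "I (\<lambda>x. u x * (F x - p x)\<^sup>2) = 0" by (simp only: IF mom0 mom1 mom2)
  have cs: "continuous_on UNIV (\<lambda>x. u x * (F x - p x)\<^sup>2)" by (intro continuous_intros cu F cp)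
  have "integral {-N..N} (\<lambda>x. u x * (F x - p x)\<^sup>2) = 0"
    using set_borel_integral_eq_integral(2)[of "{-N..N}" "\<lambda>x. u x * (F x - p x)\<^sup>2"] zero
      integrable_Icc_mult[OF cs, of "-N" N]
    by (simp add: I_def set_lebesgue_integral_def set_integrable_def)
  then have z: "\<forall>x\<in>{-N..N}. u x * (F x - p x)\<^sup>2 = 0"
    using N u_nonneg continuous_on_subset[OF cs]
    by (subst (asm) integral_eq_0_iff) auto
  show ?thesis
  proof (rule that)
    fix x assume x: "x \<in> {-N<..<N}"
    then have "x\<^sup>2 < N\<^sup>2" using abs_le_square_iff[of N x] N by (auto simp: not_le[symmetric])
    then have "u x \<noteq> 0" by (simp add: u_def)
    with z x show "F x = c0 + c1 * x + c2 * x\<^sup>2" by (auto simp: p_def)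
  qed
qed

text \<open>Integrating the lower-order terms by parts until they too are tested against
  \<open>\<phi>3\<close> shows that F = a \<open>\<psi>1\<close> + Y is orthogonal to every
  \<open>\<phi>3\<close>, hence a quadratic. So \<open>\<psi>1\<close> is expressed by
  antiderivatives of continuous functions and can be differentiated three times.\<close>

lemma weak_solution_regular:
  fixes \<psi> \<psi>1 p p' q :: "real \<Rightarrow> real"
  assumes \<psi>: "\<And>x. (\<psi> has_real_derivative \<psi>1 x) (at x)" "continuous_on UNIV \<psi>1"
    and p: "\<And>x. (p has_real_derivative p' x) (at x)" "continuous_on UNIV p'"
    and q: "continuous_on UNIV q" and a: "a \<noteq> 0"
    and weak: "\<And>N \<phi> \<phi>1 \<phi>2 \<phi>3. C3_supported N \<phi> \<phi>1 \<phi>2 \<phi>3 \<Longrightarrow>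
      (LINT x|lborel. p x * \<psi>1 x * \<phi>1 x + q x * \<psi> x * \<phi> x - a * \<psi>1 x * \<phi>3 x) = 0"
  obtains \<psi>2 \<psi>3 \<psi>4 where "\<And>x. (\<psi>1 has_real_derivative \<psi>2 x) (at x)"
    "\<And>x. (\<psi>2 has_real_derivative \<psi>3 x) (at x)" "\<And>x. (\<psi>3 has_real_derivative \<psi>4 x) (at x)"
    "continuous_on UNIV \<psi>4" "\<And>x. a * \<psi>4 x = p' x * \<psi>1 x + p x * \<psi>2 x - q x * \<psi> x"
proof -
  have D_cont: "continuous_on UNIV f" if "\<And>x. (f has_real_derivative f' x) (at x)" for f f' :: "real \<Rightarrow> real"
    using that by (meson DERIV_continuous_on has_field_derivative_at_within)
  have c\<psi>: "continuous_on UNIV \<psi>" and cp: "continuous_on UNIV p"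
    using D_cont[OF \<psi>(1)] D_cont[OF p(1)] .
  have "continuous_on UNIV (\<lambda>x. q x * \<psi> x)" by (intro continuous_intros q c\<psi>)
  then obtain W1 where W1: "\<And>x. (W1 has_real_derivative q x * \<psi> x) (at x)"
    using ex_antiderivative by metis
  obtain W where W: "\<And>x. (W has_real_derivative W1 x) (at x)"
    using ex_antiderivative[OF D_cont[OF W1]] by metis
  have "continuous_on UNIV (\<lambda>x. p x * \<psi>1 x)" by (intro continuous_intros cp \<psi>(2))
  then obtain V where V: "\<And>x. (V has_real_derivative p x * \<psi>1 x) (at x)"
    using ex_antiderivative by metis
  have "continuous_on UNIV (\<lambda>x. W x - V x)" by (intro continuous_intros D_cont[OF W] D_cont[OF V])
  then obtain Y where Y: "\<And>x. (Y has_real_derivative W x - V x) (at x)"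
    using ex_antiderivative by metis
  define F where "F = (\<lambda>x. a * \<psi>1 x + Y x)"
  have cF: "continuous_on UNIV F" unfolding F_def by (intro continuous_intros D_cont[OF Y] \<psi>(2))
  have F_zero: "(LINT x|lborel. F x * \<phi>3 x) = 0"
    if "N > 0" and test: "C3_supported N \<phi> \<phi>1 \<phi>2 \<phi>3" for N \<phi> \<phi>1 \<phi>2 \<phi>3
  proof -
    have \<phi>: "N > 0" "\<And>x. (\<phi> has_real_derivative \<phi>1 x) (at x)" "\<And>x. (\<phi>1 has_real_derivative \<phi>2 x) (at x)"
      "\<And>x. (\<phi>2 has_real_derivative \<phi>3 x) (at x)" "continuous_on UNIV \<phi>3"
      "\<And>x. x \<notin> {-N..N} \<Longrightarrow> \<phi> x = 0 \<and> \<phi>1 x = 0 \<and> \<phi>2 x = 0 \<and> \<phi>3 x = 0"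
      using that unfolding C3_supported_def by blast+
    note c = D_cont[OF \<phi>(2)] D_cont[OF \<phi>(3)] D_cont[OF \<phi>(4)] \<phi>(5) c\<psi> cp q \<psi>(2) D_cont[OF Y]
    have ends: "\<phi> (N+1) = 0 \<and> \<phi>1 (N+1) = 0 \<and> \<phi>2 (N+1) = 0" "\<phi> (-N-1) = 0 \<and> \<phi>1 (-N-1) = 0 \<and> \<phi>2 (-N-1) = 0"
      using \<phi>(6)[of "N+1"] \<phi>(6)[of "-N-1"] \<phi>(1) by auto
    define G where "G = (\<lambda>x. p x * \<psi>1 x * \<phi>1 x + q x * \<psi> x * \<phi> x + Y x * \<phi>3 x)"
    have cG: "continuous_on UNIV G" unfolding G_def by (intro continuous_intros c)
    have oG: "G x = 0" if "x \<notin> {-N-1..N+1}" for x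
    proof -
      have "x \<notin> {-N..N}" using that by auto
      then show ?thesis using \<phi>(6)[of x] by (simp add: G_def)
    qed
    \<comment> \<open>An exact antiderivative of G: it shows that the two lower-order terms
      integrate to minus the integral of Y times \<open>\<phi>3\<close>.\<close>
    have dG: "((\<lambda>x. W1 x * \<phi> x - W x * \<phi>1 x + V x * \<phi>1 x + Y x * \<phi>2 x) has_real_derivative G x) (at x)" for x
      by (auto intro!: derivative_eq_intros W1 W V Y \<phi>(2-4) simp: G_def algebra_simps)
    have iG: "integrable lborel G"
      using \<phi>(1) oG by (intro LINT_FTC_supp(1)[where a = "-N-1" and b = "N+1", OF _ dG cG]) auto
    have "(LINT x|lborel. G x) = (W1 (N+1) * \<phi> (N+1) - W (N+1) * \<phi>1 (N+1) + V (N+1) * \<phi>1 (N+1) + Y (N+1) * \<phi>2 (N+1))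
        - (W1 (-N-1) * \<phi> (-N-1) - W (-N-1) * \<phi>1 (-N-1) + V (-N-1) * \<phi>1 (-N-1) + Y (-N-1) * \<phi>2 (-N-1))"
      using \<phi>(1) oG by (intro LINT_FTC_supp(2)[OF _ dG cG]) auto
    then have "(LINT x|lborel. G x) = 0" using ends by simp
    define K where "K = (\<lambda>x. p x * \<psi>1 x * \<phi>1 x + q x * \<psi> x * \<phi> x - a * \<psi>1 x * \<phi>3 x)"
    have cK: "continuous_on UNIV K" unfolding K_def by (intro continuous_intros c)
    have oK: "K x = 0" if "x \<notin> {-N-1..N+1}" for x
    proof -
      have "x \<notin> {-N..N}" using that by auto
      then show ?thesis using \<phi>(6)[of x] by (simp add: K_def)
    qed
    obtain P where P: "\<And>x. (P has_real_derivative K x) (at x)" using ex_antiderivative[OF cK] by metis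
    have iK: "integrable lborel K"
      using \<phi>(1) oK by (intro LINT_FTC_supp(1)[where a = "-N-1" and b = "N+1", OF _ P cK]) auto
    have "(LINT x|lborel. K x) = 0" unfolding K_def by (rule weak[OF test])
    have "(LINT x|lborel. F x * \<phi>3 x) = (LINT x|lborel. G x - K x)"
      by (intro Bochner_Integration.integral_cong) (auto simp: F_def G_def K_def algebra_simps)
    also have "\<dots> = 0" using iG iK \<open>(LINT x|lborel. K x) = 0\<close> \<open>(LINT x|lborel. G x) = 0\<close> by simp
    finally show ?thesis .
  qed
  \<comment> \<open>The quadratic found on an interval might depend on N. Its values at 0, 1 and -1
    determine the coefficients, and N = |x| + 2 keeps these points and x inside.\<close>
  define b0 where "b0 = F 0"
  define b1 where "b1 = (F 1 - F (-1)) / 2"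
  define b2 where "b2 = (F 1 + F (-1)) / 2 - F 0"
  have quad: "F x = b0 + b1 * x + b2 * x\<^sup>2" for x
  proof -
    define N where "N = \<bar>x\<bar> + 2"
    have N: "N > 0" by (simp add: N_def)
    obtain c0 c1 c2 where c: "\<And>x. x \<in> {-N<..<N} \<Longrightarrow> F x = c0 + c1 * x + c2 * x\<^sup>2"
      by (rule du_Bois_Reymond_third_order[OF N cF]) (use F_zero[OF N] in blast)+
    have mem: "0 \<in> {-N<..<N}" "1 \<in> {-N<..<N}" "-1 \<in> {-N<..<N}" "x \<in> {-N<..<N}"
      unfolding N_def greaterThanLessThan_iff by linarith+
    have "F 0 = c0" "F 1 = c0 + c1 + c2" "F (-1) = c0 - c1 + c2"
      using mem(1-3)[THEN c] by simp_all
    then have "b0 = c0" "b1 = c1" "b2 = c2" by (simp_all add: b0_def b1_def b2_def field_simps)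
    then show ?thesis using c[OF mem(4)] by simp
  qed
  have \<psi>1_eq: "\<psi>1 x = (b0 + b1 * x + b2 * x\<^sup>2 - Y x) / a" for x
    using quad[of x] a by (simp add: F_def field_simps)
  define \<psi>2 where "\<psi>2 = (\<lambda>x. (b1 + 2 * b2 * x - (W x - V x)) / a)"
  define \<psi>3 where "\<psi>3 = (\<lambda>x. (2 * b2 - (W1 x - p x * \<psi>1 x)) / a)"
  define \<psi>4 where "\<psi>4 = (\<lambda>x. (p' x * \<psi>1 x + p x * \<psi>2 x - q x * \<psi> x) / a)"
  show ?thesis
  proof (rule that)
    have "((\<lambda>x. (b0 + b1 * x + b2 * x\<^sup>2 - Y x) / a) has_real_derivative \<psi>2 x) (at x)" for x
      using a by (auto intro!: derivative_eq_intros Y simp: \<psi>2_def)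
    then show 1: "(\<psi>1 has_real_derivative \<psi>2 x) (at x)" for x using \<psi>1_eq by presburger
    show 2: "(\<psi>2 has_real_derivative \<psi>3 x) (at x)" for x
      unfolding \<psi>2_def using a by (auto intro!: derivative_eq_intros W V simp: \<psi>3_def)
    show "(\<psi>3 has_real_derivative \<psi>4 x) (at x)" for x
      unfolding \<psi>3_def using a by (auto intro!: derivative_eq_intros W1 p(1) 1 simp: \<psi>4_def)
    show "continuous_on UNIV \<psi>4"
      unfolding \<psi>4_def using a by (intro continuous_intros p(2) \<psi>(2) cp q c\<psi> D_cont[OF 2]) auto
    show "a * \<psi>4 x = p' x * \<psi>1 x + p x * \<psi>2 x - q x * \<psi> x" for x using a by (simp add: \<psi>4_def)
  qed
qed

section \<open>The variational problem\<close>

definition C2_H2 :: "(real \<Rightarrow> real) \<Rightarrow> bool" where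
  "C2_H2 f \<longleftrightarrow> C2_L2 f (deriv f) (deriv (deriv f))"

lemma C2_L2_imp_C2_H2:
  assumes "C2_L2 f f1 f2"
  shows "C2_H2 f" "deriv f = f1" "deriv (deriv f) = f2"
proof -
  show "deriv f = f1"
    using assms DERIV_imp_deriv unfolding C2_L2_def by blast
  moreover show "deriv (deriv f) = f2"
    using assms DERIV_imp_deriv unfolding C2_L2_def \<open>deriv f = f1\<close> by blast
  ultimately show "C2_H2 f" using assms unfolding C2_H2_def by metis
qed

lemma C2_H2D:
  assumes "C2_H2 f"
  shows "(f has_real_derivative deriv f x) (at x)" "(deriv f has_real_derivative deriv (deriv f) x) (at x)"
    "continuous_on UNIV f" "continuous_on UNIV (deriv f)" "continuous_on UNIV (deriv (deriv f))"
    "f \<in> L2" "deriv f \<in> L2" "deriv (deriv f) \<in> L2"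
  using assms unfolding C2_H2_def C2_L2_def
  by (auto intro: DERIV_continuous_on has_field_derivative_at_within)

lemma C2_H2_lincomb:
  assumes f: "C2_H2 f" and h: "C2_H2 h"
  shows "C2_H2 (\<lambda>x. s * f x + t * h x)" "deriv (\<lambda>x. s * f x + t * h x) = (\<lambda>x. s * deriv f x + t * deriv h x)"
    "deriv (\<lambda>x. s * deriv f x + t * deriv h x) = (\<lambda>x. s * deriv (deriv f) x + t * deriv (deriv h) x)"
proof -
  have *: "C2_L2 (\<lambda>x. s * f x + t * h x) (\<lambda>x. s * deriv f x + t * deriv h x) (\<lambda>x. s * deriv (deriv f) x + t * deriv (deriv h) x)"
    unfolding C2_L2_def using C2_H2D[OF f] C2_H2D[OF h]
    by (auto intro!: derivative_eq_intros continuous_intros L2_add L2_cmult)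
  show "C2_H2 (\<lambda>x. s * f x + t * h x)" "deriv (\<lambda>x. s * f x + t * h x) = (\<lambda>x. s * deriv f x + t * deriv h x)"
    "deriv (\<lambda>x. s * deriv f x + t * deriv h x) = (\<lambda>x. s * deriv (deriv f) x + t * deriv (deriv h) x)"
    using C2_L2_imp_C2_H2[OF *] by auto
qed

lemma bounded_mult_L2_integrable:
  assumes "f \<in> L2" "h \<in> L2" "continuous_on UNIV b" "\<And>x. \<bar>b x\<bar> \<le> (B :: real)"
  shows "integrable lborel (\<lambda>x. b x * (f x * h x))"
  using L2_mult_integrable[OF L2_mult_bounded[OF assms(1) borel_measurable_continuous_onI[OF assms(3)] assms(4)] assms(2)]
  by (simp add: mult.assoc)

lemma C3_supported_C2_H2:
  assumes "C3_supported N \<phi> \<phi>1 \<phi>2 \<phi>3"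
  shows "C2_H2 \<phi>" "deriv \<phi> = \<phi>1" "deriv (deriv \<phi>) = \<phi>2"
proof -
  have d: "\<And>x. (\<phi> has_real_derivative \<phi>1 x) (at x)" "\<And>x. (\<phi>1 has_real_derivative \<phi>2 x) (at x)"
    "\<And>x. (\<phi>2 has_real_derivative \<phi>3 x) (at x)"
    "\<And>x. x \<notin> {-N..N} \<Longrightarrow> \<phi> x = 0" "\<And>x. x \<notin> {-N..N} \<Longrightarrow> \<phi>1 x = 0" "\<And>x. x \<notin> {-N..N} \<Longrightarrow> \<phi>2 x = 0"
    using assms unfolding C3_supported_def by blast+
  have L2: "f \<in> L2" if "\<And>x. x \<notin> {-N..N} \<Longrightarrow> f x = 0" "continuous_on UNIV f" for f
  proof -
    have eq: "(\<lambda>x. indicator {-N..N} x * (f x)\<^sup>2) = (\<lambda>x. (f x)\<^sup>2)"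
      using that(1) by (force simp: indicator_def fun_eq_iff)
    have "continuous_on UNIV (\<lambda>x. (f x)\<^sup>2)" by (intro continuous_intros that)
    from integrable_Icc_mult[OF this, of "-N" N] show ?thesis
      unfolding L2_def eq using borel_measurable_continuous_onI[OF that(2)] by simp
  qed
  have c: "continuous_on UNIV \<phi>" "continuous_on UNIV \<phi>1" "continuous_on UNIV \<phi>2"
    using d(1-3) by (meson DERIV_continuous_on has_field_derivative_at_within)+
  have "C2_L2 \<phi> \<phi>1 \<phi>2"
    unfolding C2_L2_def using d(1,2) c L2[of \<phi>] L2[of \<phi>1] L2[of \<phi>2] d(4-6) by blast
  from C2_L2_imp_C2_H2[OF this] show "C2_H2 \<phi>" "deriv \<phi> = \<phi>1" "deriv (deriv \<phi>) = \<phi>2" by auto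
qed

text \<open>Nonnegativity at large t excludes c < 0, and for c = 0 it forces b = 0; otherwise
  evaluate at the minimum t = - b / c.\<close>

lemma discriminant_le:
  fixes a b c :: real
  assumes "\<And>t. a + 2 * t * b + t\<^sup>2 * c \<ge> 0"
  shows "b\<^sup>2 \<le> a * c"
proof (cases "c = 0")
  case True
  have "b = 0"
  proof (rule ccontr)
    assume "b \<noteq> 0"
    then show False using assms[of "- (a + 1) / (2 * b)"] True by (simp add: field_simps)
  qed
  then show ?thesis using True by simp
next
  case False
  have "c > 0"
  proof (rule ccontr)
    assume "\<not> c > 0"
    then have c: "c < 0" using False by simp
    \<comment> \<open>Large enough for the quadratic term to outweigh |a| + 2 T |b|.\<close>
    define T where "T = (\<bar>a\<bar> + 2 * \<bar>b\<bar> + 1) / (- c) + 1"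
    have T: "T \<ge> 1" using c by (simp add: T_def divide_nonneg_neg)
    have "T * (- c) = \<bar>a\<bar> + 2 * \<bar>b\<bar> + 1 - c" using c by (simp add: T_def field_simps)
    then have "T * (T * (- c)) = T * (\<bar>a\<bar> + 2 * \<bar>b\<bar> + 1 - c)" by simp
    moreover have "T * b \<le> T * \<bar>b\<bar>" using T by (intro mult_left_mono) auto
    moreover have "1 * (\<bar>a\<bar> + 1 - c) \<le> T * (\<bar>a\<bar> + 1 - c)" using T c by (intro mult_right_mono) auto
    ultimately have "a + 2 * T * b + T\<^sup>2 * c < 0" using c by (simp add: power2_eq_square algebra_simps)
    then show False using assms[of T] by simp
  qed
  then have "0 \<le> c * (a + 2 * (- b / c) * b + (- b / c)\<^sup>2 * c)" using assms[of "- b / c"]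
    by (intro mult_nonneg_nonneg) (simp_all only: less_imp_le)
  also have "\<dots> = a * c - b\<^sup>2" using False by (simp add: field_simps power2_eq_square)
  finally show ?thesis by simp
qed

text \<open>The magnetic energy has the form \<open>A2 \<integral> f''\<^sup>2 + A1 \<integral> f'\<^sup>2 + A0 \<integral> f\<^sup>2\<close> in both field cases, and
  \<open>r\<close> stands for \<open>g k\<^sup>2 rho'\<close>.\<close>
locale growth_problem =
  fixes rho rho' r :: "real \<Rightarrow> real" and k \<mu> A0 A1 A2 c0 R0 B :: real
  assumes rho: "\<And>x. (rho has_real_derivative rho' x) (at x)" "continuous_on UNIV rho'"
    and rho_bounds: "c0 > 0" "\<And>x. c0 \<le> rho x" "\<And>x. rho x \<le> R0"
    and r: "continuous_on UNIV r" "\<And>x. \<bar>r x\<bar> \<le> B" "integrable lborel r"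
    and const: "k > 0" "\<mu> > 0" "A0 \<ge> 0" "A1 \<ge> 0" "A2 \<ge> 0"
begin

text \<open>Coefficients of the second, first and zeroth order parts of the form; its Euler-Lagrange
  equation is \<open>ca\<close> \<psi>'''' - (\<open>cp\<close> \<psi>')' + \<open>cq\<close> \<psi>
  = 0.\<close>

definition "ca l = l * \<mu> + A2"
definition "cp l x = l\<^sup>2 * rho x + 2 * l * \<mu> * k\<^sup>2 + A1"
definition "cq l x = l\<^sup>2 * k\<^sup>2 * rho x + l * \<mu> * k ^ 4 + A0 - r x"

definition bil :: "real \<Rightarrow> (real \<Rightarrow> real) \<Rightarrow> (real \<Rightarrow> real) \<Rightarrow> real" where
  "bil l f h = (LINT x|lborel. ca l * (deriv (deriv f) x * deriv (deriv h) x) +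
      (cp l x * (deriv f x * deriv h x) + cq l x * (f x * h x)))"

abbreviation "form l f \<equiv> bil l f f"

lemma rho_cont: "continuous_on UNIV rho"
  using rho(1) by (meson DERIV_continuous_on has_field_derivative_at_within)

lemma rho_abs: "\<bar>rho x\<bar> \<le> R0"
  using rho_bounds(2,3)[of x] rho_bounds(1) by linarith

lemma R0_pos: "R0 > 0"
  using rho_bounds(2,3)[of 0] rho_bounds(1) by linarith

lemma coeff_cont: "continuous_on UNIV (cp l)" "continuous_on UNIV (cq l)"
  unfolding cp_def[abs_def] cq_def[abs_def] by (intro continuous_intros rho_cont r)+

lemma coeff_bounds: "\<bar>cp l x\<bar> \<le> l\<^sup>2 * R0 + \<bar>2 * l * \<mu> * k\<^sup>2 + A1\<bar>"
  "\<bar>cq l x\<bar> \<le> l\<^sup>2 * k\<^sup>2 * R0 + \<bar>l * \<mu> * k ^ 4 + A0\<bar> + B"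
proof -
  have "\<bar>l\<^sup>2 * rho x\<bar> \<le> l\<^sup>2 * R0" "\<bar>l\<^sup>2 * k\<^sup>2 * rho x\<bar> \<le> l\<^sup>2 * k\<^sup>2 * R0"
    unfolding abs_mult using rho_abs[of x] by (auto intro!: mult_mono)
  then show "\<bar>cp l x\<bar> \<le> l\<^sup>2 * R0 + \<bar>2 * l * \<mu> * k\<^sup>2 + A1\<bar>"
    "\<bar>cq l x\<bar> \<le> l\<^sup>2 * k\<^sup>2 * R0 + \<bar>l * \<mu> * k ^ 4 + A0\<bar> + B"
    using r(2)[of x] unfolding cp_def cq_def by linarith+
qed

lemma bil_integrable:
  assumes f: "C2_H2 f" and h: "C2_H2 h"
  shows "integrable lborel (\<lambda>x. ca l * (deriv (deriv f) x * deriv (deriv h) x))"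
    "integrable lborel (\<lambda>x. cp l x * (deriv f x * deriv h x))"
    "integrable lborel (\<lambda>x. cq l x * (f x * h x))"
  using C2_H2D(6-8)[OF f] C2_H2D(6-8)[OF h] L2_mult_integrable[of "deriv (deriv f)" "deriv (deriv h)"]
  by (auto intro!: bounded_mult_L2_integrable[OF _ _ coeff_cont(1) coeff_bounds(1)]
      bounded_mult_L2_integrable[OF _ _ coeff_cont(2) coeff_bounds(2)])

lemma form_lincomb:
  assumes f: "C2_H2 f" and h: "C2_H2 h"
  shows "form l (\<lambda>x. s * f x + t * h x) = s\<^sup>2 * form l f + 2 * s * t * bil l f h + t\<^sup>2 * form l h"
proof -
  define X where "X = (\<lambda>f h x. ca l * (deriv (deriv f) x * deriv (deriv h) x) +
      (cp l x * (deriv f x * deriv h x) + cq l x * (f x * h x)))"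
  have X: "bil l f h = (LINT x|lborel. X f h x)" for f h by (simp add: bil_def X_def)
  have i: "integrable lborel (X f h)" if "C2_H2 f" "C2_H2 h" for f h
    unfolding X_def by (intro Bochner_Integration.integrable_add bil_integrable that)
  have "form l (\<lambda>x. s * f x + t * h x) = (LINT x|lborel. s\<^sup>2 * X f f x + 2 * s * t * X f h x + t\<^sup>2 * X h h x)"
    unfolding X by (intro Bochner_Integration.integral_cong)
      (auto simp: X_def C2_H2_lincomb[OF f h] power2_eq_square algebra_simps)
  then show ?thesis unfolding X using i[OF f f] i[OF f h] i[OF h h] by simp
qed

section \<open>Energy functionals and their bounds\<close>

definition N0 :: "(real \<Rightarrow> real) \<Rightarrow> real" where "N0 f = (LINT x|lborel. (f x)\<^sup>2)"
text \<open>\<open>Rk\<close> is the weighted energy normalised in \<open>A_set\<close>,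
  \<open>Dk\<close> the viscous dissipation, \<open>K\<close> the buoyancy term and
  \<open>En\<close> the squared H^2 norm.\<close>

definition "Rk f = (LINT x|lborel. rho x * (k\<^sup>2 * (f x)\<^sup>2 + (deriv f x)\<^sup>2))"
definition "Dk f = N0 (deriv (deriv f)) + 2 * k\<^sup>2 * N0 (deriv f) + k ^ 4 * N0 f"
definition "K f = (LINT x|lborel. r x * (f x)\<^sup>2)"
definition "Q0 f = A2 * N0 (deriv (deriv f)) + A1 * N0 (deriv f) + A0 * N0 f - K f"
definition "En f = N0 f + N0 (deriv f) + N0 (deriv (deriv f))"

lemma N0_nonneg [simp]: "N0 f \<ge> 0" by (simp add: N0_def)

text \<open>Splits off the dependence on l: for fixed f the form is a quadratic polynomial in l, so
  continuity in l requires no estimate.\<close>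

lemma form_eq:
  assumes f: "C2_H2 f"
  shows "form l f = l\<^sup>2 * Rk f + l * \<mu> * Dk f + Q0 f"
proof -
  note L = C2_H2D(6-8)[OF f]
  note i = L[THEN L2D(2)] bounded_mult_L2_integrable[OF L(1) L(1) r(1,2)]
    bounded_mult_L2_integrable[OF L(1) L(1) rho_cont rho_abs]
    bounded_mult_L2_integrable[OF L(2) L(2) rho_cont rho_abs]
  note i' = i[unfolded power2_eq_square[symmetric]]
  have R: "Rk f = k\<^sup>2 * (LINT x|lborel. rho x * (f x)\<^sup>2) + (LINT x|lborel. rho x * (deriv f x)\<^sup>2)"
    unfolding Rk_def using i' by (simp add: distrib_left mult.left_commute[of _ "k\<^sup>2"])
  have "form l f = (LINT x|lborel. ca l * (deriv (deriv f) x)\<^sup>2 + l\<^sup>2 * (rho x * (deriv f x)\<^sup>2) + 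
     (2 * l * \<mu> * k\<^sup>2 + A1) * (deriv f x)\<^sup>2 + l\<^sup>2 * k\<^sup>2 * (rho x * (f x)\<^sup>2) + (l * \<mu> * k ^ 4 + A0) * (f x)\<^sup>2 - r x * (f x)\<^sup>2)"
    unfolding bil_def by (intro Bochner_Integration.integral_cong)
      (auto simp: cp_def cq_def power2_eq_square algebra_simps)
  also have "\<dots> = ca l * N0 (deriv (deriv f)) + l\<^sup>2 * (LINT x|lborel. rho x * (deriv f x)\<^sup>2) + 
     (2 * l * \<mu> * k\<^sup>2 + A1) * N0 (deriv f) + l\<^sup>2 * k\<^sup>2 * (LINT x|lborel. rho x * (f x)\<^sup>2) + (l * \<mu> * k ^ 4 + A0) * N0 f - K f"
    unfolding N0_def K_def using i' by simp
  finally show ?thesis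
    unfolding R Dk_def Q0_def ca_def by (simp add: algebra_simps)
qed

lemma functional_bounds:
  assumes f: "C2_H2 f"
  shows "c0 * k\<^sup>2 * N0 f \<le> Rk f" "Rk f \<le> R0 * (k\<^sup>2 + 1) * En f" "Dk f \<le> (1 + 2 * k\<^sup>2 + k ^ 4) * En f"
    "min 1 (min (2 * k\<^sup>2) (k ^ 4)) * En f \<le> Dk f" "K f \<le> B * N0 f"
proof -
  note L = C2_H2D(6-8)[OF f]
  note i = L[THEN L2D(2)] bounded_mult_L2_integrable[OF L(1) L(1) r(1,2)]
    bounded_mult_L2_integrable[OF L(1) L(1) rho_cont rho_abs]
    bounded_mult_L2_integrable[OF L(2) L(2) rho_cont rho_abs]
  note i' = i[unfolded power2_eq_square[symmetric]]
  have iR: "integrable lborel (\<lambda>x. rho x * (k\<^sup>2 * (f x)\<^sup>2 + (deriv f x)\<^sup>2))"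
    using i' by (simp add: distrib_left mult.left_commute[of _ "k\<^sup>2"])
  have "(LINT x|lborel. c0 * k\<^sup>2 * (f x)\<^sup>2) \<le> Rk f"
    unfolding Rk_def
  proof (rule integral_mono[OF _ iR])
    show "c0 * k\<^sup>2 * (f x)\<^sup>2 \<le> rho x * (k\<^sup>2 * (f x)\<^sup>2 + (deriv f x)\<^sup>2)" for x
      unfolding mult.assoc using rho_bounds(1) rho_bounds(2)[of x] by (intro mult_mono) auto
  qed (use i' in simp)
  then show "c0 * k\<^sup>2 * N0 f \<le> Rk f" by (simp add: N0_def)
  have "Rk f \<le> (LINT x|lborel. R0 * (k\<^sup>2 * (f x)\<^sup>2 + (deriv f x)\<^sup>2))"
    unfolding Rk_def
  proof (rule integral_mono[OF iR])
    show "rho x * (k\<^sup>2 * (f x)\<^sup>2 + (deriv f x)\<^sup>2) \<le> R0 * (k\<^sup>2 * (f x)\<^sup>2 + (deriv f x)\<^sup>2)" for x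
      using rho_bounds(3) by (intro mult_right_mono) auto
  qed (use i' in simp)
  also have "\<dots> = R0 * (k\<^sup>2 * N0 f + N0 (deriv f))" using i' by (simp add: N0_def)
  also have "\<dots> \<le> R0 * ((k\<^sup>2 + 1) * En f)"
    using R0_pos by (intro mult_left_mono) (auto simp: En_def algebra_simps)
  finally show "Rk f \<le> R0 * (k\<^sup>2 + 1) * En f" by (simp add: mult.assoc)
  show "Dk f \<le> (1 + 2 * k\<^sup>2 + k ^ 4) * En f"
    by (simp add: Dk_def En_def algebra_simps)
  have "min 1 (min (2 * k\<^sup>2) (k ^ 4)) * N0 (deriv (deriv f)) \<le> 1 * N0 (deriv (deriv f))"
    "min 1 (min (2 * k\<^sup>2) (k ^ 4)) * N0 (deriv f) \<le> 2 * k\<^sup>2 * N0 (deriv f)"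
    "min 1 (min (2 * k\<^sup>2) (k ^ 4)) * N0 f \<le> k ^ 4 * N0 f"
    by (intro mult_right_mono N0_nonneg; simp)+
  then show "min 1 (min (2 * k\<^sup>2) (k ^ 4)) * En f \<le> Dk f"
    by (simp only: Dk_def En_def distrib_left)
  have "K f \<le> (LINT x|lborel. B * (f x)\<^sup>2)"
    unfolding K_def
  proof (rule integral_mono)
    show "r x * (f x)\<^sup>2 \<le> B * (f x)\<^sup>2" for x using r(2)[of x] by (intro mult_right_mono) auto
  qed (use i' in simp_all)
  then show "K f \<le> B * N0 f" by (simp add: N0_def)
qed

text \<open>Every term of the form except - \<open>K f\<close> is nonnegative, so \<open>K f\<close>
  exceeds each of the others. Comparison with the dissipation controls the H^2 norm, which later
  keeps the limit from vanishing; comparison with inertia bounds the rates.\<close>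

lemma K_le_if_form_neg:
  assumes f: "C2_H2 f" and l: "l > 0" and neg: "form l f < 0"
  shows "l * \<mu> * (min 1 (min (2 * k\<^sup>2) (k ^ 4)) * En f) < K f" "N0 f > 0" "l\<^sup>2 * (c0 * k\<^sup>2) < B"
proof -
  note b = functional_bounds[OF f]
  have "Rk f \<ge> 0" using b(1) rho_bounds(1) by (meson N0_nonneg mult_nonneg_nonneg less_imp_le order_trans zero_le_power2)
  have "l * \<mu> * Dk f \<ge> l * \<mu> * (min 1 (min (2 * k\<^sup>2) (k ^ 4)) * En f)"
    using l const b(4) by (intro mult_left_mono) auto
  moreover have En: "En f \<ge> 0" by (simp add: En_def)
  moreover have "l\<^sup>2 * Rk f \<ge> l\<^sup>2 * (c0 * k\<^sup>2 * N0 f)" using b(1) by (intro mult_left_mono) auto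
  moreover have "A2 * N0 (deriv (deriv f)) + A1 * N0 (deriv f) + A0 * N0 f \<ge> 0" using const by simp
  moreover have nn: "l\<^sup>2 * (c0 * k\<^sup>2 * N0 f) \<ge> 0" "l * \<mu> * (min 1 (min (2 * k\<^sup>2) (k ^ 4)) * En f) \<ge> 0"
    using l const rho_bounds(1) En by (auto intro!: mult_nonneg_nonneg)
  moreover note neg[unfolded form_eq[OF f] Q0_def] b(5)
  ultimately have *: "l * \<mu> * (min 1 (min (2 * k\<^sup>2) (k ^ 4)) * En f) < K f"
    "l\<^sup>2 * (c0 * k\<^sup>2 * N0 f) < B * N0 f" by linarith+
  then show "l * \<mu> * (min 1 (min (2 * k\<^sup>2) (k ^ 4)) * En f) < K f" by simp
  have "N0 f \<noteq> 0" using *(2) nn(1) by auto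
  then show "N0 f > 0" using N0_nonneg[of f] by linarith
  then show "l\<^sup>2 * (c0 * k\<^sup>2) < B" using *(2) by (simp flip: mult.assoc)
qed

section \<open>The critical growth rate\<close>

definition "unstable = {l. l > 0 \<and> (\<exists>f. C2_H2 f \<and> form l f < 0)}"
definition "lam = Sup unstable"

lemma unstable_bdd_above: "bdd_above unstable"
proof (rule bdd_aboveI)
  fix l assume "l \<in> unstable"
  then have l: "l > 0" and *: "l\<^sup>2 * (c0 * k\<^sup>2) < B"
    using K_le_if_form_neg(3) by (auto simp: unstable_def)
  have c: "c0 * k\<^sup>2 > 0" using rho_bounds(1) const by simp
  \<comment> \<open>For l > 1 one has l \<le> l^2, which makes the quadratic bound linear; the added
    1 covers the remaining l.\<close>
  show "l \<le> B / (c0 * k\<^sup>2) + 1"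
  proof (cases "l \<le> 1")
    case True
    have "B \<ge> 0" using r(2)[of 0] by linarith
    then show ?thesis using True c by (simp add: add_increasing)
  next
    case False
    then have "l * 1 \<le> l * l" using l by (intro mult_left_mono) auto
    then have "l * (c0 * k\<^sup>2) \<le> l\<^sup>2 * (c0 * k\<^sup>2)" using c by (intro mult_right_mono) (auto simp: power2_eq_square)
    then have "l \<le> B / (c0 * k\<^sup>2)" using * c by (simp add: pos_le_divide_eq)
    then show ?thesis by simp
  qed
qed

text \<open>A negative value at rate 0 persists for small positive rates by continuity.\<close>

lemma lam_pos:
  assumes f: "C2_H2 f" and neg: "Q0 f < 0"
  shows "unstable \<noteq> {}" "lam > 0"
proof -
  have "((\<lambda>l. l\<^sup>2 * Rk f + l * \<mu> * Dk f + Q0 f) \<longlongrightarrow> 0\<^sup>2 * Rk f + 0 * \<mu> * Dk f + Q0 f) (at_right 0)"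
    by (intro tendsto_intros)
  then have "((\<lambda>l. form l f) \<longlongrightarrow> Q0 f) (at_right 0)" by (simp add: form_eq[OF f])
  from order_tendstoD(2)[OF this neg] obtain b where "b > 0" "\<And>l. 0 < l \<Longrightarrow> l < b \<Longrightarrow> form l f < 0"
    by (auto simp: eventually_at_right_field)
  then have u: "b / 2 \<in> unstable" "b / 2 > 0" using f by (auto simp: unstable_def)
  then show "unstable \<noteq> {}" by blast
  show "lam > 0" using u cSup_upper[OF u(1) unstable_bdd_above] by (simp add: lam_def)
qed

text \<open>Negativity is an open condition in l: a negative value at \<open>lam\<close> would
  persist slightly beyond the supremum.\<close>

lemma form_lam_nonneg:
  assumes f: "C2_H2 f" and "lam > 0"
  shows "form lam f \<ge> 0"
proof (rule ccontr)
  assume "\<not> form lam f \<ge> 0"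
  then have neg: "form lam f < 0" by simp
  have "((\<lambda>l. l\<^sup>2 * Rk f + l * \<mu> * Dk f + Q0 f) \<longlongrightarrow> lam\<^sup>2 * Rk f + lam * \<mu> * Dk f + Q0 f) (at_right lam)"
    by (intro tendsto_intros)
  then have "((\<lambda>l. form l f) \<longlongrightarrow> form lam f) (at_right lam)" by (simp add: form_eq[OF f])
  from order_tendstoD(2)[OF this neg] obtain b where "b > lam" "\<And>l. lam < l \<Longrightarrow> l < b \<Longrightarrow> form l f < 0"
    by (auto simp: eventually_at_right_field)
  then have "(lam + b) / 2 \<in> unstable" "(lam + b) / 2 > lam" using f \<open>lam > 0\<close> by (auto simp: unstable_def)
  then show False using cSup_upper[OF _ unstable_bdd_above] by (fastforce simp: lam_def)
qed

lemma bil_Cauchy_Schwarz: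
  assumes f: "C2_H2 f" and h: "C2_H2 h" and lam: "lam > 0"
  shows "(bil lam f h)\<^sup>2 \<le> form lam f * form lam h"
proof (rule discriminant_le)
  fix t
  have "0 \<le> form lam (\<lambda>x. 1 * f x + t * h x)"
    by (intro form_lam_nonneg C2_H2_lincomb f h lam)
  also have "\<dots> = form lam f + 2 * t * bil lam f h + t\<^sup>2 * form lam h"
    unfolding form_lincomb[OF f h] by simp
  finally show "form lam f + 2 * t * bil lam f h + t\<^sup>2 * form lam h \<ge> 0" .
qed

text \<open>Take negative directions at rates just below \<open>lam\<close>, normalised in H^2.
  Raising the rate to \<open>lam\<close> costs at most a multiple of the gap, which squeezes the
  form between 0 and a null sequence.\<close>

lemma minimizing_sequence:
  assumes "unstable \<noteq> {}" and lam: "lam > 0"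
  obtains f where "\<And>n. C2_H2 (f n)" "\<And>n. En (f n) = 1" "(\<lambda>n. form lam (f n)) \<longlonglongrightarrow> 0"
    "\<And>n. lam / 2 * \<mu> * min 1 (min (2 * k\<^sup>2) (k ^ 4)) \<le> K (f n)"
proof -
  \<comment> \<open>The cap \<open>lam / 2\<close> keeps the rates above \<open>lam / 2\<close>,
    which makes the lower bound on \<open>K\<close> uniform.\<close>
  define e where "e = (\<lambda>n. min (lam / 2) (inverse (real (Suc n))))"
  have e: "e n > 0" "e n \<le> lam / 2" "e n \<le> inverse (real (Suc n))" for n using lam by (auto simp: e_def)
  have "\<exists>l f. l > 0 \<and> lam - e n < l \<and> l \<le> lam \<and> C2_H2 f \<and> form l f < 0 \<and> En f = 1" for n
  proof -
    have "lam - e n < Sup unstable" using e(1)[of n] by (simp add: lam_def)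
    then obtain l where l: "l \<in> unstable" "lam - e n < l"
      using less_cSup_iff[OF assms(1) unstable_bdd_above] by blast
    have le: "l \<le> lam" unfolding lam_def by (rule cSup_upper[OF l(1) unstable_bdd_above])
    obtain f where f: "l > 0" "C2_H2 f" "form l f < 0" using l by (auto simp: unstable_def)
    define s where "s = inverse (sqrt (En f))"
    have En: "En f > 0" using K_le_if_form_neg(2)[OF f(2,1,3)] by (simp add: En_def add_pos_nonneg)
    have s: "s\<^sup>2 = inverse (En f)" using En by (simp add: s_def power_inverse)
    \<comment> \<open>Scaling is treated as a linear combination with second coefficient 0, so
      \<open>form_lincomb\<close> supplies homogeneity.\<close>
    note g = C2_H2_lincomb[OF f(2) f(2), of s 0]
    have "form l (\<lambda>x. s * f x + 0 * f x) = s\<^sup>2 * form l f" unfolding form_lincomb[OF f(2) f(2)] by simp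
    also have "\<dots> < 0" using f(3) En s by (simp add: mult_pos_neg)
    finally have "form l (\<lambda>x. s * f x + 0 * f x) < 0" .
    moreover have "En (\<lambda>x. s * f x + 0 * f x) = s\<^sup>2 * En f"
      unfolding En_def N0_def g(2,3) by (simp add: power_mult_distrib distrib_left)
    moreover have "s\<^sup>2 * En f = 1" using En s by simp
    ultimately show ?thesis using g(1) f(1) l(2) le by metis
  qed
  then obtain l f where lf: "\<And>n. l n > 0" "\<And>n. lam - e n < l n" "\<And>n. l n \<le> lam" "\<And>n. C2_H2 (f n)"
    "\<And>n. form (l n) (f n) < 0" "\<And>n. En (f n) = 1"
    by metis
  \<comment> \<open>Bounds the slope of the form between \<open>l n\<close> and \<open>lam\<close>,
    which is (\<open>lam\<close> + \<open>l n\<close>) \<open>Rk\<close> + \<mu> \<open>Dk\<close>,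
    using \<open>l n \<le> lam\<close> and the normalisation of \<open>En\<close>.\<close>
  define C where "C = 2 * lam * (R0 * (k\<^sup>2 + 1)) + \<mu> * (1 + 2 * k\<^sup>2 + k ^ 4)"
  have ub: "form lam (f n) \<le> inverse (real (Suc n)) * C" for n
  proof -
    note b = functional_bounds[OF lf(4)[of n]]
    have d: "0 \<le> lam - l n" "lam - l n \<le> inverse (real (Suc n))" using lf(2,3)[of n] e(3)[of n] by auto
    have R: "0 \<le> Rk (f n)" "Rk (f n) \<le> R0 * (k\<^sup>2 + 1)"
      using b(1,2) rho_bounds(1) lf(6)[of n] by (auto intro: order_trans[rotated])
    have D: "Dk (f n) \<le> 1 + 2 * k\<^sup>2 + k ^ 4" using b(3) lf(6)[of n] by simp
    have "form lam (f n) = form (l n) (f n) + (lam - l n) * ((lam + l n) * Rk (f n) + \<mu> * Dk (f n))"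
      unfolding form_eq[OF lf(4)] by (simp add: power2_eq_square algebra_simps)
    also have "\<dots> \<le> (lam - l n) * ((lam + l n) * Rk (f n) + \<mu> * Dk (f n))" using lf(5)[of n] by simp
    also have "(lam + l n) * Rk (f n) + \<mu> * Dk (f n) \<le> C"
    proof -
      have "(lam + l n) * Rk (f n) \<le> (2 * lam) * (R0 * (k\<^sup>2 + 1))"
        using R lf(1,3)[of n] lam by (intro mult_mono) auto
      moreover have "\<mu> * Dk (f n) \<le> \<mu> * (1 + 2 * k\<^sup>2 + k ^ 4)" using D const by (intro mult_left_mono) auto
      ultimately show ?thesis by (simp add: C_def)
    qed
    then have "(lam - l n) * ((lam + l n) * Rk (f n) + \<mu> * Dk (f n)) \<le> (lam - l n) * C"
      using d(1) by (rule mult_left_mono)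
    also have "(lam - l n) * C \<le> inverse (real (Suc n)) * C"
      using d lam R0_pos const by (intro mult_right_mono) (auto simp: C_def)
    finally show ?thesis .
  qed
  have "(\<lambda>n. inverse (real (Suc n)) * C) \<longlonglongrightarrow> 0 * C"
    by (intro tendsto_intros LIMSEQ_inverse_real_of_nat)
  then have "(\<lambda>n. inverse (real (Suc n)) * C) \<longlonglongrightarrow> 0" by simp
  then have "(\<lambda>n. form lam (f n)) \<longlonglongrightarrow> 0"
    by (rule tendsto_sandwich[OF _ _ tendsto_const, rotated 2])
       (use ub form_lam_nonneg[OF lf(4) lam] in auto)
  moreover have "lam / 2 * \<mu> * min 1 (min (2 * k\<^sup>2) (k ^ 4)) \<le> K (f n)" for n
  proof -
    have "l n > lam / 2" using lf(2)[of n] e(2)[of n] by simp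
    then have "lam / 2 * (\<mu> * min 1 (min (2 * k\<^sup>2) (k ^ 4))) \<le> l n * (\<mu> * min 1 (min (2 * k\<^sup>2) (k ^ 4)))"
      using const by (intro mult_right_mono) auto
    then show ?thesis using K_le_if_form_neg(1)[OF lf(4,1,5)[of n]] lf(6)[of n] by (simp add: mult.assoc)
  qed
  ultimately show ?thesis using that lf(4,6) by blast
qed

text \<open>The H^2 normalisation may be lost in the limit, since mass can escape to infinity.
  \<open>K\<close> does not suffer from this because r is integrable, and its lower bound makes the
  limit nonzero.\<close>

lemma minimizer:
  assumes f0: "C2_H2 f0" "Q0 f0 < 0"
  obtains \<psi> \<psi>1 \<psi>2 \<psi>3 \<psi>4 where
    "\<And>x. (\<psi> has_real_derivative \<psi>1 x) (at x)" "\<And>x. (\<psi>1 has_real_derivative \<psi>2 x) (at x)"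
    "\<And>x. (\<psi>2 has_real_derivative \<psi>3 x) (at x)" "\<And>x. (\<psi>3 has_real_derivative \<psi>4 x) (at x)"
    "continuous_on UNIV \<psi>4" "\<And>x. ca lam * \<psi>4 x = lam\<^sup>2 * rho' x * \<psi>1 x + cp lam x * \<psi>2 x - cq lam x * \<psi> x"
    "\<psi> \<in> L2" "\<psi>1 \<in> L2" "\<psi>2 \<in> L2" "\<exists>x. \<psi> x \<noteq> 0"
proof -
  note lam = lam_pos[OF f0]
  define \<delta> where "\<delta> = lam / 2 * \<mu> * min 1 (min (2 * k\<^sup>2) (k ^ 4))"
  have \<delta>: "\<delta> > 0" using lam const by (simp add: \<delta>_def)
  obtain f where f: "\<And>n. C2_H2 (f n)" "\<And>n. En (f n) = 1" "(\<lambda>n. form lam (f n)) \<longlonglongrightarrow> 0" "\<And>n. \<delta> \<le> K (f n)"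
    using minimizing_sequence[OF lam] unfolding \<delta>_def by blast
  note fD = C2_H2D[OF f(1)]
  have N: "N0 (f n) \<le> 1" "N0 (deriv (f n)) \<le> 1" "N0 (deriv (deriv (f n))) \<le> 1" for n
    using f(2)[of n] N0_nonneg[of "f n"] N0_nonneg[of "deriv (f n)"] N0_nonneg[of "deriv (deriv (f n))"]
    unfolding En_def by linarith+
  \<comment> \<open>The sup bound gives y^2 \<le> 2 * 1 + 1 = 3, rounded up to |y| \<le> 2.\<close>
  have small: "\<bar>y\<bar> \<le> 2" if "y\<^sup>2 \<le> 3" for y :: real
    using that power2_le_imp_le[of "\<bar>y\<bar>" 2] by simp
  have b0: "\<bar>f n x\<bar> \<le> 2" for n x
    using square_le_integral[OF fD(1,4,6,7), of n x] N[of n] unfolding N0_def by (intro small) linarith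
  have b1: "\<bar>deriv (f n) x\<bar> \<le> 2" for n x
    using square_le_integral[OF fD(2,5,7,8), of n x] N[of n] unfolding N0_def by (intro small) linarith
  have m0: "\<bar>f n x - f n y\<bar> \<le> sqrt \<bar>x - y\<bar> * 2" for n x y
  proof -
    have "\<bar>f n x - f n y\<bar> \<le> sqrt \<bar>x - y\<bar> * (N0 (deriv (f n)) + 1)"
      unfolding N0_def by (rule AC_modulus[OF AC_C1[OF fD(1,4,7)]])
    also have "\<dots> \<le> sqrt \<bar>x - y\<bar> * 2" using N[of n] by (intro mult_left_mono) auto
    finally show ?thesis .
  qed
  have m1: "\<bar>deriv (f n) x - deriv (f n) y\<bar> \<le> sqrt \<bar>x - y\<bar> * 2" for n x y
  proof -
    have "\<bar>deriv (f n) x - deriv (f n) y\<bar> \<le> sqrt \<bar>x - y\<bar> * (N0 (deriv (deriv (f n))) + 1)"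
      unfolding N0_def by (rule AC_modulus[OF AC_C1[OF fD(2,5,8)]])
    also have "\<dots> \<le> sqrt \<bar>x - y\<bar> * 2" using N[of n] by (intro mult_left_mono) auto
    finally show ?thesis .
  qed
  obtain k1 l0 where k1: "strict_mono (k1 :: nat \<Rightarrow> nat)" "\<And>x. (\<lambda>n. f (k1 n) x) \<longlonglongrightarrow> l0 x"
    by (rule equi_modulus_subsequence[of f, OF b0 m0]) (rule that)
  obtain k2 \<psi>1 where k2: "strict_mono (k2 :: nat \<Rightarrow> nat)" "\<And>x. (\<lambda>n. deriv (f (k1 (k2 n))) x) \<longlonglongrightarrow> \<psi>1 x"
    by (rule equi_modulus_subsequence[of "\<lambda>n. deriv (f (k1 n))", OF b1 m1]) (rule that)
  define \<psi> where "\<psi> = l0"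
  define F where "F = (\<lambda>n. f (k1 (k2 n)))"
  have F: "(\<lambda>n. F n x) \<longlonglongrightarrow> \<psi> x" "(\<lambda>n. deriv (F n) x) \<longlonglongrightarrow> \<psi>1 x" for x
    using LIMSEQ_subseq_LIMSEQ[OF k1(2) k2(1)] k2(2) unfolding F_def \<psi>_def comp_def by auto
  have sub: "strict_mono (k1 \<circ> k2)" using k1(1) k2(1) by (rule strict_mono_o)
  have F0: "(\<lambda>n. form lam (F n)) \<longlonglongrightarrow> 0"
    using LIMSEQ_subseq_LIMSEQ[OF f(3) sub] by (simp add: F_def comp_def)
  have FD: "C2_H2 (F n)" "\<bar>F n x\<bar> \<le> 2" "\<bar>deriv (F n) x\<bar> \<le> 2" "\<delta> \<le> K (F n)"
    "N0 (F n) \<le> 1" "N0 (deriv (F n)) \<le> 1" "N0 (deriv (deriv (F n))) \<le> 1" for n x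
    unfolding F_def by (rule f b0 b1 N)+
  note FC = C2_H2D[OF FD(1)]
  have "\<bar>\<psi>1 x - \<psi>1 y\<bar> \<le> sqrt \<bar>x - y\<bar> * 2" for x y
    by (rule modulus_LIMSEQ[of "\<lambda>n. deriv (F n)", OF _ F(2)]) (simp add: F_def m1)
  then have c\<psi>1: "continuous_on UNIV \<psi>1" by (rule equi_modulus_continuous)
  have d\<psi>: "(\<psi> has_real_derivative \<psi>1 x) (at x)" for x
    by (rule has_derivative_LIMSEQ[OF FC(1) FC(4) FD(3) F(1) F(2) c\<psi>1])
  have c\<psi>: "continuous_on UNIV \<psi>"
    using d\<psi> by (meson DERIV_continuous_on has_field_derivative_at_within)
  note [measurable] = borel_measurable_continuous_onI[OF c\<psi>] borel_measurable_continuous_onI[OF c\<psi>1]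
    borel_measurable_continuous_onI[OF FC(3)] borel_measurable_continuous_onI[OF FC(4)]
    borel_measurable_continuous_onI[OF r(1)] borel_measurable_continuous_onI[OF coeff_cont(1)]
    borel_measurable_continuous_onI[OF coeff_cont(2)]
  have L2\<psi>: "\<psi> \<in> L2" "\<psi>1 \<in> L2"
    by (rule L2_Fatou(1)[OF FC(6) FD(5)[unfolded N0_def] F(1)])
       (rule L2_Fatou(1)[OF FC(7) FD(6)[unfolded N0_def] F(2)])
  have weak: "(LINT x|lborel. cp lam x * \<psi>1 x * \<phi>1 x + cq lam x * \<psi> x * \<phi> x - ca lam * \<psi>1 x * \<phi>3 x) = 0"
    if test: "C3_supported N \<phi> \<phi>1 \<phi>2 \<phi>3" for N \<phi> \<phi>1 \<phi>2 \<phi>3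
  proof -
    note T = C3_supported_C2_H2[OF test]
    have T': "deriv \<phi>1 = \<phi>2" using T by simp
    have \<phi>: "\<And>x. (\<phi>2 has_real_derivative \<phi>3 x) (at x)" "continuous_on UNIV \<phi>3"
      "\<And>x. x \<notin> {-N..N} \<Longrightarrow> \<phi> x = 0 \<and> \<phi>1 x = 0 \<and> \<phi>2 x = 0 \<and> \<phi>3 x = 0"
      using test unfolding C3_supported_def by blast+
    have c: "continuous_on UNIV \<phi>" "continuous_on UNIV \<phi>1" "continuous_on UNIV \<phi>2"
      using C2_H2D(3-5)[OF T(1)] T T' by auto
    note [measurable] = c[THEN borel_measurable_continuous_onI] \<phi>(2)[THEN borel_measurable_continuous_onI]
    define H where "H = (\<lambda>u v x. cp lam x * v x * \<phi>1 x + cq lam x * u x * \<phi> x - ca lam * v x * \<phi>3 x)"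
    \<comment> \<open>Moves one derivative from the second-order term to the test function: G is the
      derivative of \<open>ca lam\<close> f' \<open>\<phi>2\<close>, so its integral
      vanishes.\<close>
    have bilH: "bil lam (F n) \<phi> = (LINT x|lborel. H (F n) (deriv (F n)) x)" for n
    proof -
      define G where "G = (\<lambda>x. ca lam * (deriv (deriv (F n)) x * \<phi>2 x + deriv (F n) x * \<phi>3 x))"
      \<comment> \<open>N may be negative, and \<open>\<phi>2\<close> should vanish at the end
        points as well, so the interval is enlarged.\<close>
      define M where "M = \<bar>N\<bar> + 1"
      have M: "M > 0" "\<And>x. x \<notin> {-M<..<M} \<Longrightarrow> x \<notin> {-N..N}" by (auto simp: M_def abs_if split: if_splits)
      have cG: "continuous_on UNIV G" unfolding G_def by (intro continuous_intros FC c \<phi>)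
      have dG: "((\<lambda>x. ca lam * (deriv (F n) x * \<phi>2 x)) has_real_derivative G x) (at x)" for x
        by (auto intro!: derivative_eq_intros FC \<phi> simp: G_def algebra_simps)
      have oG: "G x = 0" if "x \<notin> {-M..M}" for x
      proof -
        have "x \<notin> {-N..N}" using that M(2)[of x] by auto
        then show ?thesis using \<phi>(3)[of x] by (simp add: G_def)
      qed
      have MM: "-M \<le> M" using M by simp
      note LG = LINT_FTC_supp[OF MM dG cG oG]
      have "\<phi>2 M = 0" "\<phi>2 (-M) = 0" using \<phi>(3)[OF M(2)[of M]] \<phi>(3)[OF M(2)[of "-M"]] by auto
      then have "(LINT x|lborel. G x) = 0" using LG(2) by simp
      moreover have "bil lam (F n) \<phi> - (LINT x|lborel. G x) = (LINT x|lborel. H (F n) (deriv (F n)) x)"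
      proof -
        have "integrable lborel (\<lambda>x. ca lam * (deriv (deriv (F n)) x * \<phi>2 x) +
            (cp lam x * (deriv (F n) x * \<phi>1 x) + cq lam x * (F n x * \<phi> x)))"
          using bil_integrable[OF FD(1)[of n] T(1), of lam] unfolding T(2) T'
          by (intro Bochner_Integration.integrable_add) auto
        from Bochner_Integration.integral_diff[OF this LG(1)]
        have "bil lam (F n) \<phi> - (LINT x|lborel. G x) = (LINT x|lborel. (ca lam * (deriv (deriv (F n)) x * \<phi>2 x) +
            (cp lam x * (deriv (F n) x * \<phi>1 x) + cq lam x * (F n x * \<phi> x))) - G x)"
          unfolding bil_def T(2) T' by (rule sym)
        also have "\<dots> = (LINT x|lborel. H (F n) (deriv (F n)) x)"
          by (rule arg_cong[of _ _ "lebesgue_integral lborel"]) (simp add: H_def G_def fun_eq_iff algebra_simps)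
        finally show ?thesis .
      qed
      ultimately show ?thesis by simp
    qed
    \<comment> \<open>Cauchy-Schwarz for the semidefinite form: \<open>form lam (F n)\<close> tends
      to 0 while the factor of the test function is fixed.\<close>
    have "(\<lambda>n. bil lam (F n) \<phi>) \<longlonglongrightarrow> 0"
    proof -
      have "(\<lambda>n. form lam (F n) * form lam \<phi>) \<longlonglongrightarrow> 0 * form lam \<phi>" by (intro tendsto_intros F0)
      then have "(\<lambda>n. form lam (F n) * form lam \<phi>) \<longlonglongrightarrow> 0" by simp
      then have "(\<lambda>n. (bil lam (F n) \<phi>)\<^sup>2) \<longlonglongrightarrow> 0"
        by (rule Lim_null_comparison[rotated]) (use bil_Cauchy_Schwarz[OF FD(1) T(1) lam(2)] in auto)
      then show ?thesis by (simp add: power_tendsto_0_iff)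
    qed
    moreover have "(\<lambda>n. LINT x|lborel. H (F n) (deriv (F n)) x) \<longlonglongrightarrow> (LINT x|lborel. H \<psi> \<psi>1 x)"
    proof (rule integral_dominated_convergence)
      define w where "w = (\<lambda>x. \<bar>cp lam x\<bar> * 2 * \<bar>\<phi>1 x\<bar> + \<bar>cq lam x\<bar> * 2 * \<bar>\<phi> x\<bar> + \<bar>ca lam\<bar> * 2 * \<bar>\<phi>3 x\<bar>)"
      have cw: "continuous_on UNIV w" unfolding w_def by (intro continuous_intros coeff_cont c \<phi>)
      have "(\<lambda>x. indicator {-N..N} x * w x) = w"
        using \<phi>(3) by (force simp: w_def indicator_def fun_eq_iff)
      then show "integrable lborel w" using integrable_Icc_mult[OF cw, of "-N" N] by simp
      show "AE x in lborel. (\<lambda>n. H (F n) (deriv (F n)) x) \<longlonglongrightarrow> H \<psi> \<psi>1 x"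
        unfolding H_def by (intro AE_I2 tendsto_intros F)
      show "AE x in lborel. norm (H (F n) (deriv (F n)) x) \<le> w x" for n
      proof (intro AE_I2)
        fix x
        have "\<bar>cp lam x * deriv (F n) x * \<phi>1 x\<bar> \<le> \<bar>cp lam x\<bar> * 2 * \<bar>\<phi>1 x\<bar>"
          "\<bar>cq lam x * F n x * \<phi> x\<bar> \<le> \<bar>cq lam x\<bar> * 2 * \<bar>\<phi> x\<bar>"
          "\<bar>ca lam * deriv (F n) x * \<phi>3 x\<bar> \<le> \<bar>ca lam\<bar> * 2 * \<bar>\<phi>3 x\<bar>"
          unfolding abs_mult by (intro mult_right_mono mult_left_mono FD abs_ge_zero)+
        then show "norm (H (F n) (deriv (F n)) x) \<le> w x" unfolding H_def w_def real_norm_def by linarith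
      qed
    qed (simp_all add: H_def)
    ultimately have "(LINT x|lborel. H \<psi> \<psi>1 x) = 0" unfolding bilH using LIMSEQ_unique by blast
    then show ?thesis by (simp add: H_def)
  qed
  have dcp: "(cp lam has_real_derivative lam\<^sup>2 * rho' x) (at x)" for x
    unfolding cp_def[abs_def] by (auto intro!: derivative_eq_intros rho)
  have "ca lam > 0" using lam const unfolding ca_def by (intro add_pos_nonneg) auto
  then have ca: "ca lam \<noteq> 0" by simp
  have crho': "continuous_on UNIV (\<lambda>x. lam\<^sup>2 * rho' x)" by (intro continuous_intros rho)
  obtain \<psi>2 \<psi>3 \<psi>4 where ode:
    "\<And>x. (\<psi>1 has_real_derivative \<psi>2 x) (at x)" "\<And>x. (\<psi>2 has_real_derivative \<psi>3 x) (at x)"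
    "\<And>x. (\<psi>3 has_real_derivative \<psi>4 x) (at x)" "continuous_on UNIV \<psi>4"
    "\<And>x. ca lam * \<psi>4 x = lam\<^sup>2 * rho' x * \<psi>1 x + cp lam x * \<psi>2 x - cq lam x * \<psi> x"
    by (rule weak_solution_regular[OF d\<psi> c\<psi>1 dcp crho' coeff_cont(2) ca]) (erule weak, rule that)
  \<comment> \<open>No limit of the second derivatives is at hand, so their bound is transferred
    through difference quotients: those of the first derivatives are averages of the second ones,
    hence of norm at most 1, and Fatou is applied first in n, then in the step length.\<close>
  have "\<psi>2 \<in> L2"
  proof (rule L2_Fatou(1))
    define D where "D = (\<lambda>u n x. (u (x + inverse (real (Suc n))) - u x) / inverse (real (Suc n)) :: real)"
    have D: "D \<psi>1 j \<in> L2 \<and> (LINT x|lborel. (D \<psi>1 j x)\<^sup>2) \<le> 1" for j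
    proof -
      have pos: "inverse (real (Suc j)) > 0" by simp
      have eq: "D (deriv (F n)) j = steklov (inverse (real (Suc j))) (deriv (deriv (F n)))" for n
        unfolding D_def by (rule steklov_AC[OF AC_C1[OF FC(2,5,8)] pos, symmetric])
      have "D (deriv (F n)) j \<in> L2" "(LINT x|lborel. (D (deriv (F n)) j x)\<^sup>2) \<le> 1" for n
        using steklov_L2[OF FC(8) pos, of n] FD(7)[of n] unfolding eq N0_def by auto
      moreover have "(\<lambda>n. D (deriv (F n)) j x) \<longlonglongrightarrow> D \<psi>1 j x" for x
        unfolding D_def using pos by (intro tendsto_intros F) auto
      ultimately show ?thesis using L2_Fatou[of "\<lambda>n. D (deriv (F n)) j"] by blast
    qed
    show "D \<psi>1 j \<in> L2" "(LINT x|lborel. (D \<psi>1 j x)\<^sup>2) \<le> 1" for j using D by auto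
    fix x
    have "((\<lambda>h. (\<psi>1 (x + h) - \<psi>1 x) / h) \<longlongrightarrow> \<psi>2 x) (at 0)"
      using ode(1)[of x] by (simp add: DERIV_def)
    moreover have "filterlim (\<lambda>n. inverse (real (Suc n))) (at 0) sequentially"
      by (rule filterlim_atI[OF LIMSEQ_inverse_real_of_nat]) simp
    ultimately show "(\<lambda>n. D \<psi>1 n x) \<longlonglongrightarrow> \<psi>2 x"
      unfolding D_def by (rule filterlim_compose)
  qed
  moreover have "\<exists>x. \<psi> x \<noteq> 0"
  proof (rule ccontr)
    assume "\<nexists>x. \<psi> x \<noteq> 0"
    then have z: "\<psi> x = 0" for x by simp
    have "(\<lambda>n. LINT x|lborel. r x * (F n x)\<^sup>2) \<longlonglongrightarrow> (LINT x|lborel. r x * (\<psi> x)\<^sup>2)"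
    proof (rule integral_dominated_convergence)
      show "integrable lborel (\<lambda>x. 4 * \<bar>r x\<bar>)" using r(3) by simp
      show "AE x in lborel. (\<lambda>n. r x * (F n x)\<^sup>2) \<longlonglongrightarrow> r x * (\<psi> x)\<^sup>2"
        by (intro AE_I2 tendsto_intros F)
      have "(F n x)\<^sup>2 \<le> 4" for n x using FD(2)[of n x] abs_le_square_iff[of "F n x" 2] by simp
      then have "\<bar>r x\<bar> * (F n x)\<^sup>2 \<le> \<bar>r x\<bar> * 4" for n x by (intro mult_left_mono) auto
      then show "AE x in lborel. norm (r x * (F n x)\<^sup>2) \<le> 4 * \<bar>r x\<bar>" for n
        by (simp add: abs_mult mult.commute)
    qed simp_all
    then have "(\<lambda>n. K (F n)) \<longlonglongrightarrow> 0" by (simp add: z K_def)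
    then have "\<delta> \<le> 0" using FD(4) by (intro LIMSEQ_le_const[of "\<lambda>n. K (F n)" 0]) auto
    then show False using \<delta> by simp
  qed
  ultimately show ?thesis using that[OF d\<psi> ode] L2\<psi> by blast
qed

end

section \<open>Regularity and decay\<close>

lemma LINT_square_pos:
  assumes "continuous_on UNIV f" "f \<in> L2" "f x \<noteq> 0"
  shows "(LINT x|lborel. (f x)\<^sup>2) > 0"
proof -
  have "(LINT x|lborel. (f x)\<^sup>2) \<noteq> 0"
  proof
    assume "(LINT x|lborel. (f x)\<^sup>2) = 0"
    then have "AE x in lborel. f x = 0"
      using integral_nonneg_eq_0_iff_AE[OF L2D(2)[OF assms(2)]] by simp
    from AE_zero_continuous[OF assms(1) this, of x] assms(3) show False by simp
  qed
  moreover have "(LINT x|lborel. (f x)\<^sup>2) \<ge> 0" by simp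
  ultimately show ?thesis by linarith
qed

section \<open>From Sobolev functions to continuous representatives\<close>

lemma is_wderiv_measurable: "is_wderiv f g \<Longrightarrow> g \<in> borel_measurable borel"
  by (rule borel_measurable_if_test) (auto simp: is_wderiv_def)

lemma is_wderiv_wd: "is_wderiv f g \<Longrightarrow> is_wderiv f (wd f)"
  unfolding wd_def by (rule someI[of "is_wderiv f"])

lemma is_wderiv_cong_AE:
  assumes "is_wderiv f h" "AE x in lborel. f x = g x" "f \<in> borel_measurable borel" "g \<in> borel_measurable borel"
  shows "is_wderiv g h"
  unfolding is_wderiv_def
proof (intro allI impI)
  fix \<phi> assume \<phi>: "test_fun \<phi>"
  have c: "C_inf \<phi>" using \<phi> by (simp add: test_fun_def)
  note [measurable] = assms(3,4) borel_measurable_continuous_onI[OF C_inf_continuous[OF C_inf_D(2)[OF c]]]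
  have f: "integrable lborel (\<lambda>x. f x * deriv \<phi> x)" "integrable lborel (\<lambda>x. h x * \<phi> x)"
    "(LINT x|lborel. f x * deriv \<phi> x) = - (LINT x|lborel. h x * \<phi> x)"
    using assms(1) \<phi> unfolding is_wderiv_def by blast+
  have "integrable lborel (\<lambda>x. g x * deriv \<phi> x)"
    by (rule integrable_cong_AE_imp[OF f(1)]) (use assms(2) in \<open>auto elim!: eventually_mono\<close>)
  moreover have "(LINT x|lborel. f x * deriv \<phi> x) = (LINT x|lborel. g x * deriv \<phi> x)"
    by (rule integral_cong_AE) (use assms(2) in \<open>auto elim!: eventually_mono\<close>)
  ultimately show "integrable lborel (\<lambda>x. g x * deriv \<phi> x) \<and> integrable lborel (\<lambda>x. h x * \<phi> x) \<and>
      (LINT x|lborel. g x * deriv \<phi> x) = - (LINT x|lborel. h x * \<phi> x)"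
    using f by simp
qed

lemma H1_D:
  assumes "\<psi> \<in> H (Suc 0)"
  obtains U where "\<psi> \<in> L2" "wd \<psi> \<in> L2" "AC U (wd \<psi>)" "AE x in lborel. \<psi> x = U x" "U \<in> L2"
proof -
  obtain g where g: "\<psi> \<in> L2" "is_wderiv \<psi> g" "g \<in> L2" using assms by auto
  note w = is_wderiv_wd[OF g(2)]
  have wL: "wd \<psi> \<in> L2"
    by (rule L2_cong_AE[OF g(3) is_wderiv_unique[OF g(2) w] is_wderiv_measurable[OF w]])
  obtain U where U: "AC U (wd \<psi>)" "AE x in lborel. \<psi> x = U x"
    by (rule H1_AC_representative[OF g(1) wL w])
  have "U \<in> L2"
    by (rule L2_cong_AE[OF g(1) U(2) borel_measurable_continuous_onI[OF AC_continuous[OF U(1)]]])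
  then show ?thesis using that g(1) wL U by blast
qed

text \<open>\<open>wd (wd \<psi>)\<close> refers to the particular choice \<open>wd \<psi>\<close>,
  which may differ from the witness g on a null set; weak differentiability is carried over along
  the almost everywhere equality. The continuous U1 then replaces \<open>wd \<psi>\<close> as the
  density of U, so that both levels are absolutely continuous at once.\<close>

lemma H2_D:
  assumes "\<psi> \<in> H 2"
  obtains U U1 where "\<psi> \<in> L2" "wd \<psi> \<in> L2" "wd (wd \<psi>) \<in> L2" "AC U U1" "AC U1 (wd (wd \<psi>))"
    "AE x in lborel. \<psi> x = U x" "AE x in lborel. wd \<psi> x = U1 x" "U \<in> L2"
proof -
  obtain g where g: "\<psi> \<in> L2" "is_wderiv \<psi> g" "g \<in> H (Suc 0)"
    using assms by (auto simp: numeral_2_eq_2)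
  obtain g2 where g2: "g \<in> L2" "is_wderiv g g2" "g2 \<in> L2" using g(3) by auto
  have "\<psi> \<in> H (Suc 0)" using g g2 by auto
  then obtain U where U: "wd \<psi> \<in> L2" "AC U (wd \<psi>)" "AE x in lborel. \<psi> x = U x" "U \<in> L2"
    by (rule H1_D) (rule that)
  have "is_wderiv (wd \<psi>) g2"
    by (rule is_wderiv_cong_AE[OF g2(2) is_wderiv_unique[OF g(2) is_wderiv_wd[OF g(2)]] L2D(1)[OF g2(1)] L2D(1)[OF U(1)]])
  then have "wd \<psi> \<in> H (Suc 0)" using g2 U by auto
  then obtain U1 where U1: "wd (wd \<psi>) \<in> L2" "AC U1 (wd (wd \<psi>))" "AE x in lborel. wd \<psi> x = U1 x"
    by (rule H1_D) (rule that)
  have "AC U U1"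
    by (rule AC_cong_AE[OF U(2) U1(3) borel_measurable_continuous_onI[OF AC_continuous[OF U1(2)]]])
  then show ?thesis using that g(1) U U1 by blast
qed

lemma ndiff_L2_in_H:
  assumes "C_inf f" "ndiff (\<lambda>f. f \<in> L2) n f"
  shows "f \<in> H n"
  using assms
proof (induction n arbitrary: f)
  case (Suc n)
  then obtain f' where f': "\<And>x. (f has_real_derivative f' x) (at x)" "ndiff (\<lambda>f. f \<in> L2) n f'" "f \<in> L2"
    by auto
  have eq: "f' = deriv f" using DERIV_imp_deriv[OF f'(1)] by (simp add: fun_eq_iff)
  then have "C_inf f'" using C_inf_D(2)[OF Suc.prems(1)] by simp
  then have "f' \<in> H n" "is_wderiv f f'"
    using Suc.IH f' is_wderiv_C1 C_inf_continuous by blast+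
  then show ?case using f' by auto
qed auto

section \<open>Bounded coefficients and the regularity bootstrap\<close>

abbreviation bounded_Cn :: "nat \<Rightarrow> (real \<Rightarrow> real) \<Rightarrow> bool" where
  "bounded_Cn \<equiv> ndiff (\<lambda>b. b \<in> borel_measurable borel \<and> (\<exists>B. \<forall>x. \<bar>b x\<bar> \<le> B))"

lemma test_fun_deriv:
  assumes "test_fun \<phi>"
  shows "test_fun (deriv \<phi>)"
proof -
  obtain N where N: "N > 0" "\<And>x. N \<le> \<bar>x\<bar> \<Longrightarrow> deriv \<phi> x = 0" using test_funE[OF assms] by metis
  have "deriv \<phi> x = 0" if "x \<notin> {-N..N}" for x
    using that by (intro N(2)) auto
  then show ?thesis
    using assms C_inf_D(2) by (intro test_funI[of _ "-N" N]) (auto simp: test_fun_def)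
qed

lemma test_fun_bounded:
  assumes "test_fun \<phi>"
  shows "\<exists>B. \<forall>x. \<bar>\<phi> x\<bar> \<le> B"
proof -
  obtain N where N: "N > 0" "\<And>x. N \<le> \<bar>x\<bar> \<Longrightarrow> \<phi> x = 0" using test_funE[OF assms] by metis
  have "continuous_on {-N..N} \<phi>" using assms by (auto simp: test_fun_def intro: C_inf_continuous)
  then have "bounded (\<phi> ` {-N..N})" by (intro compact_imp_bounded compact_continuous_image) auto
  then obtain B where B: "\<forall>x\<in>{-N..N}. \<bar>\<phi> x\<bar> \<le> B" by (auto simp: bounded_iff)
  have "\<bar>\<phi> x\<bar> \<le> max B 0" for x
  proof (cases "x \<in> {-N..N}")
    case False
    then have "\<phi> x = 0" by (intro N(2)) auto
    then show ?thesis by simp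
  qed (use B in \<open>auto intro: order_trans[OF _ max.cobounded1]\<close>)
  then show ?thesis by blast
qed

lemma test_fun_bounded_Cn: "test_fun \<phi> \<Longrightarrow> bounded_Cn n \<phi>"
proof (induction n arbitrary: \<phi>)
  case 0
  then show ?case
    using test_fun_bounded[of \<phi>] borel_measurable_continuous_onI[OF C_inf_continuous, of \<phi>]
    by (auto simp: test_fun_def)
next
  case (Suc n)
  then show ?case
    using test_fun_bounded[of \<phi>] borel_measurable_continuous_onI[OF C_inf_continuous, of \<phi>] test_fun_deriv[of \<phi>] C_inf_D(1)[of \<phi>]
    by (intro ndiff_SucI[where f' = "deriv \<phi>"]) (auto simp: test_fun_def)
qed

lemma bounded_Cn_add: "bounded_Cn n f \<Longrightarrow> bounded_Cn n g \<Longrightarrow> bounded_Cn n (\<lambda>x. f x + g x)"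
proof (rule ndiff_add)
  fix f g :: "real \<Rightarrow> real"
  assume "f \<in> borel_measurable borel \<and> (\<exists>B. \<forall>x. \<bar>f x\<bar> \<le> B)" "g \<in> borel_measurable borel \<and> (\<exists>B. \<forall>x. \<bar>g x\<bar> \<le> B)"
  moreover from this obtain B C where "\<And>x. \<bar>f x\<bar> \<le> B" "\<And>x. \<bar>g x\<bar> \<le> C" by blast
  then have "\<bar>f x + g x\<bar> \<le> B + C" for x using abs_triangle_ineq[of "f x" "g x"] by (meson add_mono order_trans)
  ultimately show "(\<lambda>x. f x + g x) \<in> borel_measurable borel \<and> (\<exists>B. \<forall>x. \<bar>f x + g x\<bar> \<le> B)" by auto
qed

lemma bounded_Cn_const: "bounded_Cn n (\<lambda>_. c)"
  by (rule ndiff_const) auto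

lemma bounded_Cn_cmult: "bounded_Cn n f \<Longrightarrow> bounded_Cn n (\<lambda>x. c * f x)"
proof (induction n arbitrary: f)
  case 0
  then obtain B where "\<And>x. \<bar>f x\<bar> \<le> B" by auto
  then have "\<bar>c * f x\<bar> \<le> \<bar>c\<bar> * B" for x unfolding abs_mult by (intro mult_left_mono) auto
  then show ?case using 0 by auto
next
  case (Suc n)
  then obtain B f' where B: "\<And>x. \<bar>f x\<bar> \<le> B" and f': "\<And>x. (f has_real_derivative f' x) (at x)" "bounded_Cn n f'"
    by auto
  have "\<bar>c * f x\<bar> \<le> \<bar>c\<bar> * B" for x unfolding abs_mult using B by (intro mult_left_mono) auto
  then show ?case
    using Suc.prems f' Suc.IH by (intro ndiff_SucI[where f' = "\<lambda>x. c * f' x"]) (auto intro!: derivative_eq_intros)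
qed

lemma bounded_Cn_mult_L2:
  "bounded_Cn n b \<Longrightarrow> ndiff (\<lambda>f. f \<in> L2) n f \<Longrightarrow> ndiff (\<lambda>f. f \<in> L2) n (\<lambda>x. b x * f x)"
  by (rule ndiff_mult) (auto intro: L2_mult_bounded L2_add)

text \<open>The equation expresses \<open>f4\<close> through lower derivatives, so n square
  integrable derivatives of \<open>f0\<close> to \<open>f3\<close> give n of \<open>f4\<close>,
  hence n + 1 of all four. The induction therefore carries the four together.\<close>

lemma linear_ODE_bootstrap:
  assumes d: "\<And>x. (f0 has_real_derivative f1 x) (at x)" "\<And>x. (f1 has_real_derivative f2 x) (at x)"
    "\<And>x. (f2 has_real_derivative f3 x) (at x)" "\<And>x. (f3 has_real_derivative f4 x) (at x)"
    and L2: "f0 \<in> L2" "f1 \<in> L2" "f2 \<in> L2" "f3 \<in> L2"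
    and ode: "\<And>x. f4 x = b0 x * f0 x + (b1 x * f1 x + b2 x * f2 x)"
    and b: "\<And>n. bounded_Cn n b0" "\<And>n. bounded_Cn n b1" "\<And>n. bounded_Cn n b2"
  shows "ndiff (\<lambda>f. f \<in> L2) n f0"
proof -
  let ?P = "ndiff (\<lambda>f. f \<in> L2)"
  have L2n_add: "?P n f \<Longrightarrow> ?P n g \<Longrightarrow> ?P n (\<lambda>x. f x + g x)" for n f g
    by (rule ndiff_add) (rule L2_add)
  have "?P n f0 \<and> ?P n f1 \<and> ?P n f2 \<and> ?P n f3"
  proof (induction n)
    case (Suc n)
    have "f4 = (\<lambda>x. b0 x * f0 x + (b1 x * f1 x + b2 x * f2 x))" using ode by blast
    moreover have "?P n (\<lambda>x. b0 x * f0 x + (b1 x * f1 x + b2 x * f2 x))"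
      using Suc by (intro L2n_add bounded_Cn_mult_L2 b) auto
    ultimately have "?P n f4" by simp
    then show ?case
      using Suc ndiff_SucI[where P = "\<lambda>f. f \<in> L2", OF L2(1) d(1)] ndiff_SucI[where P = "\<lambda>f. f \<in> L2", OF L2(2) d(2)]
        ndiff_SucI[where P = "\<lambda>f. f \<in> L2", OF L2(3) d(3)] ndiff_SucI[where P = "\<lambda>f. f \<in> L2", OF L2(4) d(4)]
      by blast
  qed (use L2 in simp)
  then show ?thesis by blast
qed

text \<open>\<open>sqrt\<close> is odd on the reals, so squares compare only once signs are known:
  \<open>k \<ge> 0\<close> supplies this here, \<open>X \<ge> 0\<close> in
  \<open>ereal_sqrt_less\<close>.\<close>

lemma less_ereal_sqrt:
  assumes "ereal k < ereal_sqrt X" "k \<ge> 0"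
  shows "ereal (k\<^sup>2) < X"
proof (cases X)
  case (real x)
  then have "k < sqrt x" using assms(1) by (simp add: ereal_sqrt_def)
  then have "0 < sqrt x" "k\<^sup>2 < (sqrt x)\<^sup>2"
    using assms(2) power_strict_mono[of k "sqrt x" 2] by linarith+
  then have "k\<^sup>2 < x" by simp
  then show ?thesis using real by simp
qed (use assms in \<open>auto simp: ereal_sqrt_def\<close>)

lemma ereal_sqrt_less:
  assumes "ereal_sqrt X < ereal k" "X \<ge> 0"
  shows "k > 0" "X < ereal (k\<^sup>2)"
proof -
  have "k > 0 \<and> X < ereal (k\<^sup>2)"
  proof (cases X)
    case (real x)
    then have x: "sqrt x < k" "0 \<le> x" using assms by (auto simp: ereal_sqrt_def)
    then have "k > 0" using real_sqrt_ge_zero[of x] by linarith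
    moreover have "(sqrt x)\<^sup>2 < k\<^sup>2" using x by (intro power_strict_mono) auto
    then have "x < k\<^sup>2" using x by simp
    ultimately show ?thesis using real by simp
  qed (use assms in \<open>auto simp: ereal_sqrt_def\<close>)
  then show "k > 0" "X < ereal (k\<^sup>2)" by auto
qed

section \<open>The theorem\<close>

lemma test_fun_C2_L2:
  assumes "test_fun \<phi>"
  shows "C2_L2 \<phi> (deriv \<phi>) (deriv (deriv \<phi>))"
proof -
  have t: "test_fun (deriv \<phi>)" "test_fun (deriv (deriv \<phi>))"
    using test_fun_deriv[OF assms] test_fun_deriv[OF test_fun_deriv[OF assms]] .
  then have c: "C_inf \<phi>" "C_inf (deriv \<phi>)" "C_inf (deriv (deriv \<phi>))"
    using assms unfolding test_fun_def by blast+
  show ?thesis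
    unfolding C2_L2_def using C_inf_D(1)[OF c(1)] C_inf_D(1)[OF c(2)] C_inf_continuous[OF c(3)]
      test_fun_L2[OF assms] test_fun_L2[OF t(1)] test_fun_L2[OF t(2)] by blast
qed

text \<open>Serves the frequencies with first component 0 in the horizontal case, where the magnetic
  energy vanishes and a bump inside the region of positive weight is already a negative
  direction.\<close>

lemma ex_test_fun_weight_pos:
  assumes r: "continuous_on UNIV r" "integrable lborel r" "r x0 > (0::real)"
  obtains \<phi> where "test_fun \<phi>" "(LINT x|lborel. r x * (\<phi> x)\<^sup>2) > 0"
proof -
  have "open {x. r x > 0}" using open_Collect_less[OF continuous_on_const r(1)] .
  then obtain e where e: "e > 0" "ball x0 e \<subseteq> {x. r x > 0}"
    using r(3) by (auto simp: open_contains_ball)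
  define \<phi> where "\<phi> = smooth_ind 0 (x0 - e) (x0 + e)"
  have \<phi>: "test_fun \<phi>" "C_inf \<phi>" unfolding \<phi>_def by (simp_all add: test_fun_smooth_ind C_inf_smooth_ind)
  have c: "continuous_on UNIV (\<lambda>x. r x * (\<phi> x)\<^sup>2)" by (intro continuous_intros r C_inf_continuous \<phi>)
  have nn: "r x * (\<phi> x)\<^sup>2 \<ge> 0" for x
  proof (cases "x \<in> {x0 - e<..<x0 + e}")
    case True
    then have "r x > 0" using e(2) by (auto simp: dist_real_def subset_eq)
    then show ?thesis by simp
  qed (simp add: \<phi>_def smooth_ind_eq_0)
  have "continuous_on UNIV (\<lambda>x. r x * \<phi> x)" by (intro continuous_intros r C_inf_continuous \<phi>)
  from integrable_mult_test_fun(1)[OF this \<phi>(1)]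
  have i: "integrable lborel (\<lambda>x. r x * (\<phi> x)\<^sup>2)" by (simp add: power2_eq_square mult.assoc)
  have "r x0 * (\<phi> x0)\<^sup>2 \<noteq> 0" using r(3) e(1) smooth_ind_pos[of "x0 - e" x0 "x0 + e" 0] by (simp add: \<phi>_def)
  then have "(LINT x|lborel. r x * (\<phi> x)\<^sup>2) \<noteq> 0"
  proof (rule contrapos_nn)
    assume "(LINT x|lborel. r x * (\<phi> x)\<^sup>2) = 0"
    then have "AE x in lborel. r x * (\<phi> x)\<^sup>2 = 0"
      using integral_nonneg_eq_0_iff_AE[OF i] nn by blast
    from AE_zero_continuous[OF c this] show "r x0 * (\<phi> x0)\<^sup>2 = 0" .
  qed
  moreover have "(LINT x|lborel. r x * (\<phi> x)\<^sup>2) \<ge> 0" using nn by (intro Bochner_Integration.integral_nonneg) auto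
  ultimately have "(LINT x|lborel. r x * (\<phi> x)\<^sup>2) > 0" by linarith
  then show ?thesis using that \<phi> by blast
qed

lemma LINT_square_cong_AE:
  assumes "AE x in lborel. f x = U x" "f \<in> borel_measurable borel" "U \<in> borel_measurable borel" "r \<in> borel_measurable borel"
  shows "(LINT x|lborel. r x * (f x)\<^sup>2) = (LINT x|lborel. (r x :: real) * (U x)\<^sup>2)"
  using assms by (intro integral_cong_AE) (auto elim!: eventually_mono)

text \<open>Away from first component 0, being below the supremum in \<open>S_h\<close> provides an
  H^1 function whose quotient exceeds |\<xi>|^2; clearing the two denominators gives exactly
  negativity at rate 0, and averaging makes the direction C^2.\<close>

lemma negative_direction_horizontal:
  assumes r: "continuous_on UNIV (deriv rho)" "\<And>x. \<bar>deriv rho x\<bar> \<le> B" "integrable lborel (deriv rho)"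
    and pos: "\<exists>x0. deriv rho x0 > 0" and g: "g > 0" and M: "M \<noteq> 0" and xi: "\<xi> \<in> Ag_h g rho M"
  obtains f f1 f2 where "C2_L2 f f1 f2"
    "M\<^sup>2 * (fst \<xi>)\<^sup>2 * (LINT x|lborel. (f1 x)\<^sup>2) + (norm \<xi>)\<^sup>2 * (M\<^sup>2 * (fst \<xi>)\<^sup>2) * (LINT x|lborel. (f x)\<^sup>2)
      < (LINT x|lborel. g * (norm \<xi>)\<^sup>2 * deriv rho x * (f x)\<^sup>2)"
proof (cases "fst \<xi> = 0")
  case True
  have k: "norm \<xi> > 0" using xi by (auto simp: Ag_h_def)
  obtain x0 where "deriv rho x0 > 0" using pos by blast
  then obtain \<phi> where \<phi>: "test_fun \<phi>" "(LINT x|lborel. deriv rho x * (\<phi> x)\<^sup>2) > 0"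
    using ex_test_fun_weight_pos[OF r(1,3)] by blast
  have "(LINT x|lborel. g * (norm \<xi>)\<^sup>2 * deriv rho x * (\<phi> x)\<^sup>2) = g * (norm \<xi>)\<^sup>2 * (LINT x|lborel. deriv rho x * (\<phi> x)\<^sup>2)"
    by (simp add: mult.assoc)
  moreover have "g * (norm \<xi>)\<^sup>2 * (LINT x|lborel. deriv rho x * (\<phi> x)\<^sup>2) > 0"
    using g k \<phi>(2) by simp
  ultimately show ?thesis using True by (intro that[OF test_fun_C2_L2[OF \<phi>(1)]]) simp
next
  case False
  define A where "A = (M * fst \<xi>)\<^sup>2"
  have A: "A > 0" using False M by (simp add: A_def)
  have "ereal (norm \<xi>) < S_h g rho M \<xi>" using xi False by (auto simp: Ag_h_def)
  from less_ereal_sqrt[OF this[unfolded S_h_def]] obtain \<psi> where \<psi>: "\<psi> \<in> H 1" "nonzero_fun \<psi>"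
    "(norm \<xi>)\<^sup>2 < (g * (norm \<xi>)\<^sup>2 * (LINT x|lborel. deriv rho x * (\<psi> x)\<^sup>2) / A
              - (LINT x|lborel. \<bar>wd \<psi> x\<bar>\<^sup>2)) / (LINT x|lborel. \<bar>\<psi> x\<bar>\<^sup>2)"
    by (auto simp: less_SUP_iff A_def)
  obtain U where U: "\<psi> \<in> L2" "wd \<psi> \<in> L2" "AC U (wd \<psi>)" "AE x in lborel. \<psi> x = U x" "U \<in> L2"
    using H1_D \<psi>(1) by (metis One_nat_def)
  note meas = L2D(1)[OF U(1)] L2D(1)[OF U(5)] borel_measurable_continuous_onI[OF r(1)]
  have "(LINT x|lborel. (\<psi> x)\<^sup>2) \<noteq> 0"
    using integral_nonneg_eq_0_iff_AE[OF L2D(2)[OF U(1)]] \<psi>(2) by (simp add: nonzero_fun_def)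
  moreover have "(LINT x|lborel. (\<psi> x)\<^sup>2) \<ge> 0" by simp
  ultimately have N: "(LINT x|lborel. (\<psi> x)\<^sup>2) > 0" by linarith
  have pull: "(LINT x|lborel. g * (norm \<xi>)\<^sup>2 * deriv rho x * (U x)\<^sup>2) = g * (norm \<xi>)\<^sup>2 * (LINT x|lborel. deriv rho x * (U x)\<^sup>2)"
    by (simp add: mult.assoc)
  have "(norm \<xi>)\<^sup>2 * (LINT x|lborel. (\<psi> x)\<^sup>2) < g * (norm \<xi>)\<^sup>2 * (LINT x|lborel. deriv rho x * (\<psi> x)\<^sup>2) / A
              - (LINT x|lborel. (wd \<psi> x)\<^sup>2)"
    using \<psi>(3) N by (simp add: pos_less_divide_eq)
  then have "A * ((norm \<xi>)\<^sup>2 * (LINT x|lborel. (\<psi> x)\<^sup>2)) < A * (g * (norm \<xi>)\<^sup>2 * (LINT x|lborel. deriv rho x * (\<psi> x)\<^sup>2) / A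
              - (LINT x|lborel. (wd \<psi> x)\<^sup>2))"
    using A by (intro mult_strict_left_mono)
  also have "\<dots> = g * (norm \<xi>)\<^sup>2 * (LINT x|lborel. deriv rho x * (\<psi> x)\<^sup>2) - A * (LINT x|lborel. (wd \<psi> x)\<^sup>2)"
    using A by (simp add: field_simps)
  also have "(LINT x|lborel. deriv rho x * (\<psi> x)\<^sup>2) = (LINT x|lborel. deriv rho x * (U x)\<^sup>2)"
    by (rule LINT_square_cong_AE[OF U(4) meas])
  \<comment> \<open>The horizontal energy has no second-order term: its coefficient is 0 and the
    zero function fills the slot.\<close>
  finally have neg: "0 * (LINT x|lborel. (0::real)\<^sup>2) + A * (LINT x|lborel. (wd \<psi> x)\<^sup>2) + (norm \<xi>)\<^sup>2 * A * (LINT x|lborel. (U x)\<^sup>2)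
      < (LINT x|lborel. g * (norm \<xi>)\<^sup>2 * deriv rho x * (U x)\<^sup>2)"
    using LINT_square_cong_AE[OF U(4) meas(1,2), of "\<lambda>_. 1"] unfolding pull by (simp add: mult.assoc mult.left_commute)
  have r': "continuous_on UNIV (\<lambda>x. g * (norm \<xi>)\<^sup>2 * deriv rho x)" by (intro continuous_intros r)
  have B': "\<bar>g * (norm \<xi>)\<^sup>2 * deriv rho x\<bar> \<le> g * (norm \<xi>)\<^sup>2 * B" for x
    using g r(2) by (simp add: abs_mult mult_left_mono)
  have i': "integrable lborel (\<lambda>x. g * (norm \<xi>)\<^sup>2 * deriv rho x)" using r(3) by simp
  obtain f f1 f2 where f: "C2_L2 f f1 f2" "0 * (LINT x|lborel. (f2 x)\<^sup>2) + A * (LINT x|lborel. (f1 x)\<^sup>2)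
     + (norm \<xi>)\<^sup>2 * A * (LINT x|lborel. (f x)\<^sup>2) < (LINT x|lborel. g * (norm \<xi>)\<^sup>2 * deriv rho x * (f x)\<^sup>2)"
    by (rule negative_direction_C2[OF U(3,5) r' B' i' _ _ _ _ neg]) (use A in auto)
  then show ?thesis by (intro that[OF f(1)]) (simp add: A_def power_mult_distrib)
qed

text \<open>Being above the infimum provides an H^2 function with M^2 \<integral> \<psi>''^2 <
  |\<xi>|^2 D. The part - M^2 \<integral> \<psi>'^2 of D, moved to the left, is the first-order term
  of the magnetic energy.\<close>

lemma negative_direction_vertical:
  assumes r: "continuous_on UNIV (deriv rho)" "\<And>x. \<bar>deriv rho x\<bar> \<le> B" "integrable lborel (deriv rho)"
    and g: "g > 0" and xi: "\<xi> \<in> Ag_v g rho M"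
  obtains f f1 f2 where "norm \<xi> > 0" "C2_L2 f f1 f2"
    "M\<^sup>2 * (LINT x|lborel. (f2 x)\<^sup>2) + M\<^sup>2 * (norm \<xi>)\<^sup>2 * (LINT x|lborel. (f1 x)\<^sup>2)
      < (LINT x|lborel. g * (norm \<xi>)\<^sup>2 * deriv rho x * (f x)\<^sup>2)"
proof -
  define q where "q = (\<lambda>\<psi>. M\<^sup>2 * (LINT x|lborel. \<bar>wd (wd \<psi>) x\<bar>\<^sup>2)
             / (LINT x|lborel. g * deriv rho x * (\<psi> x)\<^sup>2 - M\<^sup>2 * \<bar>wd \<psi> x\<bar>\<^sup>2))"
  have "ereal_sqrt (INF \<psi> \<in> M_vc g rho M. ereal (q \<psi>)) < ereal (norm \<xi>)"
    using xi by (simp add: Ag_v_def xi_vc_def q_def)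
  \<comment> \<open>Membership in \<open>M_vc\<close> makes the denominators positive, so the
    infimum is nonnegative; this is what yields |\<xi>| > 0.\<close>
  moreover have "(INF \<psi> \<in> M_vc g rho M. ereal (q \<psi>)) \<ge> 0"
    by (rule INF_greatest) (auto simp: q_def M_vc_def intro!: divide_nonneg_pos)
  ultimately have k: "norm \<xi> > 0" and "(INF \<psi> \<in> M_vc g rho M. ereal (q \<psi>)) < ereal ((norm \<xi>)\<^sup>2)"
    using ereal_sqrt_less by blast+
  then obtain \<psi> where \<psi>: "\<psi> \<in> M_vc g rho M" "q \<psi> < (norm \<xi>)\<^sup>2"
    by (auto simp: INF_less_iff)
  define D where "D = (LINT x|lborel. g * deriv rho x * (\<psi> x)\<^sup>2 - M\<^sup>2 * \<bar>wd \<psi> x\<bar>\<^sup>2)"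
  have D: "D > 0" "\<psi> \<in> H 2" using \<psi>(1) by (auto simp: M_vc_def D_def)
  obtain U U1 where U: "\<psi> \<in> L2" "wd \<psi> \<in> L2" "wd (wd \<psi>) \<in> L2" "AC U U1" "AC U1 (wd (wd \<psi>))"
    "AE x in lborel. \<psi> x = U x" "AE x in lborel. wd \<psi> x = U1 x" "U \<in> L2"
    by (rule H2_D[OF D(2)]) (rule that)
  have U1: "U1 \<in> L2" using U(4) by (simp add: AC_def)
  have i: "integrable lborel (\<lambda>x. deriv rho x * (\<psi> x)\<^sup>2)"
    using bounded_mult_L2_integrable[OF U(1) U(1) r(1,2)] by (simp add: power2_eq_square)
  have "D = g * (LINT x|lborel. deriv rho x * (\<psi> x)\<^sup>2) - M\<^sup>2 * (LINT x|lborel. (wd \<psi> x)\<^sup>2)"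
    unfolding D_def using i L2D(2)[OF U(2)] by (simp add: mult.assoc)
  also have "(LINT x|lborel. deriv rho x * (\<psi> x)\<^sup>2) = (LINT x|lborel. deriv rho x * (U x)\<^sup>2)"
    by (rule LINT_square_cong_AE[OF U(6) L2D(1)[OF U(1)] L2D(1)[OF U(8)] borel_measurable_continuous_onI[OF r(1)]])
  also have "(LINT x|lborel. (wd \<psi> x)\<^sup>2) = (LINT x|lborel. (U1 x)\<^sup>2)"
    using LINT_square_cong_AE[OF U(7) L2D(1)[OF U(2)] L2D(1)[OF U1], of "\<lambda>_. 1"] by simp
  finally have D_eq: "D = g * (LINT x|lborel. deriv rho x * (U x)\<^sup>2) - M\<^sup>2 * (LINT x|lborel. (U1 x)\<^sup>2)" .
  have *: "M\<^sup>2 * (LINT x|lborel. (wd (wd \<psi>) x)\<^sup>2) < (norm \<xi>)\<^sup>2 * D"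
    using \<psi>(2) D(1) unfolding q_def D_def[symmetric] by (simp add: pos_divide_less_eq)
  have pull: "(LINT x|lborel. g * (norm \<xi>)\<^sup>2 * deriv rho x * (U x)\<^sup>2) = g * (norm \<xi>)\<^sup>2 * (LINT x|lborel. deriv rho x * (U x)\<^sup>2)"
    by (simp add: mult.assoc)
  from * have neg: "M\<^sup>2 * (LINT x|lborel. (wd (wd \<psi>) x)\<^sup>2) + M\<^sup>2 * (norm \<xi>)\<^sup>2 * (LINT x|lborel. (U1 x)\<^sup>2) + 0 * (LINT x|lborel. (U x)\<^sup>2)
      < (LINT x|lborel. g * (norm \<xi>)\<^sup>2 * deriv rho x * (U x)\<^sup>2)"
    unfolding D_eq pull by (simp add: algebra_simps)
  have r': "continuous_on UNIV (\<lambda>x. g * (norm \<xi>)\<^sup>2 * deriv rho x)" by (intro continuous_intros r)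
  have B': "\<bar>g * (norm \<xi>)\<^sup>2 * deriv rho x\<bar> \<le> g * (norm \<xi>)\<^sup>2 * B" for x
    using g r(2) by (simp add: abs_mult mult_left_mono)
  have i': "integrable lborel (\<lambda>x. g * (norm \<xi>)\<^sup>2 * deriv rho x)" using r(3) by simp
  obtain f f1 f2 where f: "C2_L2 f f1 f2" "M\<^sup>2 * (LINT x|lborel. (f2 x)\<^sup>2) + M\<^sup>2 * (norm \<xi>)\<^sup>2 * (LINT x|lborel. (f1 x)\<^sup>2)
     + 0 * (LINT x|lborel. (f x)\<^sup>2) < (LINT x|lborel. g * (norm \<xi>)\<^sup>2 * deriv rho x * (f x)\<^sup>2)"
    by (rule negative_direction_C2[OF U(4,8) r' B' i' _ _ _ _ neg]) (use U(5) in auto)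
  then show ?thesis by (intro that[OF k f(1)]) simp
qed

theorem theorem2p1:
  fixes g \<mu> M :: real and rho :: "real \<Rightarrow> real" and c :: field_case and \<xi> :: "real \<times> real"
  assumes g_pos: "g > 0" and mu_pos: "\<mu> > 0"
    and rho_meas: "rho \<in> borel_measurable lborel" and rho_bdd: "bounded (range rho)"
    and rho_diff: "\<forall>x. rho differentiable (at x)"
    and rho'_smooth: "C_inf (deriv rho)"
    and rho'_supp: "compact (closure {x. deriv rho x \<noteq> 0})"
    and rho_inf: "(INF x. rho x) > 0"
    and rho'_pos: "\<exists>x0. deriv rho x0 > 0"
    and M_adm: "admissible_M g rho c M"
    and xi_in: "\<xi> \<in> Ag g rho c M"
  shows "\<exists>\<psi> lam. nonzero_fun \<psi> \<and> lam > 0 \<and> C_inf \<psi> \<and>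
     (\<forall>x. - (lam\<^sup>2) * (rho x * (norm \<xi>)\<^sup>2 * \<psi> x - deriv (\<lambda>y. rho y * deriv \<psi> y) x)
          = lam * \<mu> * ((norm \<xi>)^4 * \<psi> x - 2 * (norm \<xi>)\<^sup>2 * (deriv ^^ 2) \<psi> x + (deriv ^^ 4) \<psi> x)
            - g * (norm \<xi>)\<^sup>2 * deriv rho x * \<psi> x + mag_term c M \<xi> \<psi> x) \<and>
     (\<psi> \<longlongrightarrow> 0) at_top \<and> (\<psi> \<longlongrightarrow> 0) at_bot \<and>
     (deriv \<psi> \<longlongrightarrow> 0) at_top \<and> (deriv \<psi> \<longlongrightarrow> 0) at_bot \<and>
     \<psi> \<in> H_inf \<and> \<psi> \<in> A_set rho \<xi>"
proof -
  define k where "k = norm \<xi>"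
  \<comment> \<open>The coefficients arise by testing \<open>mag_term\<close> with \<psi> and
    integrating by parts; with them both cases read A2 \<psi>'''' - A1 \<psi>'' + A0 \<psi>.\<close>
  define A2 where "A2 = (case c of Horizontal \<Rightarrow> 0 | Vertical \<Rightarrow> M\<^sup>2)"
  define A1 where "A1 = (case c of Horizontal \<Rightarrow> M\<^sup>2 * (fst \<xi>)\<^sup>2 | Vertical \<Rightarrow> M\<^sup>2 * k\<^sup>2)"
  define A0 where "A0 = (case c of Horizontal \<Rightarrow> k\<^sup>2 * (M\<^sup>2 * (fst \<xi>)\<^sup>2) | Vertical \<Rightarrow> 0)"
  define r where "r = (\<lambda>x. g * k\<^sup>2 * deriv rho x)"
  have r_eq: "r x = g * k\<^sup>2 * deriv rho x" for x by (simp add: r_def)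
  have test: "test_fun (deriv rho)" using rho'_smooth rho'_supp by (simp add: test_fun_def)
  have rc: "continuous_on UNIV (deriv rho)" by (rule C_inf_continuous[OF rho'_smooth])
  obtain B where B: "\<And>x. \<bar>deriv rho x\<bar> \<le> B" using test_fun_bounded[OF test] by blast
  have ri: "integrable lborel (deriv rho)"
    using integrable_mult_test_fun(1)[of "\<lambda>_. 1" "deriv rho"] test by simp
  obtain R0 where R0: "\<And>x. \<bar>rho x\<bar> \<le> R0" using rho_bdd by (auto simp: bounded_iff)
  have "bdd_below (range rho)" using rho_bdd by (rule bounded_imp_bdd_below)
  then have c0: "(INF x. rho x) \<le> rho x" for x by (intro cINF_lower) auto
  have rd: "(rho has_real_derivative deriv rho x) (at x)" for x
    using rho_diff by (simp add: DERIV_deriv_iff_real_differentiable)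
  have "k > 0 \<and> (\<exists>f f1 f2. C2_L2 f f1 f2 \<and> A2 * (LINT x|lborel. (f2 x)\<^sup>2) + A1 * (LINT x|lborel. (f1 x)\<^sup>2)
      + A0 * (LINT x|lborel. (f x)\<^sup>2) < (LINT x|lborel. r x * (f x)\<^sup>2))"
  proof (cases c)
    case Horizontal
    then have xi: "\<xi> \<in> Ag_h g rho M" and "M \<noteq> 0" using xi_in M_adm by (auto simp: Ag_def admissible_M_def)
    obtain f f1 f2 where "C2_L2 f f1 f2"
      "M\<^sup>2 * (fst \<xi>)\<^sup>2 * (LINT x|lborel. (f1 x)\<^sup>2) + (norm \<xi>)\<^sup>2 * (M\<^sup>2 * (fst \<xi>)\<^sup>2) * (LINT x|lborel. (f x)\<^sup>2)
        < (LINT x|lborel. g * (norm \<xi>)\<^sup>2 * deriv rho x * (f x)\<^sup>2)"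
      by (rule negative_direction_horizontal[OF rc B ri rho'_pos g_pos \<open>M \<noteq> 0\<close> xi]) (rule that)
    moreover have "k > 0" using xi by (auto simp: Ag_h_def k_def)
    ultimately show ?thesis using Horizontal
      by (intro conjI exI[of _ f] exI[of _ f1] exI[of _ f2]) (simp_all add: A2_def A1_def A0_def r_def k_def)
  next
    case Vertical
    then have xi: "\<xi> \<in> Ag_v g rho M" using xi_in by (auto simp: Ag_def)
    obtain f f1 f2 where "norm \<xi> > 0" "C2_L2 f f1 f2"
      "M\<^sup>2 * (LINT x|lborel. (f2 x)\<^sup>2) + M\<^sup>2 * (norm \<xi>)\<^sup>2 * (LINT x|lborel. (f1 x)\<^sup>2)
        < (LINT x|lborel. g * (norm \<xi>)\<^sup>2 * deriv rho x * (f x)\<^sup>2)"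
      by (rule negative_direction_vertical[OF rc B ri g_pos xi]) (rule that)
    then show ?thesis using Vertical
      by (intro conjI exI[of _ f] exI[of _ f1] exI[of _ f2]) (simp_all add: A2_def A1_def A0_def r_def k_def)
  qed
  then obtain f f1 f2 where k: "k > 0" and f: "C2_L2 f f1 f2" "A2 * (LINT x|lborel. (f2 x)\<^sup>2) + A1 * (LINT x|lborel. (f1 x)\<^sup>2)
      + A0 * (LINT x|lborel. (f x)\<^sup>2) < (LINT x|lborel. r x * (f x)\<^sup>2)"
    by blast
  have A_nonneg: "A0 \<ge> 0" "A1 \<ge> 0" "A2 \<ge> 0"
    by (auto simp: A0_def A1_def A2_def split: field_case.split)
  interpret growth_problem rho "deriv rho" r k \<mu> A0 A1 A2 "INF x. rho x" R0 "g * k\<^sup>2 * B"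
  proof
    show "continuous_on UNIV r" unfolding r_def by (intro continuous_intros rc)
    show "\<bar>r x\<bar> \<le> g * k\<^sup>2 * B" for x using g_pos B by (simp add: r_def abs_mult mult_left_mono)
    show "integrable lborel r" unfolding r_def using ri by simp
    show "rho x \<le> R0" for x using R0[of x] by linarith
  qed (fact rd rc rho_inf c0 k mu_pos A_nonneg)+
  note fX = C2_L2_imp_C2_H2[OF f(1)]
  have Q0: "Q0 f < 0" using f(2) fX(3) unfolding Q0_def N0_def K_def fX(2) by simp
  have lam: "lam > 0" using lam_pos[OF fX(1) Q0] by simp
  obtain \<psi> \<psi>1 \<psi>2 \<psi>3 \<psi>4 where \<psi>:
    "\<And>x. (\<psi> has_real_derivative \<psi>1 x) (at x)" "\<And>x. (\<psi>1 has_real_derivative \<psi>2 x) (at x)"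
    "\<And>x. (\<psi>2 has_real_derivative \<psi>3 x) (at x)" "\<And>x. (\<psi>3 has_real_derivative \<psi>4 x) (at x)"
    "continuous_on UNIV \<psi>4" "\<And>x. ca lam * \<psi>4 x = lam\<^sup>2 * deriv rho x * \<psi>1 x + cp lam x * \<psi>2 x - cq lam x * \<psi> x"
    "\<psi> \<in> L2" "\<psi>1 \<in> L2" "\<psi>2 \<in> L2" "\<exists>x. \<psi> x \<noteq> 0"
    by (rule minimizer[OF fX(1) Q0]) (rule that)
  have D_cont: "continuous_on UNIV f" if "\<And>x. (f has_real_derivative f' x) (at x)" for f f' :: "real \<Rightarrow> real"
    using that by (meson DERIV_continuous_on has_field_derivative_at_within)
  note cont = D_cont[OF \<psi>(1)] D_cont[OF \<psi>(2)] D_cont[OF \<psi>(3)] D_cont[OF \<psi>(4)] \<psi>(5)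
  have ca: "ca lam > 0" using lam mu_pos A_nonneg unfolding ca_def by (intro add_pos_nonneg) auto
  \<comment> \<open>The equation solved for \<open>\<psi>4\<close>, which \<open>ca lam > 0\<close>
    permits; the coefficients are bounded with all derivatives because rho is bounded and rho' is a
    test function.\<close>
  define b0 where "b0 = (\<lambda>x. (- 1 / ca lam) * cq lam x)"
  define b1 where "b1 = (\<lambda>x. (lam\<^sup>2 / ca lam) * deriv rho x)"
  define b2 where "b2 = (\<lambda>x. (1 / ca lam) * cp lam x)"
  have ode: "\<psi>4 x = b0 x * \<psi> x + (b1 x * \<psi>1 x + b2 x * \<psi>2 x)" for x
  proof -
    have "\<psi>4 x = (lam\<^sup>2 * deriv rho x * \<psi>1 x + cp lam x * \<psi>2 x - cq lam x * \<psi> x) / ca lam"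
      using \<psi>(6)[of x] ca by (simp add: nonzero_eq_divide_eq mult.commute)
    then show ?thesis
      by (simp add: b0_def b1_def b2_def add_divide_distrib diff_divide_distrib)
  qed
  have rho_n: "bounded_Cn n rho" for n
  proof -
    have "bounded_Cn (Suc n) rho"
      using rho_meas R0 rd test_fun_bounded_Cn[OF test] by (intro ndiff_SucI[where f' = "deriv rho"]) auto
    then show ?thesis by (rule ndiff_lower)
  qed
  have bn: "bounded_Cn n b0" "bounded_Cn n b1" "bounded_Cn n b2" for n
  proof -
    have "cq lam = (\<lambda>x. (lam\<^sup>2 * k\<^sup>2) * rho x + ((- g * k\<^sup>2) * deriv rho x + (lam * \<mu> * k ^ 4 + A0)))"
      "cp lam = (\<lambda>x. lam\<^sup>2 * rho x + (2 * lam * \<mu> * k\<^sup>2 + A1))"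
      by (auto simp: cq_def cp_def r_eq fun_eq_iff)
    then have "bounded_Cn n (cq lam)" "bounded_Cn n (cp lam)"
      by (simp_all only:) (intro bounded_Cn_add bounded_Cn_cmult rho_n test_fun_bounded_Cn test bounded_Cn_const)+
    then show "bounded_Cn n b0" "bounded_Cn n b1" "bounded_Cn n b2"
      unfolding b0_def b1_def b2_def using test_fun_bounded_Cn[OF test] by (intro bounded_Cn_cmult; simp)+
  qed
  have "\<psi>4 \<in> L2"
  proof -
    have "\<psi>4 = (\<lambda>x. b0 x * \<psi> x + (b1 x * \<psi>1 x + b2 x * \<psi>2 x))" using ode by blast
    moreover have "(\<lambda>x. b x * f x) \<in> L2" if "bounded_Cn 0 b" "f \<in> L2" for b f :: "real \<Rightarrow> real"
      using that L2_mult_bounded[of f b] by auto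
    ultimately show ?thesis using bn[of 0] \<psi>(7-9) by (auto intro!: L2_add)
  qed
  \<comment> \<open>\<open>\<psi>3\<close> does not occur in the equation, so its integrability
    comes from interpolation between \<open>\<psi>2\<close> and \<open>\<psi>4\<close>.\<close>
  then have "\<psi>3 \<in> L2" by (rule L2_interpolate[OF \<psi>(3,4,5,9)])
  define J where "J = (LINT x|lborel. rho x * (k\<^sup>2 * (\<psi> x)\<^sup>2 + (\<psi>1 x)\<^sup>2))"
  have "J > 0"
  proof -
    have X: "C2_L2 \<psi> \<psi>1 \<psi>2" using \<psi> cont by (simp add: C2_L2_def)
    note X' = C2_L2_imp_C2_H2[OF X]
    have "J = Rk \<psi>" by (simp add: J_def Rk_def X')
    moreover obtain x0 where "\<psi> x0 \<noteq> 0" using \<psi>(10) by blast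
    then have "N0 \<psi> > 0" unfolding N0_def by (rule LINT_square_pos[OF cont(1) \<psi>(7)])
    then have "(INF x. rho x) * k\<^sup>2 * N0 \<psi> > 0" using rho_inf k by simp
    ultimately show ?thesis using functional_bounds(1)[OF X'(1)] by linarith
  qed
  \<comment> \<open>The minimizing sequence was normalised in H^2, whereas \<open>A_set\<close> asks
    for weighted energy 1; the equation is linear, so the solution may be rescaled.\<close>
  define s where "s = inverse (sqrt J)"
  have s: "s > 0" "s\<^sup>2 * J = 1" using \<open>J > 0\<close> by (auto simp: s_def power_inverse)
  define \<Psi> where "\<Psi> = (\<lambda>x. s * \<psi> x)"
  have d: "(\<Psi> has_real_derivative s * \<psi>1 x) (at x)" "((\<lambda>x. s * \<psi>1 x) has_real_derivative s * \<psi>2 x) (at x)"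
    "((\<lambda>x. s * \<psi>2 x) has_real_derivative s * \<psi>3 x) (at x)" "((\<lambda>x. s * \<psi>3 x) has_real_derivative s * \<psi>4 x) (at x)" for x
    unfolding \<Psi>_def by (auto intro!: derivative_eq_intros \<psi>)
  have D: "deriv \<Psi> = (\<lambda>x. s * \<psi>1 x)" "deriv (\<lambda>x. s * \<psi>1 x) = (\<lambda>x. s * \<psi>2 x)"
    "deriv (\<lambda>x. s * \<psi>2 x) = (\<lambda>x. s * \<psi>3 x)" "deriv (\<lambda>x. s * \<psi>3 x) = (\<lambda>x. s * \<psi>4 x)"
    using d DERIV_imp_deriv by blast+
  have D2: "(deriv ^^ 2) \<Psi> = (\<lambda>x. s * \<psi>2 x)" and D4: "(deriv ^^ 4) \<Psi> = (\<lambda>x. s * \<psi>4 x)"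
    by (simp_all add: eval_nat_numeral D)
  have L2: "\<Psi> \<in> L2" "(\<lambda>x. s * \<psi>1 x) \<in> L2" "(\<lambda>x. s * \<psi>2 x) \<in> L2" "(\<lambda>x. s * \<psi>3 x) \<in> L2"
    unfolding \<Psi>_def using \<psi>(7-9) \<open>\<psi>3 \<in> L2\<close> by (auto intro!: L2_cmult)
  have ode_s: "s * \<psi>4 x = b0 x * \<Psi> x + (b1 x * (s * \<psi>1 x) + b2 x * (s * \<psi>2 x))" for x
    unfolding ode by (simp add: \<Psi>_def algebra_simps)
  have nL2: "ndiff (\<lambda>f. f \<in> L2) n \<Psi>" for n
    by (rule linear_ODE_bootstrap[OF d L2 ode_s bn])
  have Cinf: "C_inf \<Psi>" unfolding C_inf_iff_ndiff by (intro allI ndiff_mono[OF nL2] TrueI)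
  have Hn: "\<Psi> \<in> H n" for n by (rule ndiff_L2_in_H[OF Cinf nL2])
  have cs: "continuous_on UNIV \<Psi>" "continuous_on UNIV (\<lambda>x. s * \<psi>1 x)" "continuous_on UNIV (\<lambda>x. s * \<psi>2 x)"
    unfolding \<Psi>_def by (intro continuous_intros cont)+
  have "nonzero_fun \<Psi>"
    unfolding nonzero_fun_def
  proof
    assume "AE x in lborel. \<Psi> x = 0"
    then have "\<Psi> x = 0" for x by (rule AE_zero_continuous[OF cs(1)])
    then show False using \<psi>(10) s(1) by (simp add: \<Psi>_def)
  qed
  moreover have "- (lam\<^sup>2) * (rho x * (norm \<xi>)\<^sup>2 * \<Psi> x - deriv (\<lambda>y. rho y * deriv \<Psi> y) x)
          = lam * \<mu> * ((norm \<xi>)^4 * \<Psi> x - 2 * (norm \<xi>)\<^sup>2 * (deriv ^^ 2) \<Psi> x + (deriv ^^ 4) \<Psi> x)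
            - g * (norm \<xi>)\<^sup>2 * deriv rho x * \<Psi> x + mag_term c M \<xi> \<Psi> x" for x
  proof -
    have "((\<lambda>y. rho y * (s * \<psi>1 y)) has_real_derivative deriv rho x * (s * \<psi>1 x) + rho x * (s * \<psi>2 x)) (at x)"
      by (auto intro!: derivative_eq_intros rd \<psi>(2) simp: algebra_simps)
    then have e: "deriv (\<lambda>y. rho y * deriv \<Psi> y) x = deriv rho x * (s * \<psi>1 x) + rho x * (s * \<psi>2 x)"
      unfolding D by (rule DERIV_imp_deriv)
    have mag: "mag_term c M \<xi> \<Psi> x = A2 * (s * \<psi>4 x) - A1 * (s * \<psi>2 x) + A0 * (s * \<psi> x)"
      unfolding mag_term_def D2 D4 A2_def A1_def A0_def k_def
      by (cases c) (simp_all add: \<Psi>_def algebra_simps)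
    have "s * (ca lam * \<psi>4 x) = s * (lam\<^sup>2 * deriv rho x * \<psi>1 x + cp lam x * \<psi>2 x - cq lam x * \<psi> x)"
      using \<psi>(6)[of x] by simp
    then show ?thesis
      unfolding e mag D2 D4 k_def[symmetric] by (simp add: \<Psi>_def ca_def cp_def cq_def r_eq algebra_simps)
  qed
  moreover have "\<Psi> \<in> A_set rho \<xi>"
  proof -
    have w: "is_wderiv \<Psi> (\<lambda>x. s * \<psi>1 x)" by (rule is_wderiv_C1[OF d(1) cs(2)])
    note w' = is_wderiv_wd[OF w]
    note [measurable] = is_wderiv_measurable[OF w'] cs(1,2)[THEN borel_measurable_continuous_onI]
      borel_measurable_continuous_onI[OF rho_cont]
    \<comment> \<open>\<open>wd\<close> is a chosen weak derivative, known to equal the classical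
      one only almost everywhere.\<close>
    have "(LINT x|lborel. rho x * ((norm \<xi>)\<^sup>2 * (\<Psi> x)\<^sup>2 + \<bar>wd \<Psi> x\<bar>\<^sup>2)) = (LINT x|lborel. rho x * (k\<^sup>2 * (\<Psi> x)\<^sup>2 + (s * \<psi>1 x)\<^sup>2))"
      using is_wderiv_unique[OF w' w] by (intro integral_cong_AE) (auto elim!: eventually_mono simp: k_def)
    also have "\<dots> = (LINT x|lborel. s\<^sup>2 * (rho x * (k\<^sup>2 * (\<psi> x)\<^sup>2 + (\<psi>1 x)\<^sup>2)))"
      by (intro Bochner_Integration.integral_cong) (auto simp: \<Psi>_def power_mult_distrib algebra_simps)
    also have "\<dots> = 1" using s(2) by (simp add: J_def)
    finally show ?thesis using Hn by (simp add: A_set_def)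
  qed
  moreover have "\<Psi> \<in> H_inf" using Hn by (simp add: H_inf_def)
  ultimately show ?thesis
    using lam Cinf L2_C1_tendsto_0_at_top[OF d(1) cs(2) L2(1,2)] L2_C1_tendsto_0_at_bot[OF d(1) cs(2) L2(1,2)]
      L2_C1_tendsto_0_at_top[OF d(2) cs(3) L2(2,3)] L2_C1_tendsto_0_at_bot[OF d(2) cs(3) L2(2,3)]
    by (intro exI[of _ \<Psi>] exI[of _ lam]) (simp add: D(1))
qed

end
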